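(* For every $\mathbf f\in[L^2(\Omega)]^2$, there is a unique $(\mathbf u_h,p_h)\in V_h\times M_h$ such that $$(\nabla_w\mathbf u_h,\nabla_w\mathbf v)_h-(p_h,\operatorname{div}_w\mathbf v)_h=(\mathbf f,\mathbf v^0)\quad\forall\,\mathbf v\in V_h,$$ $$(\operatorname{div}_w\mathbf u_h,q_h)_h=0\quad\forall\,q_h\in M_h.$$
   Context: Let $\Omega\subset\mathbb R^2$ be a convex polygonal domain. Let $T_h$ be a shape-regular triangulation into triangles $K$. Fix an integer $k\ge0$. Local space: $W_{k,k+1}(K)=\{\{v^0,v^b\}: v^0\in P_k(K),\ v^b\in P_{k+1}(\partial K)\}$, where $P_{k+1}(\partial K)$ means polynomials of degree at most $k+1$ on each edge. The weak gradient $\nabla_wv\in[P_{k+1}(K)]^2$ is defined by $\int_K\nabla_wv\cdot\mathbf q=-\int_Kv^0\operatorname{div}\mathbf q+\int_{\partial K}v^b\mathbf q\cdot\mathbf n$ for all $\mathbf q\in[P_{k+1}(K)]^2$, taken row-wise for vectors. The weak divergence $\operatorname{div}_w\mathbf v\in P_{k+1}(K)$ is defined by $\int_K\operatorname{div}_w\mathbf v\,q=-\int_K\mathbf v^0\cdot\nabla q+\int_{\partial K}\mathbf v^b\cdot\mathbf n\,q$ for all $q\in P_{k+1}(K)$. Both are applied elementwise. $S_h^0$ is the set of weak functions with $v|_K\in W_{k,k+1}(K)$ for every $K$, $v^b$ single-valued on interior edges, and $v^b=0$ on $\partial\Omega$. $V_h=[S_h^0]^2$ and $M_h=\{q\in L^2_0(\Omega):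 q|_K\in P_k(K)\}$. $(u,v)_h=\sum_K\int_Kuv$ (for matrices, summed over entries), $\|u\|_h^2=(u,u)_h$, and $(\cdot,\cdot)$ is the $L^2(\Omega)$ inner product. *)

theory Defs
  imports "HOL-Analysis.Analysis"
begin

type_synonym pt = "real^2"

definition triangle :: "pt set \<Rightarrow> bool" where
  "triangle K \<longleftrightarrow> (\<exists>a b c. \<not> collinear {a, b, c} \<and> K = convex hull {a, b, c})"

definition verts :: "pt set \<Rightarrow> pt set" where
  "verts K = {x. x extreme_point_of K}"

definition edges :: "pt set \<Rightarrow> pt set set" where
  "edges K = {closed_segment a b | a b. a \<in> verts K \<and> b \<in> verts K \<and> a \<noteq> b}"

definition mesh_edges :: "pt set set \<Rightarrow> pt set set" where
  "mesh_edges T = (\<Union>K\<in>T. edges K)"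

definition triangulation :: "pt set \<Rightarrow> pt set set \<Rightarrow> bool" where
  "triangulation \<Omega> T \<longleftrightarrow> finite T \<and> T \<noteq> {} \<and> (\<forall>K\<in>T. triangle K) \<and> \<Union>T = closure \<Omega> \<and>
     (\<forall>K\<in>T. \<forall>K'\<in>T. K \<noteq> K' \<longrightarrow>
        K \<inter> K' = {} \<or>
        (\<exists>v. v \<in> verts K \<and> v \<in> verts K' \<and> K \<inter> K' = {v}) \<or>
        (\<exists>e. e \<in> edges K \<and> e \<in> edges K' \<and> K \<inter> K' = e))"

definition normal :: "pt set \<Rightarrow> pt set \<Rightarrow> pt" where
  "normal K e = (THE n. norm n = 1 \<and> (\<forall>x\<in>e. \<forall>y\<in>e. n \<bullet> (x - y) = 0) \<and>
                         (\<forall>y\<in>K. \<forall>x\<in>e. n \<bullet> (y - x) \<le> 0))"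

definition edge_int :: "pt set \<Rightarrow> (pt \<Rightarrow> real) \<Rightarrow> real" where
  "edge_int e g = (let (a, b) = (SOME (a, b). a \<noteq> b \<and> e = closed_segment a b)
                   in norm (b - a) * integral {0..1} (\<lambda>t::real. g (a + t *\<^sub>R (b - a))))"

definition poly2 :: "nat \<Rightarrow> (pt \<Rightarrow> real) set" where
  "poly2 k = {p. \<exists>c::nat \<Rightarrow> nat \<Rightarrow> real.
                 \<forall>x. p x = (\<Sum>i\<le>k. \<Sum>j\<le>k - i. c i j * (x$1)^i * (x$2)^j)}"

text \<open>P_k(K): polynomials restricted to K (extended by zero outside K, so that
  elements are determined uniquely by their values on K).\<close>
definition Pk :: "nat \<Rightarrow> pt set \<Rightarrow> (pt \<Rightarrow> real) set" where
  "Pk k K = {f. \<exists>p\<in>poly2 k. \<forall>x. f x = (if x \<in> K then p x else 0)}"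

definition vPk :: "nat \<Rightarrow> pt set \<Rightarrow> (pt \<Rightarrow> pt) set" where
  "vPk k K = {g. (\<lambda>x. g x $ 1) \<in> Pk k K \<and> (\<lambda>x. g x $ 2) \<in> Pk k K}"

definition Pedge :: "nat \<Rightarrow> pt set \<Rightarrow> (pt \<Rightarrow> real) set" where
  "Pedge k e = {f. (\<exists>a b. a \<noteq> b \<and> e = closed_segment a b \<and>
                    (\<exists>c::nat \<Rightarrow> real. \<forall>t\<in>{0..1}. f (a + t *\<^sub>R (b - a)) = (\<Sum>i\<le>k. c i * t^i))) \<and>
                 (\<forall>x. x \<notin> e \<longrightarrow> f x = 0)}"

definition grad2 :: "(pt \<Rightarrow> real) \<Rightarrow> pt \<Rightarrow> pt" where
  "grad2 q x = (\<chi> i. frechet_derivative q (at x) (axis i 1))"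

definition div2 :: "(pt \<Rightarrow> pt) \<Rightarrow> pt \<Rightarrow> real" where
  "div2 q x = (\<Sum>i\<in>UNIV. frechet_derivative q (at x) (axis i 1) $ i)"

definition vec2 :: "real \<Rightarrow> real \<Rightarrow> pt" where
  "vec2 a b = vector [a, b]"

text \<open>A scalar weak function: (v0, vb) with v0 K the interior part on element K and
  vb e the boundary part on the (global) edge e; single-valuedness on interior edges
  is built in by indexing vb by global edges.\<close>
type_synonym wfun = "(pt set \<Rightarrow> pt \<Rightarrow> real) \<times> (pt set \<Rightarrow> pt \<Rightarrow> real)"

definition Sh0 :: "pt set \<Rightarrow> pt set set \<Rightarrow> nat \<Rightarrow> wfun set" where
  "Sh0 \<Omega> T k = {(v0, vb).
      (\<forall>K\<in>T. v0 K \<in> Pk k K) \<and> (\<forall>K. K \<notin> T \<longrightarrow> v0 K = (\<lambda>x. 0)) \<and>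
      (\<forall>e\<in>mesh_edges T. vb e \<in> Pedge (k + 1) e) \<and>
      (\<forall>e. e \<notin> mesh_edges T \<longrightarrow> vb e = (\<lambda>x. 0)) \<and>
      (\<forall>e\<in>mesh_edges T. e \<subseteq> frontier \<Omega> \<longrightarrow> vb e = (\<lambda>x. 0))}"

definition Vh :: "pt set \<Rightarrow> pt set set \<Rightarrow> nat \<Rightarrow> (wfun \<times> wfun) set" where
  "Vh \<Omega> T k = Sh0 \<Omega> T k \<times> Sh0 \<Omega> T k"

definition Mh :: "pt set set \<Rightarrow> nat \<Rightarrow> (pt set \<Rightarrow> pt \<Rightarrow> real) set" where
  "Mh T k = {q. (\<forall>K\<in>T. q K \<in> Pk k K) \<and> (\<forall>K. K \<notin> T \<longrightarrow> q K = (\<lambda>x. 0)) \<and>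
               (\<Sum>K\<in>T. integral K (q K)) = 0}"

definition wgrad :: "nat \<Rightarrow> pt set \<Rightarrow> wfun \<Rightarrow> pt \<Rightarrow> pt" where
  "wgrad k K v = (THE g. g \<in> vPk (k + 1) K \<and>
     (\<forall>q. (\<lambda>x. q x $ 1) \<in> poly2 (k + 1) \<and> (\<lambda>x. q x $ 2) \<in> poly2 (k + 1) \<longrightarrow>
        integral K (\<lambda>x. g x \<bullet> q x) =
          - integral K (\<lambda>x. fst v K x * div2 q x)
          + (\<Sum>e\<in>edges K. edge_int e (\<lambda>x. snd v e x * (q x \<bullet> normal K e)))))"

definition wdiv :: "nat \<Rightarrow> pt set \<Rightarrow> wfun \<times> wfun \<Rightarrow> pt \<Rightarrow> real" where
  "wdiv k K v = (THE d. d \<in> Pk (k + 1) K \<and>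
     (\<forall>q\<in>poly2 (k + 1).
        integral K (\<lambda>x. d x * q x) =
          - integral K (\<lambda>x. vec2 (fst (fst v) K x) (fst (snd v) K x) \<bullet> grad2 q x)
          + (\<Sum>e\<in>edges K. edge_int e
               (\<lambda>x. (vec2 (snd (fst v) e x) (snd (snd v) e x) \<bullet> normal K e) * q x))))"

definition ah :: "nat \<Rightarrow> pt set set \<Rightarrow> wfun \<times> wfun \<Rightarrow> wfun \<times> wfun \<Rightarrow> real" where
  "ah k T u v = (\<Sum>K\<in>T. integral K (\<lambda>x.
       wgrad k K (fst u) x \<bullet> wgrad k K (fst v) x + wgrad k K (snd u) x \<bullet> wgrad k K (snd v) x))"

definition bh :: "nat \<Rightarrow> pt set set \<Rightarrow> (pt set \<Rightarrow> pt \<Rightarrow> real) \<Rightarrow> wfun \<times> wfun \<Rightarrow> real" where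
  "bh k T p v = (\<Sum>K\<in>T. integral K (\<lambda>x. p K x * wdiv k K v x))"

definition rhs :: "pt set set \<Rightarrow> (pt \<Rightarrow> pt) \<Rightarrow> wfun \<times> wfun \<Rightarrow> real" where
  "rhs T f v = (\<Sum>K\<in>T. integral K (\<lambda>x. f x \<bullet> vec2 (fst (fst v) K x) (fst (snd v) K x)))"

end

theory Submission
  imports Defs "HOL-Library.Function_Algebras"
begin

text \<open>The discrete problem is a square linear system on the finite-dimensional space
  \<open>V\<^sub>h \<times> M\<^sub>h\<close>, so only injectivity matters. Testing with the solution itself kills the
  weak gradient of the velocity. On one triangle with barycentric coordinates \<open>\<lambda>\<^sub>a, \<lambda>\<^sub>b, \<lambda>\<^sub>c\<close>,
  the fields \<open>\<lambda>\<^sub>a \<lambda>\<^sub>b r (b - a)\<close> have no normal component on the boundary and show that \<open>v0\<close> is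
  constant; the fields \<open>\<lambda>\<^sub>a r (c - a)\<close>, whose normal component lives on the edge \<open>a b\<close> alone, then
  show that \<open>vb\<close> is the same constant. Any two triangles are joined by a chain of triangles that
  share edges, and some edge lies on the boundary, so the velocity vanishes. For the pressure no
  quantitative inf-sup condition is needed: \<open>v0 = \<nabla>p\<close> makes it piecewise constant, \<open>vb\<close> equal to the
  normal of one interior edge makes its jump there vanish, and the zero mean does the rest.\<close>

section \<open>Linear algebra in spaces of functions\<close>

text \<open>The degrees make the scheme well posed without a penalty term. Test fields of the weak
  gradient have degree up to \<open>k + 1\<close>: two barycentric factors times a derivative of the
  interior part give \<open>2 + (k - 1)\<close>, one factor times a polynomial of degree
  \<open>k\<close> gives \<open>1 + k\<close>. An edge value has \<open>k + 2\<close> coefficients,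
  while the fields attached to one endpoint test only \<open>k + 1\<close> of them, so both
  endpoints are used. The obstacle to plain linear algebra is that the forms are built from
  integrals and definite descriptions: they are known to be linear only on the finite element
  spaces, not on the surrounding function type. One solvability lemma for forms on a subspace serves
  both levels, the existence of the weak operators on a triangle and the global system. Convexity of
  the domain enters geometrically: \<open>interior (closure \<Omega>)\<close> is
  \<open>\<Omega>\<close>, a mesh edge with a boundary point strictly between its endpoints lies in
  the boundary, and the midpoint of a shared edge lies in the domain.\<close>

instantiation "fun" :: (type, real_vector) real_vector
begin

definition "scaleR c f = (\<lambda>x. c *\<^sub>R f x)"

instance
  by standard (simp_all add: scaleR_fun_def fun_eq_iff scaleR_add_right scaleR_add_left)

end

lemma scaleR_fun_apply [simp]: "(c *\<^sub>R f) x = c *\<^sub>R f x"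
  by (simp add: scaleR_fun_def)

lemma sum_fun_apply: "(\<Sum>i\<in>I. f i) x = (\<Sum>i\<in>I. f i x)"
  by (induction I rule: infinite_finite_induct) auto

text \<open>The set need not be a subspace, so the property passes to subsets and a crude enclosing
  product of local spaces is enough to bound the global ones.\<close>

definition fin_dim :: "'a::real_vector set \<Rightarrow> bool" where
  "fin_dim X \<longleftrightarrow> (\<exists>S. finite S \<and> X \<subseteq> span S)"

lemma fin_dim_subset: "fin_dim Y \<Longrightarrow> X \<subseteq> Y \<Longrightarrow> fin_dim X"
  unfolding fin_dim_def by blast

lemma fin_dim_linear_image:
  assumes "linear g" "fin_dim X"
  shows "fin_dim (g ` X)"
proof -
  obtain S where "finite S" "X \<subseteq> span S" using assms(2) fin_dim_def by blast
  then show ?thesis unfolding fin_dim_def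
    by (intro exI[of _ "g ` S"]) (auto simp: linear_span_image[OF assms(1)])
qed

lemma fin_dim_span_UN:
  assumes "finite I" "\<And>i. i \<in> I \<Longrightarrow> fin_dim (X i)"
  shows "fin_dim (span (\<Union>i\<in>I. X i))"
proof -
  have "\<forall>i\<in>I. \<exists>S. finite S \<and> X i \<subseteq> span S" using assms(2) by (auto simp: fin_dim_def)
  then obtain S where S: "\<And>i. i \<in> I \<Longrightarrow> finite (S i) \<and> X i \<subseteq> span (S i)" by metis
  have "(\<Union>i\<in>I. X i) \<subseteq> span (\<Union>i\<in>I. S i)"
  proof clarify
    fix i x assume "i \<in> I" "x \<in> X i"
    then have "x \<in> span (S i)" using S by blast
    moreover have "span (S i) \<subseteq> span (\<Union>i\<in>I. S i)"
      using \<open>i \<in> I\<close> by (intro span_mono) blast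
    ultimately show "x \<in> span (\<Union>i\<in>I. S i)" by blast
  qed
  then have "span (\<Union>i\<in>I. X i) \<subseteq> span (\<Union>i\<in>I. S i)" by (simp add: span_minimal)
  moreover have "finite (\<Union>i\<in>I. S i)" using S assms(1) by blast
  ultimately show ?thesis unfolding fin_dim_def by blast
qed

lemma fin_dim_Times:
  assumes "fin_dim X" "fin_dim Y"
  shows "fin_dim (X \<times> Y)"
proof -
  let ?Z = "\<lambda>i::bool. if i then (\<lambda>x. (x, 0)) ` X else (\<lambda>y. (0, y)) ` Y"
  have "linear (\<lambda>x. (x::'a, 0::'b))" "linear (\<lambda>y. (0::'a, y::'b))"
    by (auto intro!: linearI)
  then have "fin_dim (span (\<Union>i\<in>UNIV. ?Z i))"
    using assms by (intro fin_dim_span_UN) (auto intro: fin_dim_linear_image)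
  moreover have "X \<times> Y \<subseteq> span (\<Union>i\<in>UNIV. ?Z i)"
  proof clarify
    fix x y assume "x \<in> X" "y \<in> Y"
    then have "(x, 0) + (0, y) \<in> span (\<Union>i\<in>UNIV. ?Z i)"
      by (intro span_add span_base) (auto intro: exI[of _ True] exI[of _ False])
    then show "(x, y) \<in> span (\<Union>i\<in>UNIV. ?Z i)" by simp
  qed
  ultimately show ?thesis by (rule fin_dim_subset)
qed

text \<open>A family supported on the finite index set is the sum of its one-point parts, each in a
  linear copy of some \<open>X i\<close>.\<close>

lemma fin_dim_families:
  assumes "finite I" "\<And>i. i \<in> I \<Longrightarrow> fin_dim (X i)"
  shows "fin_dim {f. (\<forall>i\<in>I. f i \<in> X i) \<and> (\<forall>i. i \<notin> I \<longrightarrow> f i = 0)}"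
proof -
  let ?s = "\<lambda>i y. (\<lambda>j. if j = i then y else 0)"
  have "linear (?s i :: 'b \<Rightarrow> 'a \<Rightarrow> 'b)" for i by (auto intro!: linearI simp: fun_eq_iff)
  then have fd: "fin_dim (span (\<Union>i\<in>I. ?s i ` X i))"
    using assms by (intro fin_dim_span_UN fin_dim_linear_image) auto
  have "f \<in> span (\<Union>i\<in>I. ?s i ` X i)"
    if f: "\<forall>i\<in>I. f i \<in> X i" "\<forall>i. i \<notin> I \<longrightarrow> f i = 0" for f
  proof -
    have "f = (\<Sum>i\<in>I. ?s i (f i))"
      using f(2) assms(1) by (auto simp: fun_eq_iff sum_fun_apply)
    moreover have "(\<Sum>i\<in>I. ?s i (f i)) \<in> span (\<Union>i\<in>I. ?s i ` X i)"
      using f(1) by (intro span_sum span_base) auto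
    ultimately show ?thesis by simp
  qed
  then show ?thesis by (intro fin_dim_subset[OF fd]) auto
qed

text \<open>Stands in for linearity of \<open>L\<close> on the whole type, which fails to be
  available for maps defined by integrals of arbitrary functions.\<close>

lemma sum_on_subspace:
  fixes L :: "'a::real_vector \<Rightarrow> 'b::real_vector"
  assumes X: "subspace X"
    and add: "\<And>x y. x \<in> X \<Longrightarrow> y \<in> X \<Longrightarrow> L (x + y) = L x + L y"
    and scale: "\<And>c x. x \<in> X \<Longrightarrow> L (c *\<^sub>R x) = c *\<^sub>R L x"
    and S: "finite S" "S \<subseteq> X"
  shows "L (\<Sum>b\<in>S. c b *\<^sub>R b) = (\<Sum>b\<in>S. c b *\<^sub>R L b)"
  using S
proof (induction S rule: finite_induct)
  case empty
  have "L (0 *\<^sub>R 0) = 0 *\<^sub>R L 0" by (rule scale) (use X in \<open>simp add: subspace_0\<close>)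
  then show ?case by simp
next
  case (insert a S)
  have "a \<in> X" and "(\<Sum>b\<in>S. c b *\<^sub>R b) \<in> X"
    using insert.prems X by (auto intro!: subspace_sum subspace_scale)
  then have "L (c a *\<^sub>R a + (\<Sum>b\<in>S. c b *\<^sub>R b)) = c a *\<^sub>R L a + L (\<Sum>b\<in>S. c b *\<^sub>R b)"
    using X by (simp add: add scale subspace_scale)
  then show ?case using insert by simp
qed

text \<open>Expanding in a basis \<open>S\<close> turns the form into the endomorphism
  \<open>x \<mapsto> \<Sum>b\<in>S. B x b *\<^sub>R b\<close>, which is injective by nondegeneracy, hence surjective.\<close>

lemma nondegenerate_form_ex1:
  fixes B :: "'a::real_vector \<Rightarrow> 'a \<Rightarrow> real"
  assumes X: "subspace X" "fin_dim X"
    and B1: "\<And>x y z. x \<in> X \<Longrightarrow> y \<in> X \<Longrightarrow> z \<in> X \<Longrightarrow> B (x + y) z = B x z + B y z"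
    and B2: "\<And>c x z. x \<in> X \<Longrightarrow> z \<in> X \<Longrightarrow> B (c *\<^sub>R x) z = c * B x z"
    and B3: "\<And>x y z. x \<in> X \<Longrightarrow> y \<in> X \<Longrightarrow> z \<in> X \<Longrightarrow> B z (x + y) = B z x + B z y"
    and B4: "\<And>c x z. x \<in> X \<Longrightarrow> z \<in> X \<Longrightarrow> B z (c *\<^sub>R x) = c * B z x"
    and L1: "\<And>x y. x \<in> X \<Longrightarrow> y \<in> X \<Longrightarrow> L (x + y) = L x + L y"
    and L2: "\<And>c x. x \<in> X \<Longrightarrow> L (c *\<^sub>R x) = c * L x"
    and nondeg: "\<And>x. x \<in> X \<Longrightarrow> (\<And>y. y \<in> X \<Longrightarrow> B x y = 0) \<Longrightarrow> x = 0"
  shows "\<exists>!x. x \<in> X \<and> (\<forall>y\<in>X. B x y = L y)"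
proof -
  obtain S where S: "S \<subseteq> X" "independent S" "X \<subseteq> span S"
    using maximal_independent_subset[of X] by blast
  have spanS: "span S = X" using S X(1) by (metis span_subspace)
  obtain F where F: "finite F" "X \<subseteq> span F" using X(2) fin_dim_def by blast
  have finS: "finite S" using independent_span_bound[OF F(1) S(2)] S(1) F(2) by auto
  have expand: "\<exists>c. x = (\<Sum>b\<in>S. c b *\<^sub>R b)" if "x \<in> X" for x
    using that spanS finS unfolding span_finite[OF finS] by auto
  have X_sum: "(\<Sum>b\<in>S. c b *\<^sub>R b) \<in> X" for c
    using S(1) X(1) by (auto intro!: subspace_sum subspace_scale)
  have eq_on_basis: "(\<forall>y\<in>X. B x y = L y) \<longleftrightarrow> (\<forall>b\<in>S. B x b = L b)" if x: "x \<in> X" for x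
  proof
    assume *: "\<forall>b\<in>S. B x b = L b"
    show "\<forall>y\<in>X. B x y = L y"
    proof
      fix y assume "y \<in> X"
      then obtain c where y: "y = (\<Sum>b\<in>S. c b *\<^sub>R b)" using expand by blast
      have "B x y = (\<Sum>b\<in>S. c b *\<^sub>R B x b)"
        unfolding y using B3[OF _ _ x] B4[OF _ x] finS S(1) X(1) by (intro sum_on_subspace) auto
      moreover have "L y = (\<Sum>b\<in>S. c b *\<^sub>R L b)"
        unfolding y using L1 L2 finS S(1) X(1) by (intro sum_on_subspace) auto
      ultimately show "B x y = L y" using * by simp
    qed
  qed (use S(1) in auto)
  \<comment> \<open>The extension to the whole type is arbitrary off \<open>span S\<close>; only the
    values on \<open>X\<close> are used, where \<open>g\<close> is the endomorphism induced by
    \<open>B\<close>.\<close>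
  obtain g where g: "linear g" "\<forall>a\<in>S. g a = (\<Sum>b\<in>S. B a b *\<^sub>R b)"
    using linear_independent_extend[OF S(2), of "\<lambda>a. \<Sum>b\<in>S. B a b *\<^sub>R b"] by blast
  have g_eq: "g x = (\<Sum>b\<in>S. B x b *\<^sub>R b)" if "x \<in> X" for x
  proof -
    obtain c where x: "x = (\<Sum>a\<in>S. c a *\<^sub>R a)" using expand \<open>x \<in> X\<close> by blast
    have "B x b = (\<Sum>a\<in>S. c a *\<^sub>R B a b)" if "b \<in> S" for b
      unfolding x using B1[of _ _ b] B2[of _ b] finS S(1) X(1) that
      by (intro sum_on_subspace[where L = "\<lambda>x. B x b"]) auto
    then have "(\<Sum>b\<in>S. B x b *\<^sub>R b) = (\<Sum>b\<in>S. \<Sum>a\<in>S. (c a * B a b) *\<^sub>R b)"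
      by (auto intro!: sum.cong simp: scaleR_sum_left)
    also have "\<dots> = (\<Sum>a\<in>S. c a *\<^sub>R g a)"
      by (subst sum.swap) (auto intro!: sum.cong simp: g(2) scaleR_sum_right)
    also have "\<dots> = g x" unfolding x by (simp add: linear_sum[OF g(1)] linear_scale[OF g(1)])
    finally show ?thesis by simp
  qed
  have coeffs: "(\<forall>b\<in>S. c b = d b)" if "(\<Sum>b\<in>S. c b *\<^sub>R b) = (\<Sum>b\<in>S. d b *\<^sub>R b)" for c d
  proof -
    have "(\<Sum>b\<in>S. (c b - d b) *\<^sub>R b) = 0" using that by (simp add: scaleR_diff_left sum_subtractf)
    then have "\<forall>b\<in>S. c b - d b = 0" 
      using S(2) finS independentD[OF S(2) finS order_refl, of "\<lambda>b. c b - d b"] by blast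
    then show ?thesis by simp
  qed
  \<comment> \<open>Equal images have equal coefficients in the basis, so the difference pairs to
    zero with every basis vector and hence with all of \<open>X\<close>.\<close>
  have inj: "inj_on g X"
  proof (rule inj_onI)
    fix x y assume xy: "x \<in> X" "y \<in> X" "g x = g y"
    have "B (x + (-1) *\<^sub>R y) b = 0" if "b \<in> S" for b
    proof -
      have "b \<in> X" using that S(1) by blast
      then have "B (x + (-1) *\<^sub>R y) b = B x b + (-1) * B y b"
        using B1[of x "(-1) *\<^sub>R y" b] B2[of y b "-1"] xy X(1) subspace_scale by metis
      then show ?thesis
        using coeffs[of "B x" "B y"] xy g_eq that by simp
    qed
    moreover have xyX: "x + (-1) *\<^sub>R y \<in> X" using xy X(1) by (simp add: subspace_diff)
    ultimately have z: "B (x + (-1) *\<^sub>R y) z = 0" if zX: "z \<in> X" for z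
    proof -
      obtain c where z: "z = (\<Sum>b\<in>S. c b *\<^sub>R b)" using expand zX by blast
      have "B (x + (-1) *\<^sub>R y) z = (\<Sum>b\<in>S. c b *\<^sub>R B (x + (-1) *\<^sub>R y) b)"
        unfolding z using B3[OF _ _ xyX] B4[OF _ xyX] finS S(1) X(1)
        by (intro sum_on_subspace) auto
      then show ?thesis using \<open>\<And>b. b \<in> S \<Longrightarrow> B (x + (-1) *\<^sub>R y) b = 0\<close> by simp
    qed
    have "x + (-1) *\<^sub>R y = 0" using nondeg[OF xyX z] .
    then show "x = y" by simp
  qed
  have inj_span: "inj_on g (span S)" using inj spanS by simp
  have indep: "independent (g ` S)"
    using linear_independent_injective_image[OF g(1) S(2) inj_span] .
  have gS: "g ` S \<subseteq> span S" using g_eq X_sum spanS S(1) by auto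
  have card: "card (g ` S) = card S" using inj S(1) by (meson card_image inj_on_subset)
  \<comment> \<open>The image of the basis is independent and has \<open>card S\<close> elements; a
    vector outside its span would give an independent set of \<open>card S + 1\<close> elements
    inside \<open>span S\<close>.\<close>
  have surj: "X \<subseteq> span (g ` S)"
  proof
    fix y assume y: "y \<in> X"
    show "y \<in> span (g ` S)"
    proof (rule ccontr)
      have sub: "insert y (g ` S) \<subseteq> span S" using gS y spanS by blast
      assume ny: "y \<notin> span (g ` S)"
      then have "independent (insert y (g ` S))" using indep by (rule independent_insertI)
      then have "card (insert y (g ` S)) \<le> card S"
        using independent_span_bound[OF finS _ sub] by blast
      moreover have "y \<notin> g ` S" using ny span_base[of y "g ` S"] by argo
      ultimately show False using card finS by simp
    qed
  qed
  \<comment> \<open>The functional is encoded as the vector with coefficients \<open>L b\<close>; a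
    preimage of it under \<open>g\<close> is exactly a solution.\<close>
  have "(\<Sum>b\<in>S. L b *\<^sub>R b) \<in> g ` span S"
    using surj X_sum linear_span_image[OF g(1), of S] by auto
  then obtain x where x: "x \<in> X" "g x = (\<Sum>b\<in>S. L b *\<^sub>R b)" using spanS by auto
  show ?thesis
  proof (rule ex1I[of _ x])
    show "x \<in> X \<and> (\<forall>y\<in>X. B x y = L y)"
      using x coeffs[of "B x" L] g_eq[OF x(1)] eq_on_basis[OF x(1)] by auto
  next
    fix x' assume x': "x' \<in> X \<and> (\<forall>y\<in>X. B x' y = L y)"
    then have "B x' b = L b" if "b \<in> S" for b using S(1) that by blast
    then have "g x' = g x" using x(2) g_eq[of x'] x' by simp
    then show "x' = x" using inj x(1) x' by (meson inj_onD)
  qed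
qed

section \<open>Polynomials in the plane\<close>

text \<open>Replaces the triangular coefficient sum by a span, so that linear statements about
  polynomials can be proved by induction on monomials.\<close>

lemma poly2_eq_span:
  "poly2 k = span {(\<lambda>x. x$1 ^ i * x$2 ^ j) | i j. i + j \<le> k}" (is "_ = span ?M")
proof
  show "poly2 k \<subseteq> span ?M"
  proof
    fix p assume "p \<in> poly2 k"
    then obtain c where c: "\<And>x. p x = (\<Sum>i\<le>k. \<Sum>j\<le>k - i. c i j * (x$1)^i * (x$2)^j)"
      by (auto simp: poly2_def)
    have "p = (\<Sum>i\<le>k. \<Sum>j\<le>k - i. c i j *\<^sub>R (\<lambda>x. x$1 ^ i * x$2 ^ j))"
      by (simp add: fun_eq_iff c sum_fun_apply mult.assoc)
    also have "\<dots> \<in> span ?M"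
    proof (intro span_sum span_scale span_base)
      fix i j assume "i \<in> {..k}" "j \<in> {..k - i}"
      then have "i + j \<le> k" by simp
      then show "(\<lambda>x::pt. x$1 ^ i * x$2 ^ j) \<in> ?M" by blast
    qed
    finally show "p \<in> span ?M" .
  qed
  have "subspace (poly2 k)"
  proof (rule subspaceI)
    show "0 \<in> poly2 k" by (auto simp: poly2_def intro!: exI[of _ "\<lambda>i j. 0"])
    fix p q assume "p \<in> poly2 k" "q \<in> poly2 k"
    then obtain c d where "\<And>x. p x = (\<Sum>i\<le>k. \<Sum>j\<le>k - i. c i j * (x$1)^i * (x$2)^j)"
      and "\<And>x. q x = (\<Sum>i\<le>k. \<Sum>j\<le>k - i. d i j * (x$1)^i * (x$2)^j)"
      unfolding poly2_def by blast
    then show "p + q \<in> poly2 k"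
      unfolding poly2_def
      by (intro CollectI exI[of _ "\<lambda>i j. c i j + d i j"]) (simp add: sum.distrib distrib_right)
  next
    fix r p assume "p \<in> poly2 k"
    then obtain c where "\<And>x. p x = (\<Sum>i\<le>k. \<Sum>j\<le>k - i. c i j * (x$1)^i * (x$2)^j)"
      unfolding poly2_def by blast
    then show "r *\<^sub>R p \<in> poly2 k"
      unfolding poly2_def
      by (intro CollectI exI[of _ "\<lambda>i j. r * c i j"]) (simp add: sum_distrib_left mult.assoc)
  qed
  moreover have "?M \<subseteq> poly2 k"
  proof clarify
    fix i j assume ij: "i + j \<le> k"
    show "(\<lambda>x::pt. x$1 ^ i * x$2 ^ j) \<in> poly2 k"
      unfolding poly2_def
    proof (intro CollectI exI[of _ "\<lambda>i' j'. if i' = i then (if j' = j then 1 else 0) else 0"] allI)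
      fix x :: pt
      have "(\<Sum>i'\<le>k. \<Sum>j'\<le>k - i'. (if i' = i then (if j' = j then 1 else 0) else 0) * x$1 ^ i' * x$2 ^ j')
        = (\<Sum>i'\<le>k. if i' = i then (\<Sum>j'\<le>k - i. if j' = j then x$1 ^ i * x$2 ^ j else 0) else 0)"
        by (intro sum.cong refl) (auto simp: if_distrib[of "\<lambda>r. r * _"] mult.assoc cong: if_cong)
      also have "\<dots> = x$1 ^ i * x$2 ^ j" using ij by simp
      finally show "x$1 ^ i * x$2 ^ j = (\<Sum>i'\<le>k. \<Sum>j'\<le>k - i'.
        (if i' = i then (if j' = j then 1 else 0) else 0) * x$1 ^ i' * x$2 ^ j')" ..
    qed
  qed
  ultimately show "span ?M \<subseteq> poly2 k" by (rule span_minimal[rotated])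
qed

lemma subspace_poly2 [simp]: "subspace (poly2 k)"
  by (simp add: poly2_eq_span)

lemma fin_dim_poly2 [simp]: "fin_dim (poly2 k)"
proof -
  have "{(\<lambda>x::pt. x$1 ^ i * x$2 ^ j) | i j. i + j \<le> k}
      \<subseteq> (\<lambda>(i, j) x. x$1 ^ i * x$2 ^ j) ` ({..k} \<times> {..k})"
    by force
  then have "finite {(\<lambda>x::pt. x$1 ^ i * x$2 ^ j) | i j. i + j \<le> k}"
    by (rule finite_subset) auto
  then show ?thesis unfolding fin_dim_def poly2_eq_span by blast
qed

lemma poly2_induct [consumes 1, case_names subspace monomial]:
  assumes "p \<in> poly2 k" "subspace (Collect P)"
    and "\<And>i j. i + j \<le> k \<Longrightarrow> P (\<lambda>x. x$1 ^ i * x$2 ^ j)"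
  shows "P p"
  using assms(1) unfolding poly2_eq_span
  by (rule span_induct) (use assms(2,3) in auto)

lemma monomial_poly2: "i + j \<le> k \<Longrightarrow> (\<lambda>x. x$1 ^ i * x$2 ^ j) \<in> poly2 k"
  unfolding poly2_eq_span by (intro span_base) blast

lemma poly2_mono: "m \<le> n \<Longrightarrow> poly2 m \<subseteq> poly2 n"
  unfolding poly2_eq_span by (intro span_mono) (auto intro: le_trans)

lemma poly2_const [simp]: "(\<lambda>x. c) \<in> poly2 k"
  using subspace_scale[OF subspace_poly2 monomial_poly2[of 0 0 k], of c]
  by (simp add: scaleR_fun_def)

lemma poly2_add: "p \<in> poly2 k \<Longrightarrow> q \<in> poly2 k \<Longrightarrow> (\<lambda>x. p x + q x) \<in> poly2 k"
  using subspace_add[OF subspace_poly2] by (simp add: plus_fun_def)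

lemma poly2_scale: "p \<in> poly2 k \<Longrightarrow> (\<lambda>x. c * p x) \<in> poly2 k"
  using subspace_scale[OF subspace_poly2] by (simp add: scaleR_fun_def)

lemma poly2_sum: "(\<And>i. i \<in> I \<Longrightarrow> p i \<in> poly2 k) \<Longrightarrow> (\<lambda>x. \<Sum>i\<in>I. p i x) \<in> poly2 k"
  by (induction I rule: infinite_finite_induct) (auto intro: poly2_add)

lemma poly2_affine: "(\<lambda>x. \<alpha> + \<beta> * x$1 + \<gamma> * x$2) \<in> poly2 1"
  using monomial_poly2[of 1 0 1] monomial_poly2[of 0 1 1]
  by (intro poly2_add poly2_scale) auto

lemma poly2_mult:
  assumes "p \<in> poly2 m" "q \<in> poly2 n"
  shows "(\<lambda>x. p x * q x) \<in> poly2 (m + n)"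
  using assms(1)
proof (induction rule: poly2_induct)
  case subspace
  show ?case
    by (rule subspaceI) (auto simp: distrib_right mult.assoc intro: poly2_add poly2_scale)
next
  case (monomial i j)
  show ?case using assms(2)
  proof (induction rule: poly2_induct)
    case subspace
    show ?case
      by (rule subspaceI) (auto simp: distrib_left mult.left_commute intro: poly2_add poly2_scale)
  next
    case (monomial i' j')
    then show ?case
      using monomial_poly2[of "i + i'" "j + j'" "m + n"] \<open>i + j \<le> m\<close>
      by (simp add: power_add mult_ac)
  qed
qed

lemma poly2_power: "p \<in> poly2 1 \<Longrightarrow> (\<lambda>x. p x ^ i) \<in> poly2 i"
  using poly2_mult[of p 1] by (induction i) auto

section \<open>Derivatives of plane polynomials and their restriction to lines\<close>

lemma poly2_has_derivative_ex:
  assumes "p \<in> poly2 k"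
  shows "\<exists>g1\<in>poly2 (k - 1). \<exists>g2\<in>poly2 (k - 1).
    \<forall>x. (p has_derivative (\<lambda>h. h$1 * g1 x + h$2 * g2 x)) (at x)"
  using assms
proof (induction rule: poly2_induct)
  case subspace
  show ?case
  proof (rule subspaceI; clarify)
    show "\<exists>g1\<in>poly2 (k - 1). \<exists>g2\<in>poly2 (k - 1).
        \<forall>x. (0 has_derivative (\<lambda>h. h$1 * g1 x + h$2 * g2 x)) (at x)"
      by (intro bexI[of _ "\<lambda>x. 0"]) (auto simp: zero_fun_def)
  next
    fix p q g1 g2 f1 f2
    assume "g1 \<in> poly2 (k - 1)" "g2 \<in> poly2 (k - 1)" "f1 \<in> poly2 (k - 1)" "f2 \<in> poly2 (k - 1)"
      and *: "\<forall>x. (p has_derivative (\<lambda>h. h$1 * g1 x + h$2 * g2 x)) (at x)"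
        "\<forall>x. (q has_derivative (\<lambda>h. h$1 * f1 x + h$2 * f2 x)) (at x)"
    moreover have "((\<lambda>x. p x + q x) has_derivative
        (\<lambda>h. h$1 * (g1 x + f1 x) + h$2 * (g2 x + f2 x))) (at x)" for x
      using has_derivative_add[OF *[rule_format]] by (simp add: algebra_simps)
    ultimately show "\<exists>g1\<in>poly2 (k - 1). \<exists>g2\<in>poly2 (k - 1).
        \<forall>x. (p + q has_derivative (\<lambda>h. h$1 * g1 x + h$2 * g2 x)) (at x)"
      unfolding plus_fun_def
      by (intro bexI[of _ "\<lambda>x. g1 x + f1 x"] bexI[of _ "\<lambda>x. g2 x + f2 x"]) (auto intro: poly2_add)
  next
    fix c p g1 g2
    assume "g1 \<in> poly2 (k - 1)" "g2 \<in> poly2 (k - 1)"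
      and *: "\<forall>x. (p has_derivative (\<lambda>h. h$1 * g1 x + h$2 * g2 x)) (at x)"
    moreover have "((\<lambda>x. c * p x) has_derivative
        (\<lambda>h. h$1 * (c * g1 x) + h$2 * (c * g2 x))) (at x)" for x
      using has_derivative_mult_right[OF *[rule_format], of c] by (simp add: algebra_simps)
    ultimately show "\<exists>g1\<in>poly2 (k - 1). \<exists>g2\<in>poly2 (k - 1).
        \<forall>x. (c *\<^sub>R p has_derivative (\<lambda>h. h$1 * g1 x + h$2 * g2 x)) (at x)"
      unfolding scaleR_fun_def real_scaleR_def
      by (intro bexI[of _ "\<lambda>x. c * g1 x"] bexI[of _ "\<lambda>x. c * g2 x"]) (auto intro: poly2_scale)
  qed
next
  case (monomial i j)
  let ?g1 = "\<lambda>x::pt. real i * (x$1 ^ (i - 1) * x$2 ^ j)"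
  let ?g2 = "\<lambda>x::pt. real j * (x$1 ^ i * x$2 ^ (j - 1))"
  have "?g1 \<in> poly2 (k - 1)"
    using monomial by (cases "i = 0") (auto intro!: poly2_scale monomial_poly2)
  moreover have "?g2 \<in> poly2 (k - 1)"
    using monomial by (cases "j = 0") (auto intro!: poly2_scale monomial_poly2)
  moreover have "((\<lambda>x::pt. x$1 ^ i * x$2 ^ j) has_derivative (\<lambda>h. h$1 * ?g1 x + h$2 * ?g2 x)) (at x)" for x
  proof -
    have nth: "((\<lambda>x::pt. x$n) has_derivative (\<lambda>h. h$n)) (at x)" for n
      by (simp add: bounded_linear_imp_has_derivative bounded_linear_vec_nth)
    show ?thesis
      by (rule has_derivative_eq_rhs[OF has_derivative_mult[OF has_derivative_power[OF nth]
            has_derivative_power[OF nth]]]) (simp add: algebra_simps fun_eq_iff)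
  qed
  ultimately show ?case by (intro bexI[of _ ?g1] bexI[of _ ?g2] allI)
qed

lemma poly2_differentiable: "p \<in> poly2 k \<Longrightarrow> p differentiable (at x)"
  using poly2_has_derivative_ex[of p k] unfolding differentiable_def by blast

lemma poly2_has_derivative:
  "p \<in> poly2 k \<Longrightarrow> (p has_derivative frechet_derivative p (at x)) (at x)"
  using poly2_differentiable frechet_derivative_works by blast

lemma poly2_derivative:
  assumes "p \<in> poly2 k"
  shows "(\<lambda>x. frechet_derivative p (at x) d) \<in> poly2 (k - 1)"
proof -
  obtain g1 g2 where g: "g1 \<in> poly2 (k - 1)" "g2 \<in> poly2 (k - 1)"
    "\<And>x. (p has_derivative (\<lambda>h. h$1 * g1 x + h$2 * g2 x)) (at x)"
    using poly2_has_derivative_ex[OF assms] by blast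
  have "(\<lambda>x. frechet_derivative p (at x) d) = (\<lambda>x. d$1 * g1 x + d$2 * g2 x)"
    by (simp add: frechet_derivative_at[OF g(3), symmetric])
  then show ?thesis using g(1,2) by (auto intro: poly2_add poly2_scale)
qed

text \<open>For degree zero the bound \<open>k - 1\<close> truncates to 0 and
  \<open>poly2_derivative\<close> yields only a constant; this supplies the missing fact that the
  derivative vanishes.\<close>

lemma poly2_0_derivative:
  assumes "p \<in> poly2 0"
  shows "frechet_derivative p (at x) = (\<lambda>h. 0)"
proof -
  obtain c :: "nat \<Rightarrow> nat \<Rightarrow> real" where "\<And>x. p x = c 0 0"
    using assms by (auto simp: poly2_def)
  then have "p = (\<lambda>x. c 0 0)" by blast
  then show ?thesis by simp
qed

lemma poly2_continuous_on: "p \<in> poly2 k \<Longrightarrow> continuous_on S p"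
  by (meson poly2_differentiable differentiable_imp_continuous_within continuous_at_imp_continuous_on)

text \<open>Reduces questions about plane polynomials to univariate ones, where finitely many roots
  and coefficient lists are at hand.\<close>

lemma poly2_on_line:
  assumes "p \<in> poly2 k"
  shows "\<exists>P. degree P \<le> k \<and> (\<forall>t. p (a + t *\<^sub>R d) = poly P t)"
  using assms
proof (induction rule: poly2_induct)
  case subspace
  show ?case
  proof (rule subspaceI; clarify)
    show "\<exists>P. degree P \<le> k \<and> (\<forall>t. 0 (a + t *\<^sub>R d) = poly P t)"
      by (intro exI[of _ 0]) simp
  next
    fix p q P Q
    assume "degree P \<le> k" "\<forall>t. p (a + t *\<^sub>R d) = poly P t"
      "degree Q \<le> k" "\<forall>t. q (a + t *\<^sub>R d) = poly Q t"
    then show "\<exists>P. degree P \<le> k \<and> (\<forall>t. (p + q) (a + t *\<^sub>R d) = poly P t)"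
      by (intro exI[of _ "P + Q"]) (auto intro: degree_add_le)
  next
    fix c p P
    assume "degree P \<le> k" "\<forall>t. p (a + t *\<^sub>R d) = poly P t"
    then show "\<exists>P. degree P \<le> k \<and> (\<forall>t. (c *\<^sub>R p) (a + t *\<^sub>R d) = poly P t)"
      by (intro exI[of _ "smult c P"]) (auto intro: order_trans[OF degree_smult_le])
  qed
next
  case (monomial i j)
  let ?P = "[:a$1, d$1:] ^ i * [:a$2, d$2:] ^ j"
  have "degree ([:x, y::real:] ^ n) \<le> n" for x y n
    using degree_power_le[of "[:x, y:]" n] by (auto intro: order_trans simp: mult_le_cancel2)
  then have "degree ?P \<le> i + j"
    by (intro order_trans[OF degree_mult_le] add_mono)
  with monomial show ?case
    by (intro exI[of _ ?P]) (auto simp: algebra_simps)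
qed

text \<open>On the line from a point of \<open>U\<close> to any \<open>y\<close> the polynomial
  vanishes for infinitely many parameters near 0, hence also at the parameter 1.\<close>

lemma poly2_eq_0_if_open:
  assumes p: "p \<in> poly2 k" and U: "open U" "U \<noteq> {}" "\<And>x. x \<in> U \<Longrightarrow> p x = 0"
  shows "p = (\<lambda>x. 0)"
proof
  fix y
  obtain x where x: "x \<in> U" using U(2) by blast
  obtain P where P: "\<And>t. p (x + t *\<^sub>R (y - x)) = poly P t" using poly2_on_line[OF p] by blast
  have "open ((\<lambda>t. x + t *\<^sub>R (y - x)) -` U)"
    by (intro continuous_open_vimage continuous_intros U)
  moreover have "0 \<in> (\<lambda>t. x + t *\<^sub>R (y - x)) -` U" using x by simp
  ultimately have "infinite ((\<lambda>t::real. x + t *\<^sub>R (y - x)) -` U)"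
    using finite_imp_not_open by blast
  moreover have "(\<lambda>t. x + t *\<^sub>R (y - x)) -` U \<subseteq> {t. poly P t = 0}"
    using P U(3) by (metis (mono_tags, lifting) mem_Collect_eq subsetI vimageD)
  ultimately have "infinite {t. poly P t = 0}" using finite_subset by blast
  then have "P = 0" using poly_roots_finite by blast
  with P[of 1] show "p y = 0" by simp
qed

text \<open>The extension by zero used in the definitions, isolated because it is linear: the local
  spaces are its images of polynomial spaces and inherit subspace structure and finite
  dimension.\<close>

definition restrict0 :: "'a set \<Rightarrow> ('a \<Rightarrow> 'b::zero) \<Rightarrow> 'a \<Rightarrow> 'b" where
  "restrict0 S q = (\<lambda>x. if x \<in> S then q x else 0)"

lemma linear_restrict0: "linear (restrict0 S :: ('a \<Rightarrow> 'b::real_vector) \<Rightarrow> _)"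
  by (rule linearI) (auto simp: restrict0_def fun_eq_iff)

lemma Pk_eq: "Pk k K = restrict0 K ` poly2 k"
  by (auto simp: Pk_def restrict0_def fun_eq_iff)

lemma subspace_Pk [simp]: "subspace (Pk k K)"
  by (simp add: Pk_eq linear_subspace_image linear_restrict0)

lemma fin_dim_Pk [simp]: "fin_dim (Pk k K)"
  by (simp add: Pk_eq fin_dim_linear_image linear_restrict0)

text \<open>The parameter of an edge is the restriction of an affine function, so a polynomial in
  the parameter is the trace of a plane polynomial of the same degree. In particular the edge space
  does not depend on the chosen parametrization.\<close>

lemma Pedge_eq:
  assumes "a \<noteq> b" and e: "e = closed_segment a b"
  shows "Pedge k e = restrict0 e ` poly2 k"
proof
  show "Pedge k e \<subseteq> restrict0 e ` poly2 k"
  proof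
    fix f assume "f \<in> Pedge k e"
    then obtain a' b' and c :: "nat \<Rightarrow> real" where ab: "a' \<noteq> b'" "e = closed_segment a' b'"
      and c: "\<And>t. t \<in> {0..1} \<Longrightarrow> f (a' + t *\<^sub>R (b' - a')) = (\<Sum>i\<le>k. c i * t^i)"
      and 0: "\<And>x. x \<notin> e \<Longrightarrow> f x = 0"
      unfolding Pedge_def by blast
    \<comment> \<open>Scaled so that \<open>w \<bullet> (b' - a') = 1\<close>; then
      \<open>\<tau>\<close> returns the parameter \<open>t\<close> on the edge.\<close>
    define w where "w = (1 / (norm (b' - a'))\<^sup>2) *\<^sub>R (b' - a')"
    have w: "w \<bullet> (b' - a') = 1" using ab(1) by (simp add: w_def dot_square_norm)
    define \<tau> where "\<tau> = (\<lambda>x::pt. - (w \<bullet> a') + w$1 * x$1 + w$2 * x$2)"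
    have \<tau>_eq: "\<tau> x = w \<bullet> (x - a')" for x :: pt
      by (simp add: \<tau>_def inner_vec_def sum_2 algebra_simps)
    define p where "p = (\<lambda>x. \<Sum>i\<le>k. c i * \<tau> x ^ i)"
    have "\<tau> \<in> poly2 1" unfolding \<tau>_def by (rule poly2_affine)
    then have "(\<lambda>x. \<tau> x ^ i) \<in> poly2 k" if "i \<le> k" for i
      using poly2_power poly2_mono[OF that] by blast
    then have "p \<in> poly2 k" unfolding p_def by (intro poly2_sum poly2_scale) auto
    moreover have "f = restrict0 e p"
    proof
      fix x
      show "f x = restrict0 e p x"
      proof (cases "x \<in> e")
        case True
        then obtain t where t: "t \<in> {0..1}" "x = a' + t *\<^sub>R (b' - a')"
          unfolding ab(2) closed_segment_def by (auto simp: algebra_simps)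
        then have "\<tau> x = t" using w by (simp add: \<tau>_eq inner_scaleR_right)
        then show ?thesis using True t c by (simp add: restrict0_def p_def)
      qed (simp add: 0 restrict0_def)
    qed
    ultimately show "f \<in> restrict0 e ` poly2 k" by blast
  qed
  show "restrict0 e ` poly2 k \<subseteq> Pedge k e"
  proof clarify
    fix p assume "p \<in> poly2 k"
    then obtain P where P: "degree P \<le> k" "\<And>t. p (a + t *\<^sub>R (b - a)) = poly P t"
      using poly2_on_line by blast
    have "restrict0 e p (a + t *\<^sub>R (b - a)) = (\<Sum>i\<le>k. coeff P i * t ^ i)" if "t \<in> {0..1}" for t
    proof -
      have "a + t *\<^sub>R (b - a) \<in> e" using that unfolding e closed_segment_def
        by (auto simp: algebra_simps intro!: exI[of _ t])
      moreover have "poly P t = (\<Sum>i\<le>k. coeff P i * t ^ i)"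
        unfolding poly_altdef
        by (rule sum.mono_neutral_left) (use P(1) in \<open>auto simp: coeff_eq_0\<close>)
      ultimately show ?thesis by (simp add: restrict0_def P(2))
    qed
    moreover have "\<forall>x. x \<notin> e \<longrightarrow> restrict0 e p x = 0" by (simp add: restrict0_def)
    ultimately show "restrict0 e p \<in> Pedge k e"
      using assms unfolding Pedge_def by blast
  qed
qed

section \<open>Polynomial vector fields, gradient and divergence\<close>

definition vpoly2 :: "nat \<Rightarrow> (pt \<Rightarrow> pt) set" where
  "vpoly2 k = {q. (\<lambda>x. q x $ 1) \<in> poly2 k \<and> (\<lambda>x. q x $ 2) \<in> poly2 k}"

lemma vec2_nth [simp]: "vec2 a b $ 1 = a" "vec2 a b $ 2 = b"
  by (simp_all add: vec2_def)

lemma vec2_eq: "vec2 (x$1) (x$2) = x"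
  by (simp add: vec_eq_iff forall_2)

lemma inner_pt: "x \<bullet> y = x$1 * y$1 + x$2 * (y::pt)$2"
  by (simp add: inner_vec_def sum_2)

lemma vPk_eq: "vPk k K = restrict0 K ` vpoly2 k"
proof
  show "vPk k K \<subseteq> restrict0 K ` vpoly2 k"
  proof
    fix g assume "g \<in> vPk k K"
    then obtain p q where pq: "p \<in> poly2 k" "q \<in> poly2 k" "\<And>x. g x $ 1 = restrict0 K p x"
      "\<And>x. g x $ 2 = restrict0 K q x" unfolding vPk_def Pk_eq by (auto simp: fun_eq_iff)
    then have "g = restrict0 K (\<lambda>x. vec2 (p x) (q x))"
      by (simp add: fun_eq_iff restrict0_def vec_eq_iff forall_2)
    then show "g \<in> restrict0 K ` vpoly2 k" using pq(1,2) by (auto simp: vpoly2_def)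
  qed
  show "restrict0 K ` vpoly2 k \<subseteq> vPk k K"
  proof clarify
    fix q assume q: "q \<in> vpoly2 k"
    have "(\<lambda>x. restrict0 K q x $ i) = restrict0 K (\<lambda>x. q x $ i)" for i
      by (auto simp: restrict0_def)
    then show "restrict0 K q \<in> vPk k K" using q by (auto simp: vPk_def Pk_eq vpoly2_def)
  qed
qed

lemma subspace_vpoly2 [simp]: "subspace (vpoly2 k)"
  by (rule subspaceI) (auto simp: vpoly2_def intro: poly2_add poly2_scale)

lemma fin_dim_vpoly2 [simp]: "fin_dim (vpoly2 k)"
proof (rule fin_dim_subset)
  have "linear (\<lambda>(p, q). \<lambda>x::pt. vec2 (p x) (q x))"
    by (rule linearI) (auto simp: fun_eq_iff vec_eq_iff forall_2)
  then show "fin_dim ((\<lambda>(p, q). \<lambda>x. vec2 (p x) (q x)) ` (poly2 k \<times> poly2 k))"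
    by (intro fin_dim_linear_image fin_dim_Times) auto
  show "vpoly2 k \<subseteq> (\<lambda>(p, q). \<lambda>x. vec2 (p x) (q x)) ` (poly2 k \<times> poly2 k)"
  proof
    fix q assume "q \<in> vpoly2 k"
    moreover have "q = (\<lambda>x. vec2 (q x $ 1) (q x $ 2))" by (simp add: vec2_eq)
    ultimately show "q \<in> (\<lambda>(p, q). \<lambda>x. vec2 (p x) (q x)) ` (poly2 k \<times> poly2 k)"
      by (intro image_eqI[of _ _ "(\<lambda>x. q x $ 1, \<lambda>x. q x $ 2)"]) (auto simp: vpoly2_def)
  qed
qed

lemma vpoly2_has_derivative:
  assumes "q \<in> vpoly2 k"
  shows "(q has_derivative (\<lambda>h. vec2 (frechet_derivative (\<lambda>x. q x $ 1) (at x) h)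
    (frechet_derivative (\<lambda>x. q x $ 2) (at x) h))) (at x)"
  using assms unfolding vpoly2_def
  by (subst has_derivative_componentwise_within)
    (auto simp: Basis_vec_def inner_axis UNIV_2 intro: poly2_has_derivative)

lemma vpoly2_continuous_on: "q \<in> vpoly2 k \<Longrightarrow> continuous_on S q"
  by (meson vpoly2_has_derivative has_derivative_continuous continuous_at_imp_continuous_on)

lemma div2_vpoly2:
  assumes "q \<in> vpoly2 k"
  shows "div2 q x = frechet_derivative (\<lambda>x. q x $ 1) (at x) (axis 1 1) +
    frechet_derivative (\<lambda>x. q x $ 2) (at x) (axis 2 1)"
  unfolding div2_def frechet_derivative_at[OF vpoly2_has_derivative[OF assms], symmetric]
  by (simp add: sum_2)

lemma div2_poly2:
  assumes "q \<in> vpoly2 k"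
  shows "div2 q \<in> poly2 (k - 1)"
  unfolding div2_vpoly2[OF assms, THEN ext]
  using assms by (intro poly2_add poly2_derivative) (auto simp: vpoly2_def)

lemma frechet_derivative_add_poly2:
  assumes "p \<in> poly2 k" "q \<in> poly2 k"
  shows "frechet_derivative (\<lambda>x. p x + q x) (at x) h =
    frechet_derivative p (at x) h + frechet_derivative q (at x) h"
  using fun_cong[OF frechet_derivative_at[OF has_derivative_add[OF poly2_has_derivative[OF assms(1), of x]
    poly2_has_derivative[OF assms(2), of x]]], of h] by simp

lemma frechet_derivative_scale_poly2:
  assumes "p \<in> poly2 k"
  shows "frechet_derivative (\<lambda>x. c * p x) (at x) h = c * frechet_derivative p (at x) h"
  using fun_cong[OF frechet_derivative_at[OF has_derivative_mult_right[OF poly2_has_derivative[OF assms, of x], of c]], of h] by simp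

lemma frechet_derivative_mult_poly2:
  assumes "p \<in> poly2 k" "q \<in> poly2 m"
  shows "frechet_derivative (\<lambda>x. p x * q x) (at x) h =
    p x * frechet_derivative q (at x) h + frechet_derivative p (at x) h * q x"
  using fun_cong[OF frechet_derivative_at[OF has_derivative_mult[OF poly2_has_derivative[OF assms(1), of x]
    poly2_has_derivative[OF assms(2), of x]]], of h] by simp

lemma frechet_derivative_poly2_components:
  assumes "p \<in> poly2 k"
  shows "frechet_derivative p (at x) h = grad2 p x \<bullet> h"
proof -
  have l: "linear (frechet_derivative p (at x))"
    using poly2_has_derivative[OF assms] has_derivative_linear by blast
  have "h = h$1 *\<^sub>R axis 1 1 + h$2 *\<^sub>R axis 2 1"
    by (simp add: vec_eq_iff forall_2 axis_def)
  then have "frechet_derivative p (at x) h = frechet_derivative p (at x) (h$1 *\<^sub>R axis 1 1 + h$2 *\<^sub>R axis 2 1)"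
    by (rule arg_cong)
  also have "\<dots> = h$1 * frechet_derivative p (at x) (axis 1 1) + h$2 * frechet_derivative p (at x) (axis 2 1)"
    by (simp only: linear_add[OF l] linear_scale[OF l] real_scaleR_def)
  finally show ?thesis by (simp add: inner_pt grad2_def)
qed

section \<open>Triangles\<close>

text \<open>The determinant of two vectors: \<open>cross2 (b - a) (c - a)\<close> is twice the
  signed area of the triangle, and also the Jacobian of the affine map from the reference
  triangle.\<close>

definition cross2 :: "pt \<Rightarrow> pt \<Rightarrow> real" where
  "cross2 u v = u$1 * v$2 - u$2 * v$1"

text \<open>\<open>bary a b c\<close> is the barycentric coordinate of the vertex \<open>c\<close>; it vanishes on the
  line through \<open>a\<close> and \<open>b\<close>.\<close>

definition bary :: "pt \<Rightarrow> pt \<Rightarrow> pt \<Rightarrow> pt \<Rightarrow> real" where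
  "bary a b c x = cross2 (b - a) (x - a) / cross2 (b - a) (c - a)"

text \<open>The edge vector turned clockwise by a right angle and normalized. This points away from
  \<open>c\<close> when \<open>a\<close>, \<open>b\<close>, \<open>c\<close> run counterclockwise;
  the sign of the determinant corrects the other orientation.\<close>

definition outward :: "pt \<Rightarrow> pt \<Rightarrow> pt \<Rightarrow> pt" where
  "outward a b c = (sgn (cross2 (b - a) (c - a)) / norm (b - a)) *\<^sub>R vec2 ((b - a)$2) (- (b - a)$1)"

lemma bary_poly2: "bary a b c \<in> poly2 1"
proof -
  let ?D = "cross2 (b - a) (c - a)"
  have "bary a b c = (\<lambda>x. ((b - a)$2 * a$1 - (b - a)$1 * a$2) / ?D + (- (b - a)$2 / ?D) * x$1 + ((b - a)$1 / ?D) * x$2)"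
  proof
    fix x :: pt
    have "cross2 (b - a) (x - a) = ((b - a)$2 * a$1 - (b - a)$1 * a$2) + (- (b - a)$2) * x$1 + (b - a)$1 * x$2"
      by (simp add: cross2_def algebra_simps)
    then show "bary a b c x = ((b - a)$2 * a$1 - (b - a)$1 * a$2) / ?D + (- (b - a)$2 / ?D) * x$1 + ((b - a)$1 / ?D) * x$2"
      unfolding bary_def by (simp only: add_divide_distrib times_divide_eq_left)
  qed
  then show ?thesis by (simp only: poly2_affine)
qed

lemma bary_add_scaleR:
  "bary a b c (x + t *\<^sub>R v) = bary a b c x + t * (cross2 (b - a) v / cross2 (b - a) (c - a))"
proof -
  have "cross2 (b - a) (x + t *\<^sub>R v - a) = cross2 (b - a) (x - a) + t * cross2 (b - a) v"
    by (simp add: cross2_def algebra_simps)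
  then show ?thesis by (simp add: bary_def add_divide_distrib)
qed

lemma collinear_iff_cross2: "collinear {a, b, c} \<longleftrightarrow> cross2 (b - a) (c - a) = 0"
proof -
  let ?u = "b - a" and ?v = "c - a"
  have "collinear {a, b, c} \<longleftrightarrow> collinear {0, ?u, ?v}"
    using collinear_3[of b a c] by (simp add: insert_commute)
  also have "\<dots> \<longleftrightarrow> cross2 ?u ?v = 0"
  proof (cases "?u = 0")
    case True
    then show ?thesis by (simp add: cross2_def)
  next
    case False
    have "\<exists>r. ?v = r *\<^sub>R ?u" if 0: "?u$1 * ?v$2 - ?u$2 * ?v$1 = 0"
    proof (cases "?u$1 = 0")
      case True
      then have "?u$2 \<noteq> 0" using False by (auto simp: vec_eq_iff forall_2)
      with True 0 have "?v = (?v$2 / ?u$2) *\<^sub>R ?u" by (simp add: vec_eq_iff forall_2)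
      then show ?thesis by blast
    next
      case False
      with 0 have "?v = (?v$1 / ?u$1) *\<^sub>R ?u" by (simp add: vec_eq_iff forall_2) (simp add: eq_divide_eq mult.commute)
      then show ?thesis by blast
    qed
    moreover have "cross2 ?u (r *\<^sub>R ?u) = 0" for r by (simp add: cross2_def)
    ultimately have "cross2 ?u ?v = 0 \<longleftrightarrow> (\<exists>r. ?v = r *\<^sub>R ?u)"
      by (metis cross2_def)
    moreover have "?v = 0 \<Longrightarrow> \<exists>r. ?v = r *\<^sub>R ?u" by (intro exI[of _ 0]) simp
    ultimately show ?thesis using False unfolding collinear_lemma by blast
  qed
  finally show ?thesis .
qed

section \<open>Integrals over edges\<close>

lemma closed_segment_param:
  fixes a b :: "'a::real_vector"
  shows "closed_segment a b = (\<lambda>t. a + t *\<^sub>R (b - a)) ` {0..1}"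
  by (force simp: closed_segment_def algebra_simps)

lemma integral_01_reflect: "integral {0..1} (\<lambda>t::real. f (1 - t)) = (integral {0..1} f :: real)"
proof -
  have *: "(\<lambda>t. g (1 - t)) integrable_on {0..1} \<and> integral {0..1} (\<lambda>t. g (1 - t)) = integral {0..1} g"
    if "g integrable_on {0..1}" for g :: "real \<Rightarrow> real"
  proof -
    have "((\<lambda>t. g ((-1) *\<^sub>R t + 1)) has_integral (1 / \<bar>- 1\<bar> ^ DIM(real)) *\<^sub>R integral {0..1} g)
       ((\<lambda>x. (1 / - 1) *\<^sub>R x + - ((1 / - 1) *\<^sub>R 1)) ` cbox 0 (1::real))"
      by (rule has_integral_affinity) (use that in \<open>auto simp: integrable_integral\<close>)
    moreover have "(\<lambda>x. (1 / - 1) *\<^sub>R x + - ((1 / - 1) *\<^sub>R 1)) ` cbox 0 (1::real) = {0..1}"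
      by (auto simp: image_iff intro!: bexI[of _ "1 - _"])
    ultimately have "((\<lambda>t. g (1 - t)) has_integral integral {0..1} g) {0..1}"
      by simp
    then show ?thesis by (auto simp: integral_unique has_integral_integrable)
  qed
  show ?thesis
  proof (cases "f integrable_on {0..1}")
    \<comment> \<open>Reflection is an involution, so \<open>f\<close> and its reflection are
      integrable together; when neither is, both integrals have the default value 0.\<close>
    case False
    then have "\<not> (\<lambda>t. f (1 - t)) integrable_on {0..1}"
      using *[of "\<lambda>t. f (1 - t)"] by auto
    then show ?thesis using False by (simp add: not_integrable_integral)
  qed (use * in blast)
qed

text \<open>The endpoints chosen by \<open>SOME\<close> can differ from \<open>a\<close> and
  \<open>b\<close> only in their order, and reversing the parametrization does not change the
  integral.\<close>

lemma edge_int_segment: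
  assumes "a \<noteq> b"
  shows "edge_int (closed_segment a b) g =
    norm (b - a) * integral {0..1} (\<lambda>t::real. g (a + t *\<^sub>R (b - a)))"
proof -
  define Q where "Q = (\<lambda>(p, q). p \<noteq> q \<and> closed_segment a b = closed_segment p q)"
  obtain p q where pq: "(SOME x. Q x) = (p, q)" by fastforce
  have "Q (a, b)" using assms by (simp add: Q_def)
  then have "Q (p, q)" unfolding pq[symmetric] by (rule someI)
  then have "p = a \<and> q = b \<or> p = b \<and> q = a"
    by (auto simp: Q_def doubleton_eq_iff)
  moreover have "integral {0..1} (\<lambda>t::real. g (b + t *\<^sub>R (a - b))) =
      integral {0..1} (\<lambda>t::real. g (a + t *\<^sub>R (b - a)))"
    using integral_01_reflect[of "\<lambda>t. g (a + t *\<^sub>R (b - a))"] by (simp add: algebra_simps)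
  ultimately show ?thesis
    unfolding edge_int_def Q_def[symmetric] pq by (auto simp: norm_minus_commute)
qed

lemma edge_int_add:
  fixes a b :: pt
  assumes "a \<noteq> b" "continuous_on (closed_segment a b) f" "continuous_on (closed_segment a b) g"
  shows "edge_int (closed_segment a b) (\<lambda>x. f x + g x) =
    edge_int (closed_segment a b) f + edge_int (closed_segment a b) g"
proof -
  have "(\<lambda>t. h (a + t *\<^sub>R (b - a))) integrable_on {0..1::real}"
    if "continuous_on (closed_segment a b) h" for h :: "pt \<Rightarrow> real"
    using that
    by (intro integrable_continuous_interval continuous_on_compose2[OF that])
      (auto intro!: continuous_intros simp: closed_segment_param)
  then show ?thesis using assms
    by (simp add: edge_int_segment integral_add distrib_left)
qed

lemma edge_int_scale:
  assumes "a \<noteq> b"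
  shows "edge_int (closed_segment a b) (\<lambda>x. r * f x) = r * edge_int (closed_segment a b) f"
  using assms by (simp add: edge_int_segment)

lemma edge_int_cong:
  assumes "a \<noteq> b" "\<And>x. x \<in> closed_segment a b \<Longrightarrow> f x = g x"
  shows "edge_int (closed_segment a b) f = edge_int (closed_segment a b) g"
  unfolding edge_int_segment[OF assms(1)]
  by (intro arg_cong[where f = "\<lambda>r. _ * r"] integral_cong assms(2)) (auto simp: closed_segment_param)

text \<open>A triangle with an order of its vertices. Facts are proved for the edge
  \<open>a b\<close> and reach the other edges and orientations through \<open>rotate\<close> and
  \<open>swap\<close>.\<close>

locale nondeg_triangle =
  fixes a b c :: pt
  assumes nondeg: "cross2 (b - a) (c - a) \<noteq> 0"
begin

lemma rotate: "nondeg_triangle b c a"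
  using nondeg by unfold_locales (simp add: cross2_def algebra_simps)

lemma swap: "nondeg_triangle b a c"
  using nondeg by unfold_locales (simp add: cross2_def algebra_simps)

lemma distinct: "a \<noteq> b" "b \<noteq> c" "a \<noteq> c"
  using nondeg by (auto simp: cross2_def)

lemma bary_comb:
  assumes "u + v + w = 1"
  shows "bary a b c (u *\<^sub>R a + v *\<^sub>R b + w *\<^sub>R c) = w"
proof -
  have u: "u = 1 - v - w" using assms by simp
  have "cross2 (b - a) (u *\<^sub>R a + v *\<^sub>R b + w *\<^sub>R c - a) = w * cross2 (b - a) (c - a)"
    unfolding u by (simp add: cross2_def algebra_simps)
  then show ?thesis using nondeg by (simp add: bary_def)
qed

lemma bary_decomp:
  "bary b c a x + bary c a b x + bary a b c x = 1"
  "bary b c a x *\<^sub>R a + bary c a b x *\<^sub>R b + bary a b c x *\<^sub>R c = x"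
proof -
  let ?D = "cross2 (b - a) (c - a)"
  have D: "cross2 (c - b) (a - b) = ?D" "cross2 (a - c) (b - c) = ?D"
    by (simp_all add: cross2_def algebra_simps)
  have 1: "cross2 (c - b) (x - b) + cross2 (a - c) (x - c) + cross2 (b - a) (x - a) = ?D"
    by (simp add: cross2_def algebra_simps)
  then show "bary b c a x + bary c a b x + bary a b c x = 1"
    using nondeg by (simp add: bary_def D add_divide_distrib[symmetric])
  have "(cross2 (c - b) (x - b) * a$i + cross2 (a - c) (x - c) * b$i + cross2 (b - a) (x - a) * c$i)
      = ?D * x$i" for i
    using exhaust_2[of i] by (auto simp: cross2_def algebra_simps)
  then have "(cross2 (c - b) (x - b) * a$i + cross2 (a - c) (x - c) * b$i + cross2 (b - a) (x - a) * c$i) / ?D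
      = x$i" for i
    using nondeg by simp
  then show "bary b c a x *\<^sub>R a + bary c a b x *\<^sub>R b + bary a b c x *\<^sub>R c = x"
    by (simp add: vec_eq_iff bary_def D add_divide_distrib)
qed

lemma hull_eq:
  "convex hull {a, b, c} = {x. bary b c a x \<ge> 0 \<and> bary c a b x \<ge> 0 \<and> bary a b c x \<ge> 0}"
proof (intro set_eqI iffI)
  fix x assume "x \<in> convex hull {a, b, c}"
  then obtain u v w where uvw: "0 \<le> u" "0 \<le> v" "0 \<le> w" "u + v + w = 1"
    and x: "x = u *\<^sub>R a + v *\<^sub>R b + w *\<^sub>R c" unfolding convex_hull_3 by blast
  interpret r: nondeg_triangle b c a by (rule rotate)
  interpret rr: nondeg_triangle c a b by (rule r.rotate)
  have "bary a b c x = w" "bary b c a x = u" "bary c a b x = v"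
    using bary_comb[of u v w] r.bary_comb[of v w u] rr.bary_comb[of w u v] uvw
    by (simp_all add: x add_ac)
  then show "x \<in> {x. bary b c a x \<ge> 0 \<and> bary c a b x \<ge> 0 \<and> bary a b c x \<ge> 0}" using uvw by simp
next
  fix x assume "x \<in> {x. bary b c a x \<ge> 0 \<and> bary c a b x \<ge> 0 \<and> bary a b c x \<ge> 0}"
  then show "x \<in> convex hull {a, b, c}"
    unfolding convex_hull_3 using bary_decomp[of x] by force
qed

lemma bary_continuous: "continuous_on S (bary p q r)"
  using poly2_continuous_on bary_poly2 by blast

lemma interior_hull:
  "{x. bary b c a x > 0 \<and> bary c a b x > 0 \<and> bary a b c x > 0} \<subseteq> interior (convex hull {a, b, c})"
proof (rule interior_maximal)
  show "open {x. bary b c a x > 0 \<and> bary c a b x > 0 \<and> bary a b c x > 0}"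
    by (intro open_Collect_conj open_Collect_less continuous_on_const bary_continuous)
qed (auto simp: hull_eq)

lemma bary_edge:
  "bary a b c (a + t *\<^sub>R (b - a)) = 0"
  "bary b c a (a + t *\<^sub>R (b - a)) = 1 - t"
  "bary c a b (a + t *\<^sub>R (b - a)) = t"
proof -
  interpret r: nondeg_triangle b c a by (rule rotate)
  interpret rr: nondeg_triangle c a b by (rule r.rotate)
  have "a + t *\<^sub>R (b - a) = (1 - t) *\<^sub>R a + t *\<^sub>R b + 0 *\<^sub>R c" by (simp add: algebra_simps)
  then show "bary a b c (a + t *\<^sub>R (b - a)) = 0"
    "bary b c a (a + t *\<^sub>R (b - a)) = 1 - t"
    "bary c a b (a + t *\<^sub>R (b - a)) = t"
    using bary_comb[of "1 - t" t 0] r.bary_comb[of t 0 "1 - t"] rr.bary_comb[of 0 "1 - t" t]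
    by (simp_all add: add_ac)
qed

lemma bary_segment: "x \<in> closed_segment a b \<Longrightarrow> bary a b c x = 0"
  by (auto simp: closed_segment_param bary_edge)

lemma segment_if_bary_0:
  assumes "x \<in> convex hull {a, b, c}" "bary a b c x = 0"
  shows "x \<in> closed_segment a b"
proof -
  have x1: "bary b c a x = 1 - bary c a b x"
    using bary_decomp(1)[of x] assms(2) by simp
  have "x = (1 - bary c a b x) *\<^sub>R a + bary c a b x *\<^sub>R b"
    using bary_decomp(2)[of x] assms(2) x1 by simp
  then have "x = a + bary c a b x *\<^sub>R (b - a)"
    by (simp add: algebra_simps)
  moreover have "bary c a b x \<in> {0..1}" using assms(1) x1 unfolding hull_eq by auto
  ultimately show ?thesis unfolding closed_segment_param by blast
qed

lemma verts_hull: "verts (convex hull {a, b, c}) = {a, b, c}"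
proof -
  have "\<not> affine_dependent {a, b, c}"
    using nondeg collinear_iff_cross2[of a b c] collinear_3_eq_affine_dependent[of a b c] by blast
  then show ?thesis
    unfolding verts_def by (auto simp: extreme_point_of_convex_hull_affine_independent)
qed

lemma edges_hull:
  "edges (convex hull {a, b, c}) = {closed_segment a b, closed_segment b c, closed_segment c a}"
  unfolding edges_def verts_hull using distinct closed_segment_commute by auto

lemma edges_distinct:
  "closed_segment a b \<noteq> closed_segment b c" "closed_segment b c \<noteq> closed_segment c a"
  "closed_segment a b \<noteq> closed_segment c a"
  using distinct by (auto simp: doubleton_eq_iff)

lemma sum_edges_hull:
  "(\<Sum>e\<in>edges (convex hull {a, b, c}). F e :: real) =
    F (closed_segment a b) + F (closed_segment b c) + F (closed_segment c a)"
  unfolding edges_hull using edges_distinct by (simp add: add.assoc)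

lemma perp_inner: "vec2 (u$2) (- u$1) \<bullet> v = - cross2 u v"
  by (simp add: inner_pt cross2_def)

text \<open>The factor \<open>norm (b - a)\<close> is the one carried by the edge integral. With it
  the third identity produces the absolute determinant, the same factor as in integrals over the
  triangle, so it cancels from the tested equations.\<close>

lemma outward_inner:
  "outward a b c \<bullet> (b - a) = 0"
  "norm (b - a) * (outward a b c \<bullet> v) = - sgn (cross2 (b - a) (c - a)) * cross2 (b - a) v"
  "norm (b - a) * (outward a b c \<bullet> (c - a)) = - \<bar>cross2 (b - a) (c - a)\<bar>"
proof -
  show *: "norm (b - a) * (outward a b c \<bullet> v) = - sgn (cross2 (b - a) (c - a)) * cross2 (b - a) v" for v
    unfolding outward_def inner_scaleR_left perp_inner using distinct by simp
  show "outward a b c \<bullet> (b - a) = 0"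
    using *[of "b - a"] distinct by (simp add: cross2_def)
  show "norm (b - a) * (outward a b c \<bullet> (c - a)) = - \<bar>cross2 (b - a) (c - a)\<bar>"
    by (simp add: * abs_sgn mult.commute)
qed

lemma norm_perp: "norm (vec2 (u$2) (- u$1)) = norm (u :: pt)"
  by (simp add: norm_eq_sqrt_inner inner_pt add.commute)

lemma norm_outward: "norm (outward a b c) = 1"
proof -
  have "norm (vec2 ((b - a)$2) (- (b - a)$1)) = norm (b - a)" by (rule norm_perp)
  then show ?thesis using distinct nondeg by (simp only: outward_def norm_scaleR) (simp add: abs_sgn_eq)
qed

text \<open>A unit vector orthogonal to the edge is the rotated edge direction up to sign, and the
  requirement that \<open>c\<close> lie on the nonpositive side fixes the sign.\<close>

lemma normal_hull: "normal (convex hull {a, b, c}) (closed_segment a b) = outward a b c"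
  unfolding normal_def
proof (rule the_equality)
  let ?D = "cross2 (b - a) (c - a)"
  have ab: "outward a b c \<bullet> x = outward a b c \<bullet> a" if "x \<in> closed_segment a b" for x
    using that outward_inner(1) by (auto simp: closed_segment_param inner_add_right)
  show "norm (outward a b c) = 1 \<and>
    (\<forall>x\<in>closed_segment a b. \<forall>y\<in>closed_segment a b. outward a b c \<bullet> (x - y) = 0) \<and>
    (\<forall>y\<in>convex hull {a, b, c}. \<forall>x\<in>closed_segment a b. outward a b c \<bullet> (y - x) \<le> 0)"
  proof (intro conjI ballI norm_outward)
    fix x y assume "x \<in> closed_segment a b" "y \<in> closed_segment a b"
    then have "outward a b c \<bullet> x = outward a b c \<bullet> y" using ab by metis
    then show "outward a b c \<bullet> (x - y) = 0" by (simp add: inner_diff_right)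
  next
    fix y x assume y: "y \<in> convex hull {a, b, c}" and x: "x \<in> closed_segment a b"
    have "cross2 (b - a) (y - a) = bary a b c y * ?D" using nondeg by (simp add: bary_def)
    then have "norm (b - a) * (outward a b c \<bullet> (y - a)) = - sgn ?D * (bary a b c y * ?D)"
      by (simp only: outward_inner(2))
    also have "\<dots> = - (bary a b c y * (?D * sgn ?D))" by algebra
    also have "\<dots> = - (bary a b c y * \<bar>?D\<bar>)" by (simp only: abs_sgn)
    also have "\<dots> \<le> 0" using y by (simp add: hull_eq)
    finally have "outward a b c \<bullet> (y - a) \<le> 0"
      using distinct by (simp add: mult_le_0_iff)
    then show "outward a b c \<bullet> (y - x) \<le> 0" using ab[OF x] by (simp add: inner_diff_right)
  qed
next
  let ?D = "cross2 (b - a) (c - a)" and ?u = "b - a"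
  fix n assume n: "norm n = 1 \<and> (\<forall>x\<in>closed_segment a b. \<forall>y\<in>closed_segment a b. n \<bullet> (x - y) = 0) \<and>
    (\<forall>y\<in>convex hull {a, b, c}. \<forall>x\<in>closed_segment a b. n \<bullet> (y - x) \<le> 0)"
  have nu: "n \<bullet> ?u = 0" using n by auto
  have nc: "n \<bullet> (c - a) \<le> 0" using n hull_inc[of c "{a, b, c}" convex] by auto
  \<comment> \<open>The coefficient of the projection of \<open>n\<close> onto the rotated edge
    vector; as \<open>n\<close> is orthogonal to the edge, the projection is \<open>n\<close>
    itself.\<close>
  define \<alpha> where "\<alpha> = (n$1 * ?u$2 - n$2 * ?u$1) / (norm ?u)\<^sup>2"
  have u: "(norm ?u)\<^sup>2 = ?u$1 * ?u$1 + ?u$2 * ?u$2"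
    by (simp add: power2_norm_eq_inner inner_pt)
  have u_pos: "(norm ?u)\<^sup>2 > 0" using distinct(1) by simp
  have "n$1 * (norm ?u)\<^sup>2 = (n$1 * ?u$2 - n$2 * ?u$1) * ?u$2"
    "n$2 * (norm ?u)\<^sup>2 = - ((n$1 * ?u$2 - n$2 * ?u$1) * ?u$1)"
    using nu unfolding u inner_pt by algebra+
  then have n_eq: "n = \<alpha> *\<^sub>R vec2 (?u$2) (- ?u$1)"
    using u_pos by (simp add: vec_eq_iff forall_2 \<alpha>_def field_simps)
  have "\<bar>\<alpha>\<bar> * norm ?u = norm n" by (metis n_eq norm_scaleR norm_perp)
  then have "\<bar>\<alpha>\<bar> * norm ?u = 1" using n by simp
  moreover have "\<alpha> * ?D \<ge> 0"
  proof -
    have "n \<bullet> (c - a) = - (\<alpha> * ?D)" by (subst n_eq) (simp only: inner_scaleR_left perp_inner)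
    then show ?thesis using nc by simp
  qed
  ultimately have "\<alpha> = sgn ?D / norm ?u"
    using nondeg distinct(1)
    by (cases "?D > 0"; cases "\<alpha> \<ge> 0") (auto simp: field_simps zero_le_mult_iff sgn_if)
  then show "n = outward a b c" using n_eq by (simp add: outward_def)
qed

end

lemma triangle_obtain:
  assumes "triangle K"
  obtains a b c where "K = convex hull {a, b, c}" "nondeg_triangle a b c"
  using assms unfolding triangle_def nondeg_triangle_def collinear_iff_cross2 by blast

section \<open>Integration over triangles\<close>

lemma continuous_on_vec2:
  assumes "continuous_on S f" "continuous_on S g"
  shows "continuous_on S (\<lambda>x. vec2 (f x) (g x))"
proof -
  have *: "(\<lambda>x. vec2 (f x) (g x)) = (\<lambda>x. \<chi> i. if i = 1 then f x else g x)"
    by (auto simp: fun_eq_iff vec_eq_iff forall_2)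
  have "continuous_on S (\<lambda>x. if i = (1::2) then f x else g x)" for i
    using assms by (cases "i = 1") auto
  then show ?thesis unfolding * by (rule continuous_on_vec_lambda)
qed

lemma borel_measurable_vec2: "(\<lambda>(s, t). vec2 s t) \<in> borel_measurable (borel :: (real \<times> real) measure)"
  unfolding case_prod_unfold
  by (intro borel_measurable_continuous_onI continuous_on_vec2 continuous_intros)

lemma prod_Basis_pt: "(\<Prod>b\<in>(Basis :: pt set). F b) = (F (axis 1 1 :: pt) * F (axis 2 1) :: real)"
proof -
  have B: "(Basis :: pt set) = {axis 1 1, axis 2 1}" by (auto simp: Basis_vec_def UNIV_2)
  have "axis 1 1 \<noteq> (axis 2 1 :: pt)" by (simp add: axis_eq_axis)
  then show ?thesis unfolding B by simp
qed

text \<open>Identifies \<open>real^2\<close> with a product of lines as a measure space, by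
  comparing boxes; this opens the way to Fubini.\<close>

lemma lborel_pt: "lborel = distr (lborel :: (real \<times> real) measure) borel (\<lambda>(s, t). vec2 s t)"
proof (rule lborel_eqI)
  fix l u :: pt assume lu: "\<And>b. b \<in> Basis \<Longrightarrow> l \<bullet> b \<le> u \<bullet> b"
  have [simp]: "l$i \<le> u$i" for i using lu[of "axis i 1"] by (auto simp: Basis_vec_def inner_axis)
  have "emeasure (distr lborel borel (\<lambda>(s, t). vec2 s t)) (box l u) =
      emeasure lborel ((\<lambda>(s, t). vec2 s t) -` box l u :: (real \<times> real) set)"
    using borel_measurable_vec2 by (subst emeasure_distr) auto
  also have "(\<lambda>(s, t). vec2 s t) -` box l u = {l$1<..<u$1} \<times> {l$2<..<u$2}"
    by (auto simp: mem_box_cart forall_2)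
  also have "emeasure lborel ({l$1<..<u$1} \<times> {l$2<..<u$2}) = emeasure lborel {l$1<..<u$1} * emeasure lborel {l$2<..<u$2}"
    unfolding lborel_prod[symmetric] by (intro lborel.emeasure_pair_measure_Times) auto
  also have "\<dots> = ennreal (\<Prod>b\<in>Basis. (u - l) \<bullet> b)"
    by (simp add: prod_Basis_pt inner_axis ennreal_mult)
  finally show "emeasure (distr lborel borel (\<lambda>(s, t). vec2 s t)) (box l u) = (\<Prod>b\<in>Basis. (u - l) \<bullet> b)" .
qed simp

definition ref_triangle :: "pt set" where
  "ref_triangle = {y. 0 \<le> y$1 \<and> 0 \<le> y$2 \<and> y$1 + y$2 \<le> 1}"

lemma compact_ref_triangle: "compact ref_triangle"
proof -
  have "closed ref_triangle" unfolding ref_triangle_def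
    by (intro closed_Collect_conj closed_Collect_le continuous_intros)
  moreover have "bounded ref_triangle"
    by (rule bounded_subset[OF bounded_cbox[of "vec2 0 0" "vec2 1 1"]])
      (auto simp: ref_triangle_def mem_box_cart forall_2)
  ultimately show ?thesis by (simp add: compact_eq_bounded_closed)
qed

text \<open>Bridges the gauge integral of the definitions and Lebesgue integration: the first claim
  feeds Fubini, the second the change of variables.\<close>

lemma integral_compact:
  fixes f :: "'a::euclidean_space \<Rightarrow> 'b::euclidean_space"
  assumes "compact S" "continuous_on S f"
  shows "integral S f = (LINT x|lborel. indicator S x *\<^sub>R f x)"
    and "f absolutely_integrable_on S" and "f integrable_on S"
proof -
  have i: "set_integrable lborel S f"
    using borel_integrable_compact[OF assms] by (simp add: set_integrable_def)
  show "integral S f = (LINT x|lborel. indicator S x *\<^sub>R f x)"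
    using set_borel_integral_eq_integral(2)[OF i] by (simp add: set_lebesgue_integral_def)
  show "f integrable_on S" using set_borel_integral_eq_integral(1)[OF i] .
  show "f absolutely_integrable_on S"
    using i unfolding set_integrable_def by (rule integrable_completion[THEN iffD2, rotated]) (use i in \<open>auto simp: set_integrable_def\<close>)
qed

text \<open>Fubini with the inner integral handed over as a \<open>has_integral\<close> fact, so
  that the fundamental theorem of calculus can supply \<open>G\<close> directly.\<close>

lemma integral_ref_triangle:
  fixes h :: "pt \<Rightarrow> real"
  assumes h: "continuous_on ref_triangle h"
    and G: "\<And>s. s \<in> {0..1} \<Longrightarrow> ((\<lambda>t. h (vec2 s t)) has_integral G s) {0..1 - s}"
    and cG: "continuous_on {0..1} G"
  shows "integral ref_triangle h = integral {0..1} G"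
proof -
  let ?H = "\<lambda>y. indicator ref_triangle y *\<^sub>R h y"
  have int: "integrable lborel ?H" using borel_integrable_compact[OF compact_ref_triangle h] .
  have meas: "(\<lambda>(s, t). vec2 s t) \<in> measurable lborel borel" using borel_measurable_vec2 by simp
  have Hm: "?H \<in> borel_measurable borel" using borel_measurable_integrable[OF int] by simp
  have int': "integrable (lborel \<Otimes>\<^sub>M lborel) (\<lambda>z. ?H ((\<lambda>(s, t). vec2 s t) z))"
  proof -
    have "integrable (distr (lborel :: (real \<times> real) measure) borel (\<lambda>(s, t). vec2 s t)) ?H"
      using int by (simp only: lborel_pt[symmetric])
    then show ?thesis unfolding integrable_distr_eq[OF meas Hm] lborel_prod .
  qed
  have inner: "(LINT t|lborel. ?H (vec2 s t)) = indicator {0..1} s *\<^sub>R G s" for s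
  proof (cases "s \<in> {0..1}")
    case True
    have "continuous_on {0..1 - s} (\<lambda>t. vec2 s t)"
      by (intro continuous_on_vec2 continuous_intros)
    then have "continuous_on {0..1 - s} (\<lambda>t. h (vec2 s t))"
      by (rule continuous_on_compose2[OF h]) (use True in \<open>auto simp: ref_triangle_def\<close>)
    then have "integral {0..1 - s} (\<lambda>t. h (vec2 s t)) = (LINT t|lborel. indicator {0..1 - s} t *\<^sub>R h (vec2 s t))"
      by (intro integral_compact) auto
    moreover have "?H (vec2 s t) = indicator {0..1 - s} t *\<^sub>R h (vec2 s t)" for t
      using True by (auto simp: ref_triangle_def indicator_def)
    ultimately show ?thesis using True integral_unique[OF G[OF True]] by (simp only: indicator_simps(1) scaleR_one)
  next
    case False
    then have "?H (vec2 s t) = 0" for t by (auto simp: ref_triangle_def indicator_def)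
    then have "(LINT t|lborel. ?H (vec2 s t)) = (LINT t|(lborel :: real measure). 0)" by (simp only:)
    then show ?thesis using False by simp
  qed
  have "integral ref_triangle h = (LINT y|lborel. ?H y)"
    by (rule integral_compact(1)[OF compact_ref_triangle h])
  also have "\<dots> = (LINT z|(lborel \<Otimes>\<^sub>M lborel). ?H ((\<lambda>(s, t). vec2 s t) z))"
    unfolding lborel_prod integral_distr[OF meas Hm, symmetric] lborel_pt[symmetric] ..
  also have "\<dots> = (LINT s|lborel. LINT t|lborel. ?H ((\<lambda>(s, t). vec2 s t) (s, t)))"
    using lborel_pair.integral_fst'[OF int'] by simp
  also have "\<dots> = (LINT s|lborel. indicator {0..1} s *\<^sub>R G s)"
    using inner by simp
  also have "\<dots> = integral {0..1} G" using cG by (intro integral_compact(1)[symmetric]) auto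
  finally show ?thesis .
qed

context nondeg_triangle
begin

lemma compact_hull: "compact (convex hull {a, b, c})"
  by (simp add: finite_imp_compact_convex_hull)

lemma hull_image_ref_triangle:
  "convex hull {a, b, c} = (\<lambda>y. a + (y$1 *\<^sub>R (b - a) + y$2 *\<^sub>R (c - a))) ` ref_triangle"
proof
  show "convex hull {a, b, c} \<subseteq> (\<lambda>y. a + (y$1 *\<^sub>R (b - a) + y$2 *\<^sub>R (c - a))) ` ref_triangle"
  proof
    fix x assume x: "x \<in> convex hull {a, b, c}"
    let ?y = "vec2 (bary c a b x) (bary a b c x)"
    have s: "bary b c a x = 1 - bary c a b x - bary a b c x" using bary_decomp(1)[of x] by simp
    have "x = a + (?y$1 *\<^sub>R (b - a) + ?y$2 *\<^sub>R (c - a))"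
      using bary_decomp(2)[of x] unfolding s by (simp add: algebra_simps)
    moreover have "?y \<in> ref_triangle" using x s by (simp add: hull_eq ref_triangle_def)
    ultimately show "x \<in> (\<lambda>y. a + (y$1 *\<^sub>R (b - a) + y$2 *\<^sub>R (c - a))) ` ref_triangle" by blast
  qed
  show "(\<lambda>y. a + (y$1 *\<^sub>R (b - a) + y$2 *\<^sub>R (c - a))) ` ref_triangle \<subseteq> convex hull {a, b, c}"
  proof clarify
    fix y assume y: "y \<in> ref_triangle"
    have "a + (y$1 *\<^sub>R (b - a) + y$2 *\<^sub>R (c - a)) = (1 - y$1 - y$2) *\<^sub>R a + y$1 *\<^sub>R b + y$2 *\<^sub>R c"
      by (simp add: algebra_simps)
    then show "a + (y$1 *\<^sub>R (b - a) + y$2 *\<^sub>R (c - a)) \<in> convex hull {a, b, c}"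
      using y unfolding convex_hull_3 ref_triangle_def by force
  qed
qed

lemma integral_hull:
  fixes f :: "pt \<Rightarrow> real"
  assumes f: "continuous_on (convex hull {a, b, c}) f"
  shows "integral (convex hull {a, b, c}) f = \<bar>cross2 (b - a) (c - a)\<bar> *
    integral ref_triangle (\<lambda>y. f (a + (y$1 *\<^sub>R (b - a) + y$2 *\<^sub>R (c - a))))"
proof -
  let ?\<psi> = "\<lambda>y::pt. y$1 *\<^sub>R (b - a) + y$2 *\<^sub>R (c - a)"
  \<comment> \<open>The change of variables is applied to a function with values in
    \<open>real^1\<close>; the inner product with 1 afterwards returns to real values.\<close>
  let ?g = "\<lambda>y. a + ?\<psi> y" and ?F = "\<lambda>x. f x *\<^sub>R (1 :: real^1)" and ?K = "convex hull {a, b, c}"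
  have lin: "linear ?\<psi>" by (rule linearI) (simp_all add: algebra_simps)
  have det: "det (matrix ?\<psi>) = cross2 (b - a) (c - a)"
    by (simp add: det_2 matrix_def axis_def cross2_def algebra_simps)
  have "inj ?\<psi>" using det_nz_iff_inj[OF lin] det nondeg by simp
  then have inj: "inj_on ?g ref_triangle"
    unfolding inj_on_def by (simp only: add_left_cancel) blast
  have der: "(?g has_derivative ?\<psi>) (at x within ref_triangle)" for x
    using has_derivative_add[OF has_derivative_const[of a] linear_imp_has_derivative[OF lin]] by simp
  have cF: "continuous_on ?K ?F" by (intro continuous_intros f)
  have cont_g: "continuous_on ref_triangle ?g" by (intro continuous_intros)
  have cfg: "continuous_on ref_triangle (\<lambda>y. f (?g y))"
    by (rule continuous_on_compose2[OF f cont_g]) (simp add: hull_image_ref_triangle)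
  have "integral ref_triangle (\<lambda>x. \<bar>det (matrix ?\<psi>)\<bar> *\<^sub>R ?F (?g x)) = integral ?K ?F"
    using has_absolute_integral_change_of_variables[of ref_triangle ?g "\<lambda>_. ?\<psi>" ?F "integral ?K ?F"]
      integral_compact(2)[OF compact_hull cF] inj der compact_ref_triangle
    unfolding hull_image_ref_triangle[symmetric] by (simp add: lmeasurable_compact fmeasurableD)
  then have eq: "integral ref_triangle (\<lambda>x. \<bar>det (matrix ?\<psi>)\<bar> *\<^sub>R ?F (?g x)) \<bullet> 1 = integral ?K ?F \<bullet> 1"
    by (rule arg_cong)
  have scal: "integral S (\<lambda>x. h x *\<^sub>R (1 :: real^1)) = integral S h *\<^sub>R 1" if "h integrable_on S" for S and h :: "pt \<Rightarrow> real"
    using integral_linear[OF that bounded_linear_scaleR_left[of "1::real^1"]] by (simp add: o_def)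
  have one: "(1 :: real^1) \<bullet> 1 = 1" by (simp add: inner_vec_def)
  show ?thesis
    using eq unfolding integral_cmul scal[OF integral_compact(3)[OF compact_hull f]]
      scal[OF integral_compact(3)[OF compact_ref_triangle cfg]] det
    by (simp only: inner_scaleR_left one real_scaleR_def mult_1_right)
qed

text \<open>The divergence theorem for the field \<open>p *\<^sub>R (c - a)\<close>: the edge \<open>c a\<close> is parallel to the
  field and \<open>p\<close> vanishes on \<open>b c\<close>, so only \<open>a b\<close> contributes.\<close>

lemma integral_derivative_along_edge:
  assumes p: "p \<in> poly2 m" and zero: "\<And>x. x \<in> closed_segment b c \<Longrightarrow> p x = 0"
  shows "integral (convex hull {a, b, c}) (\<lambda>x. frechet_derivative p (at x) (c - a)) =
    - \<bar>cross2 (b - a) (c - a)\<bar> * integral {0..1} (\<lambda>s. p (a + s *\<^sub>R (b - a)))"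
proof -
  let ?d = "\<lambda>x. frechet_derivative p (at x) (c - a)"
  let ?g = "\<lambda>y::pt. a + (y$1 *\<^sub>R (b - a) + y$2 *\<^sub>R (c - a))"
  have d: "continuous_on S ?d" for S
    using poly2_continuous_on poly2_derivative[OF p] by blast
  \<comment> \<open>For fixed \<open>s\<close> the reference map moves in the direction
    \<open>c - a\<close> as \<open>t\<close> grows, so the inner integral is a difference of values
    of \<open>p\<close>. Its upper end lies on \<open>b c\<close>, where \<open>p\<close> vanishes;
    its lower end lies on \<open>a b\<close>.\<close>
  have "integral ref_triangle (\<lambda>y. ?d (?g y)) = integral {0..1} (\<lambda>s. - p (a + s *\<^sub>R (b - a)))"
  proof (rule integral_ref_triangle)
    show "continuous_on ref_triangle (\<lambda>y. ?d (?g y))"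
      by (rule continuous_on_compose2[OF d[of UNIV]]) (auto intro!: continuous_intros)
    show "continuous_on {0..1} (\<lambda>s. - p (a + s *\<^sub>R (b - a)))"
      by (intro continuous_on_minus continuous_on_compose2[OF poly2_continuous_on[OF p, of UNIV]])
        (auto intro!: continuous_intros)
    fix s :: real assume s: "s \<in> {0..1}"
    let ?q = "\<lambda>t. p (?g (vec2 s t))"
    have "((\<lambda>t. ?d (?g (vec2 s t))) has_integral (?q (1 - s) - ?q 0)) {0..1 - s}"
    proof (rule fundamental_theorem_of_calculus)
      fix t
      have "((\<lambda>t. ?g (vec2 s t)) has_derivative (\<lambda>h. h *\<^sub>R (c - a))) (at t within {0..1 - s})"
        by (auto intro!: derivative_eq_intros)
      from has_derivative_compose[OF this poly2_has_derivative[OF p]]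
      have "(?q has_derivative (\<lambda>h. frechet_derivative p (at (?g (vec2 s t))) (h *\<^sub>R (c - a)))) (at t within {0..1 - s})" .
      moreover have "frechet_derivative p (at x) (h *\<^sub>R v) = h *\<^sub>R frechet_derivative p (at x) v" for x h v
        using poly2_has_derivative[OF p] has_derivative_linear linear_scale by blast
      ultimately show "(?q has_vector_derivative ?d (?g (vec2 s t))) (at t within {0..1 - s})"
        by (simp add: has_vector_derivative_def)
    qed (use s in auto)
    moreover have "?q (1 - s) = 0"
    proof (rule zero)
      have "?g (vec2 s (1 - s)) = b + (1 - s) *\<^sub>R (c - b)" by (simp add: algebra_simps)
      then show "?g (vec2 s (1 - s)) \<in> closed_segment b c"
        unfolding closed_segment_param using s by (intro image_eqI[of _ _ "1 - s"]) auto
    qed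
    ultimately show "((\<lambda>t. ?d (?g (vec2 s t))) has_integral (- p (a + s *\<^sub>R (b - a)))) {0..1 - s}"
      by simp
  qed
  then show ?thesis by (subst integral_hull[OF d]) simp
qed

end

section \<open>Weak gradient and weak divergence\<close>

lemma integral_nonneg_eq_0:
  fixes f :: "'a::euclidean_space \<Rightarrow> real"
  assumes K: "compact K" and f: "continuous_on K f" "\<And>x. x \<in> K \<Longrightarrow> 0 \<le> f x"
    and 0: "integral K f = 0" and x: "x \<in> interior K"
  shows "f x = 0"
proof -
  obtain u v where uv: "cbox u v \<subseteq> interior K" "x \<in> box u v"
    using open_contains_cbox[OF open_interior x] by metis
  then have sub: "cbox u v \<subseteq> K" using interior_subset by blast
  then have int: "f integrable_on cbox u v"
    using f(1) continuous_on_subset integrable_continuous by blast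
  have "integral (cbox u v) f \<le> integral K f"
    using int sub f integral_compact(3)[OF K f(1)] by (intro integral_subset_le) auto
  moreover have "0 \<le> integral (cbox u v) f"
    using int sub f(2) by (intro integral_nonneg) auto
  ultimately have "(f has_integral 0) (cbox u v)" using 0 int by (simp add: has_integral_iff)
  moreover have "x \<in> cbox u v" using uv(2) box_subset_cbox by blast
  ultimately show ?thesis
    using sub f uv(2) continuous_on_subset box_subset_cbox
    by (intro has_integral_0_cbox_imp_0[of u v f x]) (auto intro: continuous_on_subset dest: subsetD[OF box_subset_cbox])
qed

lemma triangle_convex_compact:
  assumes "triangle K"
  shows "compact K" "convex K" "interior K \<noteq> {}"
proof -
  obtain a b c where abc: "K = convex hull {a, b, c}" "nondeg_triangle a b c"
    using triangle_obtain[OF assms] .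
  interpret nondeg_triangle a b c by fact
  interpret r: nondeg_triangle b c a by (rule rotate)
  interpret rr: nondeg_triangle c a b by (rule r.rotate)
  show "compact K" "convex K" unfolding abc(1) by (simp_all add: compact_hull)
  have "(1/3) *\<^sub>R a + (1/3) *\<^sub>R b + (1/3) *\<^sub>R c \<in> interior K"
    unfolding abc(1) using bary_comb[of "1/3" "1/3" "1/3"] r.bary_comb[of "1/3" "1/3" "1/3"]
      rr.bary_comb[of "1/3" "1/3" "1/3"]
    by (intro subsetD[OF interior_hull]) (simp add: add_ac)
  then show "interior K \<noteq> {}" by blast
qed

lemma triangle_edge:
  assumes "triangle K" "e \<in> edges K"
  obtains p q where "p \<noteq> q" "e = closed_segment p q"
  using assms(2) unfolding edges_def by blast

lemma finite_edges: "triangle K \<Longrightarrow> finite (edges K)"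
  by (metis finite.emptyI finite_insert nondeg_triangle.edges_hull triangle_obtain)

text \<open>Linearity in the form \<open>f (x + c *\<^sub>R y) = f x + c *\<^sub>R f y\<close>, for maps that are linear only
  on a subspace because they involve integrals.\<close>

definition linear_on_set :: "'a::real_vector set \<Rightarrow> ('a \<Rightarrow> 'b::real_vector) \<Rightarrow> bool" where
  "linear_on_set X f \<longleftrightarrow> (\<forall>x\<in>X. \<forall>y\<in>X. \<forall>c. f (x + c *\<^sub>R y) = f x + c *\<^sub>R f y)"

lemma linear_on_setD:
  assumes "linear_on_set X f" "subspace X"
  shows "x \<in> X \<Longrightarrow> y \<in> X \<Longrightarrow> f (x + y) = f x + f y"
    and "f 0 = 0"
    and "x \<in> X \<Longrightarrow> f (c *\<^sub>R x) = c *\<^sub>R f x"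
proof -
  have lin: "f (x + c *\<^sub>R y) = f x + c *\<^sub>R f y" if "x \<in> X" "y \<in> X" for x y c
    using assms(1) that unfolding linear_on_set_def by blast
  have X0: "0 \<in> X" using assms(2) subspace_0 by blast
  show "x \<in> X \<Longrightarrow> y \<in> X \<Longrightarrow> f (x + y) = f x + f y" using lin[of x y 1] by simp
  show f0: "f 0 = 0" using lin[OF X0 X0, of 1] by simp
  show "x \<in> X \<Longrightarrow> f (c *\<^sub>R x) = c *\<^sub>R f x" using lin[OF X0, of x c] f0 by simp
qed

lemma integral_linear_comb:
  fixes f g :: "'a::euclidean_space \<Rightarrow> real"
  assumes "compact K" "continuous_on K f" "continuous_on K g"
  shows "integral K (\<lambda>x. f x + c * g x) = integral K f + c * integral K g"
proof -
  have "f integrable_on K" "(\<lambda>x. c * g x) integrable_on K"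
    using assms by (auto intro!: integral_compact(3) continuous_intros)
  then show ?thesis by (simp add: integral_add)
qed

lemma edge_int_linear_comb:
  fixes f g :: "pt \<Rightarrow> real"
  assumes "p \<noteq> q" "continuous_on (closed_segment p q) f" "continuous_on (closed_segment p q) g"
  shows "edge_int (closed_segment p q) (\<lambda>x. f x + c * g x) =
    edge_int (closed_segment p q) f + c * edge_int (closed_segment p q) g"
  using assms by (simp add: edge_int_add edge_int_scale continuous_on_mult_left)

lemma sum_edge_int_linear_comb:
  fixes f g :: "pt set \<Rightarrow> pt \<Rightarrow> real"
  assumes "triangle K" "\<And>e. e \<in> edges K \<Longrightarrow> continuous_on e (f e)"
    "\<And>e. e \<in> edges K \<Longrightarrow> continuous_on e (g e)"
  shows "(\<Sum>e\<in>edges K. edge_int e (\<lambda>x. f e x + c * g e x)) =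
    (\<Sum>e\<in>edges K. edge_int e (f e)) + c * (\<Sum>e\<in>edges K. edge_int e (g e))"
proof -
  have "edge_int e (\<lambda>x. f e x + c * g e x) = edge_int e (f e) + c * edge_int e (g e)"
    if e: "e \<in> edges K" for e
  proof -
    obtain p q where "p \<noteq> q" "e = closed_segment p q" using triangle_edge[OF assms(1) e] .
    then show ?thesis using assms(2,3)[OF e] edge_int_linear_comb by simp
  qed
  then show ?thesis by (simp add: sum.distrib sum_distrib_left)
qed

text \<open>The \<open>L^2\<close> product is nondegenerate on \<open>Y\<close>: a function
  orthogonal to itself vanishes in the interior, hence is zero by the identity hypothesis. Extension
  by zero makes the representative unique as a function on the plane, as the description operator
  demands.\<close>

lemma riesz_on_polynomials:
  fixes Y :: "(pt \<Rightarrow> 'b::euclidean_space) set"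
  assumes K: "compact K" "interior K \<noteq> {}" and Y: "subspace Y" "fin_dim Y"
    and cont: "\<And>q. q \<in> Y \<Longrightarrow> continuous_on K q"
    and zero: "\<And>q. q \<in> Y \<Longrightarrow> (\<And>x. x \<in> interior K \<Longrightarrow> q x = 0) \<Longrightarrow> q = 0"
    and L: "linear_on_set Y L"
  shows "\<exists>!g. g \<in> restrict0 K ` Y \<and> (\<forall>q\<in>Y. integral K (\<lambda>x. g x \<bullet> q x) = L q)"
proof -
  have "\<exists>!p. p \<in> Y \<and> (\<forall>q\<in>Y. integral K (\<lambda>x. p x \<bullet> q x) = L q)"
  proof (rule nondegenerate_form_ex1[OF Y])
    fix p assume p: "p \<in> Y" "\<And>q. q \<in> Y \<Longrightarrow> integral K (\<lambda>x. p x \<bullet> q x) = 0"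
    have "p x = 0" if "x \<in> interior K" for x
    proof -
      have "p x \<bullet> p x = 0"
        by (rule integral_nonneg_eq_0[OF K(1) _ _ p(2)[OF p(1)] that])
          (auto intro!: continuous_intros cont p)
      then show ?thesis by simp
    qed
    with zero p(1) show "p = 0" by blast
  next
    fix x y z assume xyz: "x \<in> Y" "y \<in> Y" "z \<in> Y"
    have i: "(\<lambda>t. u t \<bullet> v t) integrable_on K" if "u \<in> Y" "v \<in> Y" for u v
      using that by (intro integral_compact(3)[OF K(1)] continuous_intros cont)
    show "integral K (\<lambda>t. (x + y) t \<bullet> z t) = integral K (\<lambda>t. x t \<bullet> z t) + integral K (\<lambda>t. y t \<bullet> z t)"
      by (simp add: inner_add_left integral_add i xyz)
    show "integral K (\<lambda>t. z t \<bullet> (x + y) t) = integral K (\<lambda>t. z t \<bullet> x t) + integral K (\<lambda>t. z t \<bullet> y t)"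
      by (simp add: inner_add_right integral_add i xyz)
  qed (use linear_on_setD[OF L Y(1)] in auto)
  then obtain p where p: "p \<in> Y" "\<And>q. q \<in> Y \<Longrightarrow> integral K (\<lambda>x. p x \<bullet> q x) = L q"
    and uniq: "\<And>p'. p' \<in> Y \<Longrightarrow> \<forall>q\<in>Y. integral K (\<lambda>x. p' x \<bullet> q x) = L q \<Longrightarrow> p' = p"
    by blast
  have res: "integral K (\<lambda>x. restrict0 K r x \<bullet> q x) = integral K (\<lambda>x. r x \<bullet> q x)" for r q :: "pt \<Rightarrow> 'b"
    by (intro integral_cong) (simp add: restrict0_def)
  show ?thesis
  proof (rule ex1I[of _ "restrict0 K p"])
    show "restrict0 K p \<in> restrict0 K ` Y \<and> (\<forall>q\<in>Y. integral K (\<lambda>x. restrict0 K p x \<bullet> q x) = L q)"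
      using p by (simp add: res)
  qed (use uniq res in auto)
qed

text \<open>A global weak function as seen from one triangle: only the entries at \<open>K\<close>
  and at its edges are constrained, so a member of \<open>Sh0\<close> belongs to this set for every
  triangle of the mesh.\<close>

definition local_wfun :: "nat \<Rightarrow> pt set \<Rightarrow> wfun set" where
  "local_wfun k K = {v. fst v K \<in> Pk k K \<and> (\<forall>e\<in>edges K. snd v e \<in> Pedge (k + 1) e)}"

text \<open>The defining right-hand side as a functional of two arguments: linearity in the field
  gives existence of the weak gradient, linearity in the weak function gives linearity of the
  operator.\<close>

definition wgrad_rhs :: "pt set \<Rightarrow> wfun \<Rightarrow> (pt \<Rightarrow> pt) \<Rightarrow> real" where
  "wgrad_rhs K v q = - integral K (\<lambda>x. fst v K x * div2 q x)
    + (\<Sum>e\<in>edges K. edge_int e (\<lambda>x. snd v e x * (q x \<bullet> normal K e)))"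

definition wdiv_rhs :: "pt set \<Rightarrow> wfun \<times> wfun \<Rightarrow> (pt \<Rightarrow> real) \<Rightarrow> real" where
  "wdiv_rhs K v q = - integral K (\<lambda>x. vec2 (fst (fst v) K x) (fst (snd v) K x) \<bullet> grad2 q x)
    + (\<Sum>e\<in>edges K. edge_int e (\<lambda>x. (vec2 (snd (fst v) e x) (snd (snd v) e x) \<bullet> normal K e) * q x))"

lemma subspace_Pedge:
  assumes "a \<noteq> b" shows "subspace (Pedge k (closed_segment a b))"
  unfolding Pedge_eq[OF assms refl] by (simp add: linear_subspace_image linear_restrict0)

lemma subspace_local_wfun:
  assumes "triangle K"
  shows "subspace (local_wfun k K)"
proof -
  have e: "subspace (Pedge (Suc k) e)" if e: "e \<in> edges K" for e
  proof -
    obtain p q where "p \<noteq> q" "e = closed_segment p q" using triangle_edge[OF assms e] .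
    then show ?thesis by (simp add: subspace_Pedge)
  qed
  show ?thesis
    by (rule subspaceI)
      (auto simp: local_wfun_def intro: subspace_add[OF subspace_Pk] subspace_scale[OF subspace_Pk]
        subspace_0[OF subspace_Pk] subspace_add[OF e] subspace_scale[OF e] subspace_0[OF e])
qed

lemma restrict0_continuous_on: "continuous_on S f \<Longrightarrow> continuous_on S (restrict0 S f)"
  by (simp add: restrict0_def cong: continuous_on_cong)

lemma Pk_continuous_on: "f \<in> Pk k K \<Longrightarrow> continuous_on K f"
  by (auto simp: Pk_eq intro!: restrict0_continuous_on intro: poly2_continuous_on)

lemma vPk_continuous_on: "g \<in> vPk k K \<Longrightarrow> continuous_on K g"
  by (auto simp: vPk_eq intro!: restrict0_continuous_on intro: vpoly2_continuous_on)

lemma local_wfun_continuous: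
  assumes "triangle K" "v \<in> local_wfun k K"
  shows "continuous_on K (fst v K)" and "e \<in> edges K \<Longrightarrow> continuous_on e (snd v e)"
proof -
  show "continuous_on K (fst v K)" using assms(2) Pk_continuous_on by (auto simp: local_wfun_def)
  assume e: "e \<in> edges K"
  obtain p q where pq: "p \<noteq> q" "e = closed_segment p q" using triangle_edge[OF assms(1) e] .
  have "snd v e \<in> restrict0 e ` poly2 (k + 1)"
    using assms(2) e Pedge_eq[OF pq] by (auto simp: local_wfun_def)
  then obtain r where "snd v e = restrict0 e r" "r \<in> poly2 (k + 1)" by blast
  then show "continuous_on e (snd v e)"
    by (simp add: restrict0_continuous_on poly2_continuous_on)
qed

lemma grad2_continuous_on:
  assumes "q \<in> poly2 k" shows "continuous_on S (\<lambda>x. grad2 q x)"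
  unfolding grad2_def
  by (intro continuous_on_vec_lambda poly2_continuous_on[OF poly2_derivative[OF assms]])

lemma grad2_linear:
  assumes "p \<in> poly2 k" "q \<in> poly2 k"
  shows "grad2 (\<lambda>x. p x + c * q x) x = grad2 p x + c *\<^sub>R grad2 q x"
  using assms
  by (simp add: grad2_def vec_eq_iff frechet_derivative_add_poly2[of _ k]
      frechet_derivative_scale_poly2[of _ k] poly2_scale)

lemma div2_linear:
  assumes "p \<in> vpoly2 k" "q \<in> vpoly2 k"
  shows "div2 (p + c *\<^sub>R q) x = div2 p x + c * div2 q x"
proof -
  have pq: "p + c *\<^sub>R q \<in> vpoly2 k"
    using assms by (intro subspace_add subspace_scale) auto
  then have *: "(\<lambda>x. p x $ i + c * q x $ i) = (\<lambda>x. (p + c *\<^sub>R q) x $ i)" for i by simp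
  have "frechet_derivative (\<lambda>x. (p + c *\<^sub>R q) x $ i) (at x) h = frechet_derivative (\<lambda>x. p x $ i) (at x) h
      + c * frechet_derivative (\<lambda>x. q x $ i) (at x) h" for i h
    using assms exhaust_2[of i] unfolding *[symmetric] vpoly2_def
    by (auto simp: frechet_derivative_add_poly2[of _ k] frechet_derivative_scale_poly2[of _ k] poly2_scale)
  then show ?thesis
    using assms pq by (simp only: div2_vpoly2) (simp add: algebra_simps)
qed

section \<open>Linearity of the defining right-hand sides in each argument\<close>

lemma wgrad_rhs_linear_test:
  assumes K: "triangle K" and v: "v \<in> local_wfun k K"
  shows "linear_on_set (vpoly2 m) (wgrad_rhs K v)"
  unfolding linear_on_set_def
proof (intro ballI allI)
  fix p q c assume pq: "p \<in> vpoly2 m" "q \<in> vpoly2 m"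
  note cont = local_wfun_continuous[OF K v] vpoly2_continuous_on[OF pq(1)] vpoly2_continuous_on[OF pq(2)]
    poly2_continuous_on[OF div2_poly2[OF pq(1)]] poly2_continuous_on[OF div2_poly2[OF pq(2)]]
  have "integral K (\<lambda>x. fst v K x * div2 (p + c *\<^sub>R q) x) =
      integral K (\<lambda>x. fst v K x * div2 p x + c * (fst v K x * div2 q x))"
    by (simp only: div2_linear[OF pq] distrib_left mult.left_commute)
  also have "\<dots> = integral K (\<lambda>x. fst v K x * div2 p x) + c * integral K (\<lambda>x. fst v K x * div2 q x)"
    using triangle_convex_compact[OF K] by (intro integral_linear_comb continuous_intros cont)
  finally have 1: "integral K (\<lambda>x. fst v K x * div2 (p + c *\<^sub>R q) x) = \<dots>" .
  have "(\<Sum>e\<in>edges K. edge_int e (\<lambda>x. snd v e x * ((p + c *\<^sub>R q) x \<bullet> normal K e))) =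
      (\<Sum>e\<in>edges K. edge_int e (\<lambda>x. snd v e x * (p x \<bullet> normal K e) + c * (snd v e x * (q x \<bullet> normal K e))))"
    by (simp add: inner_add_left distrib_left mult.left_commute)
  also have "\<dots> = (\<Sum>e\<in>edges K. edge_int e (\<lambda>x. snd v e x * (p x \<bullet> normal K e)))
      + c * (\<Sum>e\<in>edges K. edge_int e (\<lambda>x. snd v e x * (q x \<bullet> normal K e)))"
    by (intro sum_edge_int_linear_comb[OF K] continuous_intros cont)
  finally show "wgrad_rhs K v (p + c *\<^sub>R q) = wgrad_rhs K v p + c *\<^sub>R wgrad_rhs K v q"
    unfolding wgrad_rhs_def 1 by (simp add: algebra_simps)
qed

lemma wgrad_rhs_linear:
  assumes K: "triangle K" and q: "q \<in> vpoly2 m"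
  shows "linear_on_set (local_wfun k K) (\<lambda>v. wgrad_rhs K v q)"
  unfolding linear_on_set_def
proof (intro ballI allI)
  fix v w c assume v: "v \<in> local_wfun k K" and w: "w \<in> local_wfun k K"
  note cont = local_wfun_continuous[OF K v] local_wfun_continuous[OF K w] vpoly2_continuous_on[OF q]
    poly2_continuous_on[OF div2_poly2[OF q]]
  have "integral K (\<lambda>x. fst (v + c *\<^sub>R w) K x * div2 q x) =
      integral K (\<lambda>x. fst v K x * div2 q x + c * (fst w K x * div2 q x))"
    by (simp add: distrib_right mult.assoc)
  also have "\<dots> = integral K (\<lambda>x. fst v K x * div2 q x) + c * integral K (\<lambda>x. fst w K x * div2 q x)"
    using triangle_convex_compact[OF K] by (intro integral_linear_comb continuous_intros cont)
  finally have 1: "integral K (\<lambda>x. fst (v + c *\<^sub>R w) K x * div2 q x) = \<dots>" .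
  have "(\<Sum>e\<in>edges K. edge_int e (\<lambda>x. snd (v + c *\<^sub>R w) e x * (q x \<bullet> normal K e))) =
      (\<Sum>e\<in>edges K. edge_int e (\<lambda>x. snd v e x * (q x \<bullet> normal K e) + c * (snd w e x * (q x \<bullet> normal K e))))"
    by (simp add: distrib_right mult.assoc)
  also have "\<dots> = (\<Sum>e\<in>edges K. edge_int e (\<lambda>x. snd v e x * (q x \<bullet> normal K e)))
      + c * (\<Sum>e\<in>edges K. edge_int e (\<lambda>x. snd w e x * (q x \<bullet> normal K e)))"
    by (intro sum_edge_int_linear_comb[OF K] continuous_intros cont)
  finally show "wgrad_rhs K (v + c *\<^sub>R w) q = wgrad_rhs K v q + c *\<^sub>R wgrad_rhs K w q"
    unfolding wgrad_rhs_def 1 by (simp add: algebra_simps)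
qed

lemma wdiv_rhs_linear_test:
  assumes K: "triangle K" and v: "fst v \<in> local_wfun k K" "snd v \<in> local_wfun k K"
  shows "linear_on_set (poly2 m) (wdiv_rhs K v)"
  unfolding linear_on_set_def
proof (intro ballI allI)
  fix p q c assume pq: "p \<in> poly2 m" "q \<in> poly2 m"
  note cont = local_wfun_continuous[OF K v(1)] local_wfun_continuous[OF K v(2)]
    poly2_continuous_on[OF pq(1)] poly2_continuous_on[OF pq(2)]
    grad2_continuous_on[OF pq(1)] grad2_continuous_on[OF pq(2)]
  let ?v0 = "\<lambda>x. vec2 (fst (fst v) K x) (fst (snd v) K x)"
  let ?n = "\<lambda>e x. vec2 (snd (fst v) e x) (snd (snd v) e x) \<bullet> normal K e"
  have pcq: "p + c *\<^sub>R q = (\<lambda>x. p x + c * q x)" by (simp add: fun_eq_iff)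
  have "integral K (\<lambda>x. ?v0 x \<bullet> grad2 (p + c *\<^sub>R q) x) =
      integral K (\<lambda>x. ?v0 x \<bullet> grad2 p x + c * (?v0 x \<bullet> grad2 q x))"
    by (simp only: pcq grad2_linear[OF pq] inner_add_right inner_scaleR_right)
  also have "\<dots> = integral K (\<lambda>x. ?v0 x \<bullet> grad2 p x) + c * integral K (\<lambda>x. ?v0 x \<bullet> grad2 q x)"
    using triangle_convex_compact[OF K]
    by (intro integral_linear_comb continuous_intros continuous_on_vec2 cont)
  finally have 1: "integral K (\<lambda>x. ?v0 x \<bullet> grad2 (p + c *\<^sub>R q) x) = \<dots>" .
  have "(\<Sum>e\<in>edges K. edge_int e (\<lambda>x. ?n e x * (p + c *\<^sub>R q) x)) =
      (\<Sum>e\<in>edges K. edge_int e (\<lambda>x. ?n e x * p x + c * (?n e x * q x)))"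
    by (simp add: distrib_left mult.left_commute)
  also have "\<dots> = (\<Sum>e\<in>edges K. edge_int e (\<lambda>x. ?n e x * p x))
      + c * (\<Sum>e\<in>edges K. edge_int e (\<lambda>x. ?n e x * q x))"
    by (intro sum_edge_int_linear_comb[OF K] continuous_intros continuous_on_vec2 cont)
  finally show "wdiv_rhs K v (p + c *\<^sub>R q) = wdiv_rhs K v p + c *\<^sub>R wdiv_rhs K v q"
    unfolding wdiv_rhs_def 1 by (simp add: algebra_simps)
qed

lemma wdiv_rhs_linear:
  assumes K: "triangle K" and q: "q \<in> poly2 m"
  shows "linear_on_set (local_wfun k K \<times> local_wfun k K) (\<lambda>v. wdiv_rhs K v q)"
  unfolding linear_on_set_def
proof (intro ballI allI)
  fix v w c assume "v \<in> local_wfun k K \<times> local_wfun k K" "w \<in> local_wfun k K \<times> local_wfun k K"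
  then have v: "fst v \<in> local_wfun k K" "snd v \<in> local_wfun k K"
    and w: "fst w \<in> local_wfun k K" "snd w \<in> local_wfun k K" by auto
  note cont = local_wfun_continuous[OF K v(1)] local_wfun_continuous[OF K v(2)]
    local_wfun_continuous[OF K w(1)] local_wfun_continuous[OF K w(2)]
    poly2_continuous_on[OF q] grad2_continuous_on[OF q]
  let ?v0 = "\<lambda>v x. vec2 (fst (fst v) K x) (fst (snd v) K x)"
  let ?n = "\<lambda>v e x. vec2 (snd (fst v) e x) (snd (snd v) e x) \<bullet> normal K e"
  have "integral K (\<lambda>x. ?v0 (v + c *\<^sub>R w) x \<bullet> grad2 q x) =
      integral K (\<lambda>x. ?v0 v x \<bullet> grad2 q x + c * (?v0 w x \<bullet> grad2 q x))"
    by (simp add: inner_pt algebra_simps)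
  also have "\<dots> = integral K (\<lambda>x. ?v0 v x \<bullet> grad2 q x) + c * integral K (\<lambda>x. ?v0 w x \<bullet> grad2 q x)"
    using triangle_convex_compact[OF K]
    by (intro integral_linear_comb continuous_intros continuous_on_vec2 cont)
  finally have 1: "integral K (\<lambda>x. ?v0 (v + c *\<^sub>R w) x \<bullet> grad2 q x) = \<dots>" .
  have "(\<Sum>e\<in>edges K. edge_int e (\<lambda>x. ?n (v + c *\<^sub>R w) e x * q x)) =
      (\<Sum>e\<in>edges K. edge_int e (\<lambda>x. ?n v e x * q x + c * (?n w e x * q x)))"
    by (simp add: inner_pt algebra_simps)
  also have "\<dots> = (\<Sum>e\<in>edges K. edge_int e (\<lambda>x. ?n v e x * q x))
      + c * (\<Sum>e\<in>edges K. edge_int e (\<lambda>x. ?n w e x * q x))"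
    by (intro sum_edge_int_linear_comb[OF K] continuous_intros continuous_on_vec2 cont)
  finally show "wdiv_rhs K (v + c *\<^sub>R w) q = wdiv_rhs K v q + c *\<^sub>R wdiv_rhs K w q"
    unfolding wdiv_rhs_def 1 by (simp add: algebra_simps)
qed

section \<open>The weak operators as Riesz representatives\<close>

lemma wgrad_ex1:
  assumes K: "triangle K" and v: "v \<in> local_wfun k K"
  shows "\<exists>!g. g \<in> vPk m K \<and> (\<forall>q\<in>vpoly2 m. integral K (\<lambda>x. g x \<bullet> q x) = wgrad_rhs K v q)"
  unfolding vPk_eq
proof (rule riesz_on_polynomials)
  fix q assume q: "q \<in> vpoly2 m" "\<And>x. x \<in> interior K \<Longrightarrow> q x = 0"
  then have "(\<lambda>x. q x $ 1) = (\<lambda>x. 0)" "(\<lambda>x. q x $ 2) = (\<lambda>x. 0)"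
    using triangle_convex_compact[OF K]
    by (auto intro!: poly2_eq_0_if_open[of _ m "interior K"] simp: vpoly2_def)
  then show "q = 0" by (simp add: fun_eq_iff vec_eq_iff forall_2)
qed (use triangle_convex_compact[OF K] wgrad_rhs_linear_test[OF K v] vpoly2_continuous_on in auto)

lemma wgrad_altdef:
  "wgrad k K v = (THE g. g \<in> vPk (k + 1) K \<and>
     (\<forall>q\<in>vpoly2 (k + 1). integral K (\<lambda>x. g x \<bullet> q x) = wgrad_rhs K v q))"
  unfolding wgrad_def wgrad_rhs_def vpoly2_def Ball_def by simp

lemma wgrad_props:
  assumes "triangle K" "v \<in> local_wfun k K"
  shows "wgrad k K v \<in> vPk (k + 1) K"
    and "q \<in> vpoly2 (k + 1) \<Longrightarrow> integral K (\<lambda>x. wgrad k K v x \<bullet> q x) = wgrad_rhs K v q"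
  using theI'[OF wgrad_ex1[OF assms, of "k + 1"]] unfolding wgrad_altdef by blast+

lemma wgrad_unique:
  assumes "triangle K" "v \<in> local_wfun k K" "g \<in> vPk (k + 1) K"
    and "\<And>q. q \<in> vpoly2 (k + 1) \<Longrightarrow> integral K (\<lambda>x. g x \<bullet> q x) = wgrad_rhs K v q"
  shows "wgrad k K v = g"
  unfolding wgrad_altdef
  by (rule the1_equality[OF wgrad_ex1[OF assms(1,2)]]) (use assms(3,4) in blast)

text \<open>By uniqueness: the combination of two weak gradients satisfies the identity that
  characterizes the weak gradient of the combination.\<close>

lemma wgrad_linear:
  assumes K: "triangle K"
  shows "linear_on_set (local_wfun k K) (wgrad k K)"
  unfolding linear_on_set_def
proof (intro ballI allI)
  fix v w c assume v: "v \<in> local_wfun k K" and w: "w \<in> local_wfun k K"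
  have sub: "subspace (vPk (k + 1) K)" 
    unfolding vPk_eq by (simp add: linear_subspace_image linear_restrict0)
  show "wgrad k K (v + c *\<^sub>R w) = wgrad k K v + c *\<^sub>R wgrad k K w"
  proof (rule wgrad_unique[OF K])
    show "v + c *\<^sub>R w \<in> local_wfun k K"
      using v w subspace_local_wfun[OF K] by (intro subspace_add subspace_scale)
    show "wgrad k K v + c *\<^sub>R wgrad k K w \<in> vPk (k + 1) K"
      using sub wgrad_props(1)[OF K] v w by (intro subspace_add subspace_scale)
    fix q assume q: "q \<in> vpoly2 (k + 1)"
    have "integral K (\<lambda>x. (wgrad k K v + c *\<^sub>R wgrad k K w) x \<bullet> q x) =
        integral K (\<lambda>x. wgrad k K v x \<bullet> q x + c * (wgrad k K w x \<bullet> q x))"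
      by (simp add: inner_add_left)
    also have "\<dots> = integral K (\<lambda>x. wgrad k K v x \<bullet> q x) + c * integral K (\<lambda>x. wgrad k K w x \<bullet> q x)"
      using triangle_convex_compact[OF K] wgrad_props(1)[OF K] v w q
      by (intro integral_linear_comb continuous_intros vPk_continuous_on vpoly2_continuous_on)
    also have "\<dots> = wgrad_rhs K (v + c *\<^sub>R w) q"
      using wgrad_rhs_linear[OF K q, of k] v w q wgrad_props(2)[OF K] by (simp add: linear_on_set_def)
    finally show "integral K (\<lambda>x. (wgrad k K v + c *\<^sub>R wgrad k K w) x \<bullet> q x) = wgrad_rhs K (v + c *\<^sub>R w) q" .
  qed
qed

lemma wdiv_ex1:
  assumes K: "triangle K" and v: "fst v \<in> local_wfun k K" "snd v \<in> local_wfun k K"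
  shows "\<exists>!d. d \<in> Pk m K \<and> (\<forall>q\<in>poly2 m. integral K (\<lambda>x. d x * q x) = wdiv_rhs K v q)"
  unfolding Pk_eq inner_real_def[symmetric]
proof (rule riesz_on_polynomials)
  fix q assume "q \<in> poly2 m" "\<And>x. x \<in> interior K \<Longrightarrow> q x = 0"
  then show "q = 0"
    using triangle_convex_compact[OF K] poly2_eq_0_if_open[of q m "interior K"]
    by (simp add: zero_fun_def)
qed (use triangle_convex_compact[OF K] wdiv_rhs_linear_test[OF K v] poly2_continuous_on in auto)

lemma wdiv_altdef:
  "wdiv k K v = (THE d. d \<in> Pk (k + 1) K \<and>
     (\<forall>q\<in>poly2 (k + 1). integral K (\<lambda>x. d x * q x) = wdiv_rhs K v q))"
  unfolding wdiv_def wdiv_rhs_def ..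

lemma wdiv_props:
  assumes "triangle K" "fst v \<in> local_wfun k K" "snd v \<in> local_wfun k K"
  shows "wdiv k K v \<in> Pk (k + 1) K"
    and "q \<in> poly2 (k + 1) \<Longrightarrow> integral K (\<lambda>x. wdiv k K v x * q x) = wdiv_rhs K v q"
  using theI'[OF wdiv_ex1[OF assms, of "k + 1"]] unfolding wdiv_altdef by blast+

text \<open>Pressures have degree \<open>k\<close> and are thus admissible tests for the weak
  divergence, so pairings with them are read off from the boundary and volume terms without
  computing \<open>wdiv\<close>.\<close>

lemma integral_Pk_wdiv:
  assumes "triangle K" "fst v \<in> local_wfun k K" "snd v \<in> local_wfun k K" and q: "q \<in> poly2 k"
  shows "integral K (\<lambda>x. restrict0 K q x * wdiv k K v x) = wdiv_rhs K v q"
proof -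
  have "integral K (\<lambda>x. restrict0 K q x * wdiv k K v x) = integral K (\<lambda>x. wdiv k K v x * q x)"
    by (intro integral_cong) (simp add: restrict0_def mult.commute)
  then show ?thesis using wdiv_props(2)[OF assms(1-3)] q poly2_mono[of k "k + 1"] by auto
qed

section \<open>The kernel of the local weak gradient\<close>

lemma scaled_field:
  assumes "\<phi> \<in> poly2 m"
  shows "(\<lambda>x. \<phi> x *\<^sub>R d) \<in> vpoly2 m" and "div2 (\<lambda>x. \<phi> x *\<^sub>R d) x = frechet_derivative \<phi> (at x) d"
proof -
  show v: "(\<lambda>x. \<phi> x *\<^sub>R d) \<in> vpoly2 m"
    using poly2_scale[OF assms, of "d$1"] poly2_scale[OF assms, of "d$2"]
    by (simp add: vpoly2_def mult.commute)
  have "div2 (\<lambda>x. \<phi> x *\<^sub>R d) x = d$1 * frechet_derivative \<phi> (at x) (axis 1 1) + d$2 * frechet_derivative \<phi> (at x) (axis 2 1)"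
    unfolding div2_vpoly2[OF v] using frechet_derivative_scale_poly2[OF assms]
    by (simp add: mult.commute[of "\<phi> _"])
  also have "\<dots> = frechet_derivative \<phi> (at x) d"
    unfolding frechet_derivative_poly2_components[OF assms, of x d] by (simp add: inner_pt grad2_def mult.commute)
  finally show "div2 (\<lambda>x. \<phi> x *\<^sub>R d) x = frechet_derivative \<phi> (at x) d" .
qed

lemma poly_bary_poly2:
  assumes "degree Q \<le> k"
  shows "(\<lambda>x. poly Q (bary p q r x)) \<in> poly2 k"
  unfolding poly_altdef
proof (intro poly2_sum poly2_scale)
  fix i assume "i \<in> {..degree Q}"
  then show "(\<lambda>x. bary p q r x ^ i) \<in> poly2 k"
    using poly2_power[OF bary_poly2] poly2_mono[of i k] assms by auto
qed

lemma edge_int_eq_0: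
  assumes "a \<noteq> b" "\<And>x. x \<in> closed_segment a b \<Longrightarrow> f x = 0"
  shows "edge_int (closed_segment a b) f = 0"
  using edge_int_cong[OF assms(1), of f "\<lambda>x. 0"] assms(2) edge_int_scale[OF assms(1), of 0 "\<lambda>x. 0"] by simp

context nondeg_triangle
begin

lemma wgrad_rhs_scaled:
  assumes \<phi>: "\<phi> \<in> poly2 m" and K: "K = convex hull {a, b, c}" and v0: "fst v K = restrict0 K w"
  shows "wgrad_rhs K v (\<lambda>x. \<phi> x *\<^sub>R d) = - integral K (\<lambda>x. w x * frechet_derivative \<phi> (at x) d)
    + edge_int (closed_segment a b) (\<lambda>x. snd v (closed_segment a b) x * (\<phi> x * (d \<bullet> outward a b c)))
    + edge_int (closed_segment b c) (\<lambda>x. snd v (closed_segment b c) x * (\<phi> x * (d \<bullet> outward b c a)))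
    + edge_int (closed_segment c a) (\<lambda>x. snd v (closed_segment c a) x * (\<phi> x * (d \<bullet> outward c a b)))"
proof -
  interpret r: nondeg_triangle b c a by (rule rotate)
  interpret rr: nondeg_triangle c a b by (rule r.rotate)
  have n: "normal K (closed_segment a b) = outward a b c" "normal K (closed_segment b c) = outward b c a"
    "normal K (closed_segment c a) = outward c a b"
    using normal_hull r.normal_hull rr.normal_hull by (simp_all add: K insert_commute)
  have "integral K (\<lambda>x. fst v K x * div2 (\<lambda>x. \<phi> x *\<^sub>R d) x) =
      integral K (\<lambda>x. w x * frechet_derivative \<phi> (at x) d)"
    by (intro integral_cong) (simp add: v0 restrict0_def scaled_field(2)[OF \<phi>])
  moreover have "(\<Sum>e\<in>edges K. edge_int e (\<lambda>x. snd v e x * (\<phi> x *\<^sub>R d \<bullet> normal K e))) =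
     edge_int (closed_segment a b) (\<lambda>x. snd v (closed_segment a b) x * (\<phi> x * (d \<bullet> outward a b c)))
    + edge_int (closed_segment b c) (\<lambda>x. snd v (closed_segment b c) x * (\<phi> x * (d \<bullet> outward b c a)))
    + edge_int (closed_segment c a) (\<lambda>x. snd v (closed_segment c a) x * (\<phi> x * (d \<bullet> outward c a b)))"
    unfolding n[symmetric] K by (subst sum_edges_hull) simp
  ultimately show ?thesis unfolding wgrad_rhs_def by (simp only: add.assoc)
qed

lemma open_positive:
  shows "open {x. bary b c a x > 0 \<and> bary c a b x > 0 \<and> bary a b c x > 0}" (is "open ?U")
    and "{x. bary b c a x > 0 \<and> bary c a b x > 0 \<and> bary a b c x > 0} \<noteq> {}"
proof -
  show "open ?U" by (intro open_Collect_conj open_Collect_less continuous_on_const bary_continuous)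
  interpret r: nondeg_triangle b c a by (rule rotate)
  interpret rr: nondeg_triangle c a b by (rule r.rotate)
  have "(1/3) *\<^sub>R a + (1/3) *\<^sub>R b + (1/3) *\<^sub>R c \<in> ?U"
    using bary_comb[of "1/3" "1/3" "1/3"] r.bary_comb[of "1/3" "1/3" "1/3"]
      rr.bary_comb[of "1/3" "1/3" "1/3"] by (simp add: add_ac)
  then show "?U \<noteq> {}" by blast
qed

text \<open>Tested with the field \<open>(\<lambda>\<^sub>a * \<lambda>\<^sub>b * r) *\<^sub>R (b - a)\<close>, whose normal component vanishes on every
  edge, for \<open>r\<close> the derivative of the interior part in the direction \<open>b - a\<close>.\<close>

lemma kernel_tangential_derivative:
  assumes K: "K = convex hull {a, b, c}" and w: "w \<in> poly2 k" and v0: "fst v K = restrict0 K w"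
    and ker: "\<And>q. q \<in> vpoly2 (k + 1) \<Longrightarrow> wgrad_rhs K v q = 0"
  shows "frechet_derivative w (at x) (b - a) = 0"
proof (cases "k = 0")
  case True
  then show ?thesis using w poly2_0_derivative by simp
next
  case False
  interpret r: nondeg_triangle b c a by (rule rotate)
  interpret rr: nondeg_triangle c a b by (rule r.rotate)
  interpret s: nondeg_triangle a c b by (rule rr.swap)
  define r where "r = (\<lambda>x. frechet_derivative w (at x) (b - a))"
  have r: "r \<in> poly2 (k - 1)" unfolding r_def by (rule poly2_derivative[OF w])
  define \<phi> where "\<phi> = (\<lambda>x. (bary b c a x * bary c a b x) * r x)"
  have "\<phi> \<in> poly2 (1 + 1 + (k - 1))" unfolding \<phi>_def by (intro poly2_mult bary_poly2 r)
  \<comment> \<open>Holds only for positive \<open>k\<close>; with truncated subtraction the degree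
    bound for \<open>k = 0\<close> would be 2 and the field inadmissible, which is why that case is
    treated apart.\<close>
  moreover have "1 + 1 + (k - 1) = k + 1" using False by simp
  ultimately have \<phi>: "\<phi> \<in> poly2 (k + 1)" by (simp only:)
  have \<phi>0: "\<phi> x = 0" if "x \<in> closed_segment b c \<or> x \<in> closed_segment c a" for x
    using that r.bary_segment rr.bary_segment by (auto simp: \<phi>_def)
  let ?D\<phi> = "\<lambda>x. frechet_derivative \<phi> (at x) (b - a)"
  have "wgrad_rhs K v (\<lambda>x. \<phi> x *\<^sub>R (b - a)) = 0" using ker scaled_field(1)[OF \<phi>] by blast
  then have "integral K (\<lambda>x. w x * ?D\<phi> x) = 0"
    unfolding wgrad_rhs_scaled[OF \<phi> K v0]
    using distinct outward_inner(1) \<phi>0 by (simp add: edge_int_eq_0 inner_commute)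
  \<comment> \<open>The integrand is the derivative of \<open>w * \<phi>\<close> along
    \<open>b - a\<close>. The divergence theorem is read in the vertex order \<open>a\<close>,
    \<open>c\<close>, \<open>b\<close>, and no boundary term survives since \<open>\<phi>\<close>
    vanishes on \<open>b c\<close> and \<open>c a\<close>.\<close>
  moreover have "integral K (\<lambda>x. w x * ?D\<phi> x + 1 * (r x * \<phi> x)) = 0"
  proof -
    have "(\<lambda>x. w x * \<phi> x) \<in> poly2 (k + (k + 1))" by (rule poly2_mult[OF w \<phi>])
    from s.integral_derivative_along_edge[OF this]
    have "integral K (\<lambda>x. frechet_derivative (\<lambda>x. w x * \<phi> x) (at x) (b - a)) =
      - \<bar>cross2 (c - a) (b - a)\<bar> * integral {0..1} (\<lambda>s. w (a + s *\<^sub>R (c - a)) * \<phi> (a + s *\<^sub>R (c - a)))"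
      using \<phi>0 by (simp add: K insert_commute closed_segment_commute)
    also have "integral {0..1} (\<lambda>s. w (a + s *\<^sub>R (c - a)) * \<phi> (a + s *\<^sub>R (c - a))) = integral {0..1} (\<lambda>s::real. 0)"
    proof (intro integral_cong)
      fix s :: real assume "s \<in> {0..1}"
      then have "a + s *\<^sub>R (c - a) \<in> closed_segment c a"
        unfolding closed_segment_commute[of c a] closed_segment_param[of a c] by blast
      then show "w (a + s *\<^sub>R (c - a)) * \<phi> (a + s *\<^sub>R (c - a)) = 0" using \<phi>0 by simp
    qed
    finally show ?thesis by (simp add: frechet_derivative_mult_poly2[OF w \<phi>] r_def)
  qed
  moreover have "integral K (\<lambda>x. w x * ?D\<phi> x + 1 * (r x * \<phi> x)) =
      integral K (\<lambda>x. w x * ?D\<phi> x) + 1 * integral K (\<lambda>x. r x * \<phi> x)"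
    using compact_hull unfolding K
    by (intro integral_linear_comb continuous_intros poly2_continuous_on[OF w] poly2_continuous_on[OF r]
        poly2_continuous_on[OF \<phi>] poly2_continuous_on[OF poly2_derivative[OF \<phi>]])
  ultimately have int0: "integral K (\<lambda>x. r x * \<phi> x) = 0" by simp
  have r_\<phi>: "r x * \<phi> x = bary b c a x * bary c a b x * (r x * r x)" for x by (simp add: \<phi>_def)
  \<comment> \<open>The weight is strictly positive only where the barycentric coordinates are;
    vanishing on that open set extends to the whole plane by the identity theorem.\<close>
  have "r x = 0" if x: "x \<in> {x. bary b c a x > 0 \<and> bary c a b x > 0 \<and> bary a b c x > 0}" for x
  proof -
    have "r x * \<phi> x = 0"
    proof (rule integral_nonneg_eq_0[OF _ _ _ int0])
      show "compact K" using compact_hull K by simp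
      show "continuous_on K (\<lambda>x. r x * \<phi> x)"
        by (intro continuous_intros poly2_continuous_on[OF r] poly2_continuous_on[OF \<phi>])
      show "0 \<le> r x * \<phi> x" if "x \<in> K" for x
        using that unfolding r_\<phi> K hull_eq
        by (intro mult_nonneg_nonneg[OF mult_nonneg_nonneg zero_le_square]) auto
      show "x \<in> interior K" using x interior_hull K by blast
    qed
    then show ?thesis using x unfolding r_\<phi> by simp
  qed
  then have "r = (\<lambda>x. 0)" by (rule poly2_eq_0_if_open[OF r open_positive])
  then show ?thesis unfolding r_def by meson
qed

lemma kernel_interior_constant:
  assumes K: "K = convex hull {a, b, c}" and w: "w \<in> poly2 k" and v0: "fst v K = restrict0 K w"
    and ker: "\<And>q. q \<in> vpoly2 (k + 1) \<Longrightarrow> wgrad_rhs K v q = 0"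
  shows "\<exists>\<gamma>. w = (\<lambda>x. \<gamma>)"
proof -
  interpret r: nondeg_triangle b c a by (rule rotate)
  interpret rr: nondeg_triangle c a b by (rule r.rotate)
  interpret s: nondeg_triangle a c b by (rule rr.swap)
  have K': "K = convex hull {a, c, b}" by (simp add: K insert_commute)
  have "frechet_derivative w (at x) h = 0" for x h
  proof -
    have l: "linear (frechet_derivative w (at x))"
      using poly2_has_derivative[OF w] has_derivative_linear by blast
    \<comment> \<open>The barycentric coordinates of \<open>a + h\<close> express \<open>h\<close>
      through \<open>b - a\<close> and \<open>c - a\<close>, two directions along which the
      derivative is already known to vanish.\<close>
    let ?\<beta> = "bary c a b (a + h)" and ?\<gamma> = "bary a b c (a + h)"
    have \<alpha>: "bary b c a (a + h) = 1 - ?\<beta> - ?\<gamma>" using bary_decomp(1)[of "a + h"] by simp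
    have "(1 - ?\<beta> - ?\<gamma>) *\<^sub>R a + ?\<beta> *\<^sub>R b + ?\<gamma> *\<^sub>R c = a + h"
      using bary_decomp(2)[of "a + h"] unfolding \<alpha> .
    then have "h = ?\<beta> *\<^sub>R (b - a) + ?\<gamma> *\<^sub>R (c - a)" by (simp add: algebra_simps)
    then have "frechet_derivative w (at x) h = frechet_derivative w (at x) (?\<beta> *\<^sub>R (b - a) + ?\<gamma> *\<^sub>R (c - a))"
      by (rule arg_cong)
    also have "\<dots> = 0"
      unfolding linear_add[OF l] linear_scale[OF l]
      using kernel_tangential_derivative[OF K w v0 ker] s.kernel_tangential_derivative[OF K' w v0 ker] by simp
    finally show ?thesis .
  qed
  then have "frechet_derivative w (at x) = (\<lambda>h. 0)" for x by blast
  then have "(w has_derivative (\<lambda>h. 0)) (at x)" for x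
    using poly2_has_derivative[OF w, of x] by presburger
  then have "\<exists>\<gamma>. \<forall>x\<in>UNIV. w x = \<gamma>" by (intro has_derivative_zero_constant) auto
  then show ?thesis by (simp add: fun_eq_iff)
qed

text \<open>Tested with \<open>(\<lambda>\<^sub>a * r) *\<^sub>R (c - a)\<close>, whose normal component vanishes on \<open>b c\<close> and \<open>c a\<close>.\<close>

lemma kernel_edge_orthogonal:
  assumes K: "K = convex hull {a, b, c}" and v0: "fst v K = restrict0 K (\<lambda>x. \<gamma>)"
    and ker: "\<And>q. q \<in> vpoly2 (k + 1) \<Longrightarrow> wgrad_rhs K v q = 0"
    and p: "p \<in> poly2 m" and vb: "snd v (closed_segment a b) = restrict0 (closed_segment a b) p"
    and r: "r \<in> poly2 k"
  shows "integral {0..1} (\<lambda>s. (p (a + s *\<^sub>R (b - a)) - \<gamma>) * ((1 - s) * r (a + s *\<^sub>R (b - a)))) = 0"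
proof -
  interpret r: nondeg_triangle b c a by (rule rotate)
  interpret rr: nondeg_triangle c a b by (rule r.rotate)
  define \<phi> where "\<phi> = (\<lambda>x. bary b c a x * r x)"
  have \<phi>: "\<phi> \<in> poly2 (k + 1)" unfolding \<phi>_def using poly2_mult[OF bary_poly2 r] by simp
  have \<phi>0: "\<phi> x = 0" if "x \<in> closed_segment b c" for x
    using that r.bary_segment by (simp add: \<phi>_def)
  let ?D = "cross2 (b - a) (c - a)" and ?\<sigma> = "\<lambda>s. a + s *\<^sub>R (b - a)"
  have ca: "(c - a) \<bullet> outward c a b = 0"
    using rr.outward_inner(1) by (simp add: inner_diff_left inner_diff_right inner_commute)
  have "edge_int (closed_segment a b) (\<lambda>x. snd v (closed_segment a b) x * (\<phi> x * ((c - a) \<bullet> outward a b c)))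
     = norm (b - a) * integral {0..1} (\<lambda>s. ((c - a) \<bullet> outward a b c) * (p (?\<sigma> s) * \<phi> (?\<sigma> s)))"
    unfolding edge_int_segment[OF distinct(1)]
  proof (intro arg_cong[where f = "\<lambda>t. _ * t"] integral_cong)
    fix s :: real assume "s \<in> {0..1}"
    then have "?\<sigma> s \<in> closed_segment a b" unfolding closed_segment_param by blast
    then show "snd v (closed_segment a b) (?\<sigma> s) * (\<phi> (?\<sigma> s) * ((c - a) \<bullet> outward a b c)) =
        ((c - a) \<bullet> outward a b c) * (p (?\<sigma> s) * \<phi> (?\<sigma> s))"
      by (simp add: vb restrict0_def)
  qed
  also have "\<dots> = norm (b - a) * (outward a b c \<bullet> (c - a)) * integral {0..1} (\<lambda>s. p (?\<sigma> s) * \<phi> (?\<sigma> s))"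
    by (simp add: inner_commute)
  also have "\<dots> = - \<bar>?D\<bar> * integral {0..1} (\<lambda>s. p (?\<sigma> s) * \<phi> (?\<sigma> s))"
    by (simp only: outward_inner(3))
  finally have ab: "edge_int (closed_segment a b) (\<lambda>x. snd v (closed_segment a b) x * (\<phi> x * ((c - a) \<bullet> outward a b c))) = \<dots>" .
  \<comment> \<open>For a constant interior part the volume term also reduces to an integral over
    \<open>a b\<close> with the factor of the edge term, so only the difference between edge value
    and \<open>\<gamma>\<close> is tested.\<close>
  have int: "integral K (\<lambda>x. \<gamma> * frechet_derivative \<phi> (at x) (c - a)) =
      \<gamma> * (- \<bar>?D\<bar> * integral {0..1} (\<lambda>s. \<phi> (?\<sigma> s)))"
    using integral_derivative_along_edge[OF \<phi> \<phi>0] K by simp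
  have "wgrad_rhs K v (\<lambda>x. \<phi> x *\<^sub>R (c - a)) = 0" using ker scaled_field(1)[OF \<phi>] by blast
  then have "\<bar>?D\<bar> * (integral {0..1} (\<lambda>s. p (?\<sigma> s) * \<phi> (?\<sigma> s)) + (- \<gamma>) * integral {0..1} (\<lambda>s. \<phi> (?\<sigma> s))) = 0"
    unfolding wgrad_rhs_scaled[OF \<phi> K v0] ab int
    using distinct \<phi>0 ca by (auto simp: edge_int_eq_0 algebra_simps)
  then have "integral {0..1} (\<lambda>s. p (?\<sigma> s) * \<phi> (?\<sigma> s)) + (- \<gamma>) * integral {0..1} (\<lambda>s. \<phi> (?\<sigma> s)) = 0"
    using nondeg by simp
  moreover have "integral {0..1} (\<lambda>s. p (?\<sigma> s) * \<phi> (?\<sigma> s) + (- \<gamma>) * \<phi> (?\<sigma> s)) =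
      integral {0..1} (\<lambda>s. p (?\<sigma> s) * \<phi> (?\<sigma> s)) + (- \<gamma>) * integral {0..1} (\<lambda>s. \<phi> (?\<sigma> s))"
    by (intro integral_linear_comb continuous_intros
        continuous_on_compose2[OF poly2_continuous_on[OF p, of UNIV]]
        continuous_on_compose2[OF poly2_continuous_on[OF \<phi>, of UNIV]]) auto
  \<comment> \<open>The weight \<open>1 - s\<close> is the coordinate of \<open>a\<close> along the
    edge.\<close>
  moreover have "p (?\<sigma> s) * \<phi> (?\<sigma> s) + (- \<gamma>) * \<phi> (?\<sigma> s) = (p (?\<sigma> s) - \<gamma>) * ((1 - s) * r (?\<sigma> s))" for s
    unfolding \<phi>_def bary_edge by (simp add: algebra_simps)
  ultimately show ?thesis by simp
qed

text \<open>With \<open>s\<close> the arc parameter of the edge, the polynomial \<open>c + s * Q s\<close> of degree \<open>k + 1\<close> is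
  \<open>(1 - s) * c + s * (c + Q s)\<close>, a combination of the two families of admissible test functions.\<close>

lemma kernel_edge_constant:
  assumes K: "K = convex hull {a, b, c}" and v0: "fst v K = restrict0 K (\<lambda>x. \<gamma>)"
    and ker: "\<And>q. q \<in> vpoly2 (k + 1) \<Longrightarrow> wgrad_rhs K v q = 0"
    and p: "p \<in> poly2 (k + 1)" and vb: "snd v (closed_segment a b) = restrict0 (closed_segment a b) p"
    and x: "x \<in> closed_segment a b"
  shows "p x = \<gamma>"
proof -
  interpret s: nondeg_triangle b a c by (rule swap)
  let ?\<sigma> = "\<lambda>s. a + s *\<^sub>R (b - a)"
  obtain P where P: "degree P \<le> k + 1" "\<And>t. p (?\<sigma> t) = poly P t" using poly2_on_line[OF p] by blast
  \<comment> \<open>Splitting off the constant term lowers the degree: \<open>Q\<close> has degree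
    at most \<open>k\<close> and can be used inside a test function.\<close>
  obtain c0 Q where Q: "P - [:\<gamma>:] = pCons c0 Q" by (rule pCons_cases)
  have "degree (P - [:\<gamma>:]) \<le> k + 1" using P(1) by (intro degree_diff_le) auto
  then have degQ: "degree Q \<le> k" unfolding Q by (auto split: if_splits)
  have g: "p (?\<sigma> t) - \<gamma> = c0 + t * poly Q t" for t
    using arg_cong[OF Q, of "\<lambda>p. poly p t"] P(2) by simp
  let ?g = "\<lambda>t. c0 + t * poly Q t"
  have 1: "integral {0..1} (\<lambda>t. ?g t * ((1 - t) * c0)) = 0"
    using kernel_edge_orthogonal[OF K v0 ker p vb poly2_const[of c0]] unfolding g .
  have K': "K = convex hull {b, a, c}" by (simp add: K insert_commute)
  have vb': "snd v (closed_segment b a) = restrict0 (closed_segment b a) p"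
    using vb by (simp add: closed_segment_commute)
  have flip: "b + t *\<^sub>R (a - b) = ?\<sigma> (1 - t)" for t by (simp add: algebra_simps)
  \<comment> \<open>The same test from the endpoint \<open>b\<close>. On \<open>a b\<close> the
    function \<open>bary c a b\<close> is the edge parameter, so \<open>Q\<close> of the parameter
    is the trace of a plane polynomial of degree at most \<open>k\<close>.\<close>
  have "integral {0..1} (\<lambda>t. ?g (1 - t) * ((1 - t) * (c0 + poly Q (1 - t)))) = 0"
    using s.kernel_edge_orthogonal[OF K' v0 ker p vb'
        poly2_add[OF poly2_const[of c0] poly_bary_poly2[OF degQ, of c a b]]]
    unfolding flip g bary_edge .
  then have 2: "integral {0..1} (\<lambda>t. ?g t * (t * (c0 + poly Q t))) = 0"
    using integral_01_reflect[of "\<lambda>t. ?g t * (t * (c0 + poly Q t))"] by simp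
  have "integral {0..1} (\<lambda>t. ?g t * ((1 - t) * c0) + 1 * (?g t * (t * (c0 + poly Q t)))) = 0"
    by (subst integral_linear_comb) (auto intro!: continuous_intros simp: 1 2)
  moreover have "?g t * ((1 - t) * c0) + 1 * (?g t * (t * (c0 + poly Q t))) = ?g t * ?g t" for t
    by (simp add: algebra_simps)
  ultimately have 3: "integral {0..1} (\<lambda>t. ?g t * ?g t) = 0" by simp
  have "?g t = 0" if "t \<in> {0<..<1}" for t
  proof -
    have "?g t * ?g t = 0"
      using that by (intro integral_nonneg_eq_0[OF _ _ _ 3]) (auto intro!: continuous_intros)
    then show ?thesis by simp
  qed
  then have "{0<..<1} \<subseteq> {t. poly (pCons c0 Q) t = 0}" by auto
  then have "infinite {t. poly (pCons c0 Q) t = 0}"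
    using infinite_Ioo[of "0::real" 1] by (metis finite_subset zero_less_one)
  then have "pCons c0 Q = 0" using poly_roots_finite by blast
  then have "P = [:\<gamma>:]" using Q by simp
  then show ?thesis using x P(2) unfolding closed_segment_param by auto
qed

end

text \<open>That one constant serves the interior and all three edges is what later carries a value
  from a triangle to its neighbour through their common edge.\<close>

lemma wgrad_kernel:
  assumes K: "triangle K" and v: "v \<in> local_wfun k K"
    and ker: "\<And>q. q \<in> vpoly2 (k + 1) \<Longrightarrow> wgrad_rhs K v q = 0"
  shows "\<exists>\<gamma>. (\<forall>x\<in>K. fst v K x = \<gamma>) \<and> (\<forall>e\<in>edges K. \<forall>x\<in>e. snd v e x = \<gamma>)"
proof -
  obtain a b c where abc: "K = convex hull {a, b, c}" "nondeg_triangle a b c"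
    using triangle_obtain[OF K] .
  interpret nondeg_triangle a b c by fact
  interpret r: nondeg_triangle b c a by (rule rotate)
  interpret rr: nondeg_triangle c a b by (rule r.rotate)
  obtain w where w: "w \<in> poly2 k" "fst v K = restrict0 K w" using v by (auto simp: local_wfun_def Pk_eq)
  obtain \<gamma> where \<gamma>: "w = (\<lambda>x. \<gamma>)" using kernel_interior_constant[OF abc(1) w ker] by blast
  have v0: "fst v K = restrict0 K (\<lambda>x. \<gamma>)" using w(2) \<gamma> by simp
  have edge: "snd v (closed_segment p q) x = \<gamma>"
    if t: "nondeg_triangle p q r" "K = convex hull {p, q, r}" and x: "x \<in> closed_segment p q" for p q r x
  proof -
    interpret t: nondeg_triangle p q r by fact
    have "closed_segment p q \<in> edges K" using t(2) t.edges_hull by simp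
    then have "snd v (closed_segment p q) \<in> restrict0 (closed_segment p q) ` poly2 (k + 1)"
      using v Pedge_eq[OF t.distinct(1) refl] by (auto simp: local_wfun_def)
    then obtain u where u: "u \<in> poly2 (k + 1)" "snd v (closed_segment p q) = restrict0 (closed_segment p q) u"
      by blast
    show ?thesis
      using t.kernel_edge_constant[OF t(2) v0 ker u x] x u(2) by (simp add: restrict0_def)
  qed
  have "K = convex hull {b, c, a}" "K = convex hull {c, a, b}" by (simp_all add: abc(1) insert_commute)
  then have "\<forall>e\<in>edges K. \<forall>x\<in>e. snd v e x = \<gamma>"
    using edge[OF nondeg_triangle_axioms abc(1)] edge[OF r.nondeg_triangle_axioms]
      edge[OF rr.nondeg_triangle_axioms] unfolding abc(1) edges_hull by auto
  then show ?thesis using v0 by (auto simp: restrict0_def)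
qed

section \<open>Triangulations of a convex domain\<close>

lemma triangle_edge_hull:
  assumes "triangle K" "e \<in> edges K"
  obtains p q r where "K = convex hull {p, q, r}" "nondeg_triangle p q r" "e = closed_segment p q"
proof -
  obtain a b c where abc: "K = convex hull {a, b, c}" "nondeg_triangle a b c"
    using triangle_obtain[OF assms(1)] .
  interpret nondeg_triangle a b c by fact
  interpret r: nondeg_triangle b c a by (rule rotate)
  interpret rr: nondeg_triangle c a b by (rule r.rotate)
  have K: "K = convex hull {b, c, a}" "K = convex hull {c, a, b}" by (simp_all add: abc(1) insert_commute)
  have "e = closed_segment a b \<or> e = closed_segment b c \<or> e = closed_segment c a"
    using assms(2) unfolding abc(1) edges_hull by blast
  then show ?thesis
    using that[OF abc] that[OF K(1) r.nondeg_triangle_axioms] that[OF K(2) rr.nondeg_triangle_axioms] by blast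
qed

lemma triangle_edge_hull_segment:
  assumes "triangle K" "closed_segment p q \<in> edges K"
  obtains r where "K = convex hull {p, q, r}" "nondeg_triangle p q r"
proof -
  obtain p' q' r where r: "K = convex hull {p', q', r}" "nondeg_triangle p' q' r"
    "closed_segment p q = closed_segment p' q'"
    using triangle_edge_hull[OF assms] .
  then consider "p = p'" "q = q'" | "p = q'" "q = p'" by (auto simp: doubleton_eq_iff)
  then show ?thesis
  proof cases
    case 2
    then show ?thesis using that[of r] r nondeg_triangle.swap[OF r(2)] by (simp add: insert_commute)
  qed (use that r in blast)
qed

context nondeg_triangle
begin

text \<open>At the midpoint the coordinates of \<open>a\<close> and \<open>b\<close> equal
  \<open>1/2\<close> and stay positive for small \<open>s\<close>; the coordinate of
  \<open>c\<close> starts at 0 and increases, because \<open>d\<close> points to the side of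
  \<open>c\<close>.\<close>

lemma interior_near_edge:
  assumes d: "cross2 (b - a) d * cross2 (b - a) (c - a) > 0"
  shows "\<exists>\<epsilon>>0. \<forall>s. 0 < s \<longrightarrow> s < \<epsilon> \<longrightarrow> midpoint a b + s *\<^sub>R d \<in> interior (convex hull {a, b, c})"
proof -
  have m: "midpoint a b = a + (1/2) *\<^sub>R (b - a)"
    by (simp add: midpoint_def vec_eq_iff field_simps)
  define A where "A = cross2 (c - b) d / cross2 (c - b) (a - b)"
  define B where "B = cross2 (a - c) d / cross2 (a - c) (b - c)"
  define C where "C = cross2 (b - a) d / cross2 (b - a) (c - a)"
  have C: "C > 0" using d unfolding C_def by (simp add: zero_less_mult_iff zero_less_divide_iff)
  have bA: "bary b c a (midpoint a b + s *\<^sub>R d) = 1/2 + s * A" for s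
    unfolding bary_add_scaleR by (simp add: m bary_edge A_def B_def C_def)
  have bB: "bary c a b (midpoint a b + s *\<^sub>R d) = 1/2 + s * B" for s
    unfolding bary_add_scaleR by (simp add: m bary_edge A_def B_def C_def)
  have bC: "bary a b c (midpoint a b + s *\<^sub>R d) = s * C" for s
    unfolding bary_add_scaleR by (simp add: m bary_edge A_def B_def C_def)
  \<comment> \<open>Chosen so that \<open>s * \<bar>A\<bar>\<close> and
    \<open>s * \<bar>B\<bar>\<close> stay below \<open>1/2\<close>; the summand 1 keeps the
    denominator positive when both rates vanish.\<close>
  define \<epsilon> where "\<epsilon> = 1 / (2 * (1 + \<bar>A\<bar> + \<bar>B\<bar>))"
  have "\<epsilon> > 0" unfolding \<epsilon>_def using abs_ge_zero[of A] abs_ge_zero[of B] by simp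
  moreover have "midpoint a b + s *\<^sub>R d \<in> interior (convex hull {a, b, c})" if s: "0 < s" "s < \<epsilon>" for s
  proof -
    have "s * (1 + \<bar>A\<bar> + \<bar>B\<bar>) < 1/2" using s(2) 
      using abs_ge_zero[of A] abs_ge_zero[of B] by (simp add: \<epsilon>_def pos_less_divide_eq add_pos_nonneg algebra_simps)
    then have "s * 1 + s * \<bar>A\<bar> + s * \<bar>B\<bar> < 1/2" by (simp only: distrib_left)
    moreover have "s * (- \<bar>A\<bar>) \<le> s * A" "s * (- \<bar>B\<bar>) \<le> s * B"
      using s(1) by (intro mult_left_mono; simp)+
    moreover have "s * \<bar>A\<bar> \<ge> 0" "s * \<bar>B\<bar> \<ge> 0" using s(1) by simp_all
    ultimately have "1/2 + s * A > 0" "1/2 + s * B > 0" using s(1) by linarith+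
    moreover have "s * C > 0" using s(1) C by simp
    ultimately show ?thesis using bA[of s] bB[of s] bC[of s] by (intro subsetD[OF interior_hull]) simp
  qed
  ultimately show ?thesis by blast
qed

lemma frontier_on_edge:
  assumes "x \<in> convex hull {a, b, c}" "x \<notin> interior (convex hull {a, b, c})"
  shows "\<exists>e\<in>edges (convex hull {a, b, c}). x \<in> e"
proof -
  interpret r: nondeg_triangle b c a by (rule rotate)
  interpret rr: nondeg_triangle c a b by (rule r.rotate)
  have "bary b c a x \<ge> 0" "bary c a b x \<ge> 0" "bary a b c x \<ge> 0" using assms(1) unfolding hull_eq by auto
  moreover have "\<not> (bary b c a x > 0 \<and> bary c a b x > 0 \<and> bary a b c x > 0)"
    using assms(2) interior_hull by blast
  ultimately consider "bary a b c x = 0" | "bary b c a x = 0" | "bary c a b x = 0" by linarith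
  then show ?thesis
    using segment_if_bary_0[OF assms(1)] r.segment_if_bary_0[of x] rr.segment_if_bary_0[of x] assms(1)
    unfolding edges_hull by cases (auto simp: insert_commute)
qed

end

lemma cross2_midpoint: "cross2 (q - p) (r - midpoint p q) = cross2 (q - p) (r - p)"
  by (simp add: cross2_def midpoint_def algebra_simps) (simp add: field_simps)

text \<open>From a point \<open>w\<close> of \<open>S\<close> on the segment, the open segments
  towards \<open>p\<close> and \<open>q\<close> lie in \<open>S\<close> by convexity, and
  \<open>z\<close> would lie on one of them.\<close>

lemma segment_avoids_open_convex:
  fixes p q :: "'a::euclidean_space"
  assumes S: "convex S" "open S" and pq: "p \<in> closure S" "q \<in> closure S"
    and z: "z \<in> open_segment p q" "z \<notin> S"
  shows "closed_segment p q \<inter> S = {}"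
proof (rule ccontr)
  assume "closed_segment p q \<inter> S \<noteq> {}"
  then obtain w where w: "w \<in> closed_segment p q" "w \<in> S" by blast
  then have "w \<noteq> z" using z(2) by blast
  have "z \<in> open_segment w p \<or> z \<in> open_segment w q"
  proof -
    have "closed_segment p w \<union> closed_segment w q = closed_segment p q"
      by (rule Un_closed_segment[OF w(1)])
    then have "z \<in> closed_segment w p \<or> z \<in> closed_segment w q"
      using z(1) segment_open_subset_closed closed_segment_commute by blast
    then show ?thesis using \<open>w \<noteq> z\<close> z(1) by (auto simp: open_segment_def)
  qed
  moreover have "open_segment w x \<subseteq> S" if "x \<in> closure S" for x
    using in_interior_closure_convex_segment[OF S(1) _ that, of w] w(2) S(2) by (simp add: interior_open)
  ultimately show False using z(2) pq by blast
qed

locale mesh =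
  fixes \<Omega> :: "pt set" and T :: "pt set set"
  assumes open_dom: "open \<Omega>" and bounded_dom: "bounded \<Omega>" and convex_dom: "convex \<Omega>"
    and nonempty_dom: "\<Omega> \<noteq> {}" and tri: "triangulation \<Omega> T"
begin

lemma finite_T: "finite T" and nonempty_T: "T \<noteq> {}"
  and triangle_T: "K \<in> T \<Longrightarrow> triangle K" and Union_T: "\<Union>T = closure \<Omega>"
  using tri by (auto simp: triangulation_def)

lemma intersection_cases:
  assumes "K \<in> T" "K' \<in> T" "K \<noteq> K'"
  obtains "K \<inter> K' = {}" | v where "v \<in> verts K" "K \<inter> K' = {v}" | "K \<inter> K' \<in> edges K" "K \<inter> K' \<in> edges K'"
  using tri assms unfolding triangulation_def by metis

text \<open>Convexity excludes slits and punctures, so passing to the closure and back to the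
  interior returns the open domain.\<close>

lemma interior_subset_dom: "K \<in> T \<Longrightarrow> interior K \<subseteq> \<Omega>"
proof -
  assume "K \<in> T"
  then have "interior K \<subseteq> interior (closure \<Omega>)" using Union_T by (intro interior_mono) auto
  then show ?thesis using convex_interior_closure[OF convex_dom] open_dom by (simp add: interior_open)
qed

lemma interior_disjoint:
  assumes "K \<in> T" "K' \<in> T" "K \<noteq> K'"
  shows "interior K \<inter> interior K' = {}"
proof -
  have "interior (K \<inter> K') = {}"
  proof (rule intersection_cases[OF assms])
    assume "K \<inter> K' \<in> edges K"
    then obtain p q where "K \<inter> K' = closed_segment p q" using triangle_edge[OF triangle_T[OF assms(1)]] by metis
    then show ?thesis by (simp add: interior_closed_segment_ge2)
  qed auto
  then show ?thesis by (simp add: interior_Int)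
qed

lemma finite_verts: "finite (\<Union>K\<in>T. verts K)"
proof -
  have "finite (verts K)" if "K \<in> T" for K
    using triangle_obtain[OF triangle_T[OF that]] nondeg_triangle.verts_hull by (metis finite.emptyI finite_insert)
  then show ?thesis using finite_T by blast
qed

text \<open>Deleting the finitely many vertices leaves the domain connected, so the two closed sets
  covered by the triangles of \<open>A\<close> and of \<open>T - A\<close> meet outside the vertices.\<close>

lemma edge_connected:
  assumes A: "A \<subseteq> T" "A \<noteq> {}"
    and step: "\<And>K K' e. K \<in> A \<Longrightarrow> K' \<in> T \<Longrightarrow> K \<noteq> K' \<Longrightarrow> e \<in> edges K \<Longrightarrow> e \<in> edges K' \<Longrightarrow> K' \<in> A"
  shows "A = T"
proof (rule ccontr)
  assume "A \<noteq> T"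
  let ?V = "\<Union>K\<in>T. verts K" and ?S = "\<Omega> - (\<Union>K\<in>T. verts K)"
  have conn: "connected ?S"
    using connected_open_delete_finite[OF open_dom convex_connected[OF convex_dom] _ finite_verts] by simp
  have closed: "closed (\<Union>B)" if "B \<subseteq> T" for B
    using that finite_T triangle_T triangle_convex_compact(1) compact_imp_closed
    by (intro closed_Union) (auto intro: finite_subset)
  have meets: "\<Union>B \<inter> ?S \<noteq> {}" if B: "B \<subseteq> T" "B \<noteq> {}" for B
  proof -
    obtain K where K: "K \<in> B" using B(2) by blast
    then have "interior K \<noteq> {}" using triangle_convex_compact(3) triangle_T B(1) by blast
    then have "infinite (interior K)" using finite_imp_not_open by blast
    then have "\<not> interior K \<subseteq> ?V" using finite_verts finite_subset by blast
    then obtain x where "x \<in> interior K" "x \<notin> ?V" by blast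
    then have "x \<in> \<Union>B \<inter> ?S" using K B(1) interior_subset_dom interior_subset by blast
    then show ?thesis by blast
  qed
  have cover: "?S \<subseteq> \<Union>A \<union> \<Union>(T - A)" 
  proof -
    have "\<Omega> \<subseteq> \<Union>T" using Union_T closure_subset[of \<Omega>] by simp
    moreover have "\<Union>T \<subseteq> \<Union>A \<union> \<Union>(T - A)" by auto
    ultimately show ?thesis by auto
  qed
  have "\<Union>A \<inter> \<Union>(T - A) \<inter> ?S \<noteq> {}"
  proof
    assume disj: "\<Union>A \<inter> \<Union>(T - A) \<inter> ?S = {}"
    have B: "T - A \<subseteq> T" "T - A \<noteq> {}" using \<open>A \<noteq> T\<close> A(1) by auto
    have "\<Union>A \<inter> ?S = {} \<or> \<Union>(T - A) \<inter> ?S = {}"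
      by (rule connected_closedD[OF conn disj cover closed[OF A(1)] closed[OF B(1)]])
    then show False using meets[OF A] meets[OF B] by blast
  qed
  then obtain x where "x \<in> \<Union>A \<inter> \<Union>(T - A) \<inter> ?S" by (meson ex_in_conv)
  then obtain K K' where x: "x \<in> K" "x \<in> K'" "x \<notin> ?V" and K: "K \<in> A" "K' \<in> T" "K' \<notin> A"
    by auto
  have "K \<in> T" "K \<noteq> K'" using K A(1) by auto
  \<comment> \<open>A common point that is no vertex leaves only the case of a common edge, and then
    \<open>step\<close> would put \<open>K'\<close> into \<open>A\<close>.\<close>
  from this(1) K(2) this(2) show False
  proof (rule intersection_cases)
    fix v assume "v \<in> verts K" "K \<inter> K' = {v}"
    then show False using x \<open>K \<in> T\<close> by blast
  next
    assume "K \<inter> K' \<in> edges K" "K \<inter> K' \<in> edges K'"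
    then show False using step K \<open>K \<noteq> K'\<close> by blast
  qed (use x in blast)
qed

text \<open>Removing the vertices from the plane keeps it connected, so the frontier contains a
  point that is no vertex. It lies strictly inside an edge of its triangle, and convexity forces
  that whole edge into the frontier.\<close>

lemma boundary_edge_exists: "\<exists>K\<in>T. \<exists>e\<in>edges K. e \<subseteq> frontier \<Omega>"
proof -
  let ?V = "\<Union>K\<in>T. verts K"
  have "connected (UNIV - ?V)"
    by (rule connected_open_delete_finite[OF _ _ _ finite_verts]) auto
  moreover have "(UNIV - ?V) \<inter> \<Omega> \<noteq> {}"
  proof -
    have "infinite \<Omega>" using open_dom nonempty_dom finite_imp_not_open by blast
    then have "\<not> \<Omega> \<subseteq> ?V" using finite_verts finite_subset by blast
    then show ?thesis by blast
  qed
  moreover have "(UNIV - ?V) - \<Omega> \<noteq> {}"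
  proof -
    have "bounded (?V \<union> \<Omega>)" using bounded_dom finite_verts by (simp add: finite_imp_bounded)
    then have "?V \<union> \<Omega> \<noteq> UNIV" using not_bounded_UNIV by metis
    then show ?thesis by blast
  qed
  ultimately have "(UNIV - ?V) \<inter> frontier \<Omega> \<noteq> {}" by (rule connected_Int_frontier)
  then obtain z where z: "z \<in> frontier \<Omega>" "z \<notin> ?V" by blast
  then have zc: "z \<in> closure \<Omega>" "z \<notin> \<Omega>" using open_dom by (auto simp: frontier_def interior_open)
  then obtain K where K: "K \<in> T" "z \<in> K" using Union_T by blast
  then have ni: "z \<notin> interior K" using interior_subset_dom zc(2) by blast
  obtain a b c where abc: "K = convex hull {a, b, c}" "nondeg_triangle a b c"
    using triangle_obtain[OF triangle_T[OF K(1)]] .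
  obtain e where e: "e \<in> edges K" "z \<in> e"
    using nondeg_triangle.frontier_on_edge[OF abc(2)] K(2) ni unfolding abc(1) by blast
  obtain p q where pq: "e = closed_segment p q" "p \<in> verts K" "q \<in> verts K"
    using e(1) by (auto simp: edges_def)
  have "p \<in> K" "q \<in> K" using pq(2,3) by (auto simp: verts_def extreme_point_of_def)
  then have cl: "p \<in> closure \<Omega>" "q \<in> closure \<Omega>" using K(1) Union_T by auto
  have "z \<noteq> p" "z \<noteq> q" using z(2) pq K(1) by auto
  then have "z \<in> open_segment p q" using e(2) pq(1) by (simp add: open_segment_def)
  then have "e \<inter> \<Omega> = {}"
    unfolding pq(1) using segment_avoids_open_convex[OF convex_dom open_dom cl] zc(2) by blast
  moreover have "e \<subseteq> closure \<Omega>"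
    unfolding pq(1) using cl convex_closure[OF convex_dom] by (simp add: closed_segment_subset)
  ultimately have "e \<subseteq> frontier \<Omega>" using open_dom by (auto simp: frontier_def interior_open)
  then show ?thesis using K(1) e(1) by blast
qed

lemma opposite_sides:
  assumes K: "convex hull {p, q, r} \<in> T" "convex hull {p, q, r'} \<in> T" "convex hull {p, q, r} \<noteq> convex hull {p, q, r'}"
    and nd: "nondeg_triangle p q r" "nondeg_triangle p q r'"
  shows "cross2 (q - p) (r - p) * cross2 (q - p) (r' - p) < 0"
proof (rule ccontr)
  interpret t: nondeg_triangle p q r by fact
  interpret t': nondeg_triangle p q r' by fact
  assume "\<not> ?thesis"
  then have pos: "cross2 (q - p) (r - p) * cross2 (q - p) (r' - p) > 0"
    using t.nondeg t'.nondeg by (simp add: linorder_not_less less_le)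
  \<comment> \<open>If both apexes were on one side, moving from the midpoint towards
    \<open>r\<close> would enter both triangles, contradicting disjoint interiors.\<close>
  let ?d = "r - midpoint p q"
  have "cross2 (q - p) ?d * cross2 (q - p) (r - p) > 0" "cross2 (q - p) ?d * cross2 (q - p) (r' - p) > 0"
    using pos t.nondeg unfolding cross2_midpoint by (auto simp: zero_less_mult_iff linorder_neq_iff)
  note sides = this
  obtain \<epsilon> where \<epsilon>: "\<epsilon> > 0" "\<forall>s. 0 < s \<longrightarrow> s < \<epsilon> \<longrightarrow> midpoint p q + s *\<^sub>R ?d \<in> interior (convex hull {p, q, r})"
    using t.interior_near_edge[OF sides(1)] by blast
  obtain \<epsilon>' where \<epsilon>': "\<epsilon>' > 0" "\<forall>s. 0 < s \<longrightarrow> s < \<epsilon>' \<longrightarrow> midpoint p q + s *\<^sub>R ?d \<in> interior (convex hull {p, q, r'})"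
    using t'.interior_near_edge[OF sides(2)] by blast
  define s where "s = min \<epsilon> \<epsilon>' / 2"
  have s: "0 < s" "s < \<epsilon>" "s < \<epsilon>'" using \<epsilon>(1) \<epsilon>'(1) by (auto simp: s_def)
  have "midpoint p q + s *\<^sub>R ?d \<in> interior (convex hull {p, q, r}) \<inter> interior (convex hull {p, q, r'})"
    using \<epsilon>(2)[rule_format, OF s(1,2)] \<epsilon>'(2)[rule_format, OF s(1,3)] by blast
  then show False using interior_disjoint[OF K] by blast
qed

text \<open>All but the unit length rests on the two apexes being on opposite sides: the normals are
  opposite, the edge midpoint lies between points of the two interiors and hence in
  \<open>\<Omega>\<close>, and a third triangle would have to be opposite to both.\<close>

lemma shared_edge:
  assumes K: "K \<in> T" "K' \<in> T" "K \<noteq> K'" and e: "e \<in> edges K" "e \<in> edges K'"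
  shows "normal K' e = - normal K e" and "\<not> e \<subseteq> frontier \<Omega>"
    and "norm (normal K e) = 1" and "{L \<in> T. e \<in> edges L} = {K, K'}"
proof -
  obtain p q r where r: "K = convex hull {p, q, r}" "nondeg_triangle p q r" "e = closed_segment p q"
    using triangle_edge_hull[OF triangle_T[OF K(1)] e(1)] .
  interpret t: nondeg_triangle p q r by fact
  obtain r' where r': "K' = convex hull {p, q, r'}" "nondeg_triangle p q r'"
    using triangle_edge_hull_segment[OF triangle_T[OF K(2)]] e(2) r(3) by metis
  interpret t': nondeg_triangle p q r' by fact
  let ?D = "cross2 (q - p) (r - p)" and ?D' = "cross2 (q - p) (r' - p)"
  have opp: "?D * ?D' < 0" using opposite_sides K r(1,2) r' by blast
  have n: "normal K e = outward p q r" "normal K' e = outward p q r'"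
    using t.normal_hull t'.normal_hull r r' by auto
  have "sgn ?D' = - sgn ?D" using opp by (auto simp: mult_less_0_iff sgn_if)
  then show "normal K' e = - normal K e" unfolding n outward_def by simp
  show "norm (normal K e) = 1" unfolding n by (rule t.norm_outward)
  show "\<not> e \<subseteq> frontier \<Omega>"
  proof -
    let ?d = "r - midpoint p q"
    have side: "cross2 (q - p) ?d * ?D > 0"
      using t.nondeg unfolding cross2_midpoint by (auto simp: zero_less_mult_iff linorder_neq_iff)
    have "cross2 (q - p) (- ?d) = - ?D"
      using cross2_midpoint[of q p r] by (simp add: cross2_def algebra_simps)
    then have side': "cross2 (q - p) (- ?d) * ?D' > 0" using opp by simp
    obtain \<epsilon> where \<epsilon>: "\<epsilon> > 0" "\<forall>s. 0 < s \<longrightarrow> s < \<epsilon> \<longrightarrow> midpoint p q + s *\<^sub>R ?d \<in> interior K"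
      using t.interior_near_edge[OF side] unfolding r(1) by blast
    obtain \<epsilon>' where \<epsilon>': "\<epsilon>' > 0" "\<forall>s. 0 < s \<longrightarrow> s < \<epsilon>' \<longrightarrow> midpoint p q + s *\<^sub>R (- ?d) \<in> interior K'"
      using t'.interior_near_edge[OF side'] unfolding r'(1) by blast
    define s where "s = min \<epsilon> \<epsilon>' / 2"
    have s: "0 < s" "s < \<epsilon>" "s < \<epsilon>'" using \<epsilon>(1) \<epsilon>'(1) by (auto simp: s_def)
    have "midpoint p q + s *\<^sub>R ?d \<in> \<Omega>" "midpoint p q + s *\<^sub>R (- ?d) \<in> \<Omega>"
      using \<epsilon>(2)[rule_format, OF s(1,2)] \<epsilon>'(2)[rule_format, OF s(1,3)] interior_subset_dom K by blast+
    then have "(1/2) *\<^sub>R (midpoint p q + s *\<^sub>R ?d) + (1/2) *\<^sub>R (midpoint p q + s *\<^sub>R (- ?d)) \<in> \<Omega>"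
      by (intro convexD[OF convex_dom]) auto
    moreover have "(1/2) *\<^sub>R (m + s *\<^sub>R d) + (1/2) *\<^sub>R (m + s *\<^sub>R (- d)) = m" for m d :: pt
      by (simp add: vec_eq_iff field_simps)
    ultimately have "midpoint p q \<in> \<Omega>" by (simp only:)
    moreover have "midpoint p q \<in> e" unfolding r(3) by simp
    ultimately show ?thesis using open_dom by (auto simp: frontier_def interior_open)
  qed
  show "{L \<in> T. e \<in> edges L} = {K, K'}"
  proof
    show "{L \<in> T. e \<in> edges L} \<subseteq> {K, K'}"
    proof (rule subsetI, rule ccontr)
      fix L assume "L \<in> {L \<in> T. e \<in> edges L}" "L \<notin> {K, K'}"
      then have L: "L \<in> T" "e \<in> edges L" "L \<noteq> K'" "L \<noteq> K" by auto
      obtain s where s: "L = convex hull {p, q, s}" "nondeg_triangle p q s"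
        using triangle_edge_hull_segment[OF triangle_T[OF L(1)]] L(2) r(3) by metis
      have "?D * cross2 (q - p) (s - p) < 0" "?D' * cross2 (q - p) (s - p) < 0"
        using opposite_sides K L r(1,2) r' s by blast+
      then show False using opp by (auto simp: mult_less_0_iff)
    qed
  qed (use K e in auto)
qed

end

section \<open>The finite element spaces\<close>

lemma finite_mesh_edges:
  assumes "finite T" "\<And>K. K \<in> T \<Longrightarrow> triangle K"
  shows "finite (mesh_edges T)"
  using assms finite_edges by (auto simp: mesh_edges_def)

context mesh
begin

lemma mesh_edgesI: "K \<in> T \<Longrightarrow> e \<in> edges K \<Longrightarrow> e \<in> mesh_edges T"
  by (auto simp: mesh_edges_def)

lemma mesh_edge_segment:
  assumes "e \<in> mesh_edges T"
  obtains p q where "p \<noteq> q" "e = closed_segment p q"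
  using assms triangle_edge triangle_T unfolding mesh_edges_def by (metis UN_E)

lemma Pedge_mesh_edge:
  assumes "e \<in> mesh_edges T"
  shows "Pedge m e = restrict0 e ` poly2 m" "subspace (Pedge m e)" "fin_dim (Pedge m e)"
proof -
  obtain p q where pq: "p \<noteq> q" "e = closed_segment p q" using mesh_edge_segment[OF assms] .
  show *: "Pedge m e = restrict0 e ` poly2 m" using Pedge_eq[OF pq] .
  show "subspace (Pedge m e)" "fin_dim (Pedge m e)"
    unfolding * by (simp_all add: linear_subspace_image fin_dim_linear_image linear_restrict0)
qed

lemma Sh0_iff:
  "v \<in> Sh0 \<Omega> T k \<longleftrightarrow> (\<forall>K\<in>T. fst v K \<in> Pk k K) \<and> (\<forall>K. K \<notin> T \<longrightarrow> fst v K = 0) \<and>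
    (\<forall>e\<in>mesh_edges T. snd v e \<in> Pedge (k + 1) e) \<and> (\<forall>e. e \<notin> mesh_edges T \<longrightarrow> snd v e = 0) \<and>
    (\<forall>e\<in>mesh_edges T. e \<subseteq> frontier \<Omega> \<longrightarrow> snd v e = 0)"
  by (cases v) (simp add: Sh0_def zero_fun_def)

lemma Sh0_local: "v \<in> Sh0 \<Omega> T k \<Longrightarrow> K \<in> T \<Longrightarrow> v \<in> local_wfun k K"
  using mesh_edgesI unfolding Sh0_iff local_wfun_def by blast

lemma subspace_Sh0: "subspace (Sh0 \<Omega> T k)"
proof (rule subspaceI)
  note Pk = subspace_0[OF subspace_Pk] subspace_add[OF subspace_Pk] subspace_scale[OF subspace_Pk]
  note Pedge = subspace_0[OF Pedge_mesh_edge(2)] subspace_add[OF Pedge_mesh_edge(2)]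
    subspace_scale[OF Pedge_mesh_edge(2)]
  show "0 \<in> Sh0 \<Omega> T k" by (simp add: Sh0_iff Pk Pedge)
  show "v + w \<in> Sh0 \<Omega> T k" if "v \<in> Sh0 \<Omega> T k" "w \<in> Sh0 \<Omega> T k" for v w
    using that by (simp add: Sh0_iff Pk Pedge)
  show "c *\<^sub>R v \<in> Sh0 \<Omega> T k" if "v \<in> Sh0 \<Omega> T k" for c v
    using that by (simp add: Sh0_iff Pk Pedge)
qed

lemma fin_dim_Sh0: "fin_dim (Sh0 \<Omega> T k)"
proof (rule fin_dim_subset)
  show "fin_dim ({f. (\<forall>K\<in>T. f K \<in> Pk k K) \<and> (\<forall>K. K \<notin> T \<longrightarrow> f K = 0)} \<times>
      {f. (\<forall>e\<in>mesh_edges T. f e \<in> Pedge (k + 1) e) \<and> (\<forall>e. e \<notin> mesh_edges T \<longrightarrow> f e = 0)})"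
    using finite_T triangle_T by (intro fin_dim_Times fin_dim_families finite_mesh_edges fin_dim_Pk Pedge_mesh_edge(3)) auto
  show "Sh0 \<Omega> T k \<subseteq> {f. (\<forall>K\<in>T. f K \<in> Pk k K) \<and> (\<forall>K. K \<notin> T \<longrightarrow> f K = 0)} \<times>
      {f. (\<forall>e\<in>mesh_edges T. f e \<in> Pedge (k + 1) e) \<and> (\<forall>e. e \<notin> mesh_edges T \<longrightarrow> f e = 0)}"
  proof
    fix v assume "v \<in> Sh0 \<Omega> T k"
    then show "v \<in> {f. (\<forall>K\<in>T. f K \<in> Pk k K) \<and> (\<forall>K. K \<notin> T \<longrightarrow> f K = 0)} \<times>
      {f. (\<forall>e\<in>mesh_edges T. f e \<in> Pedge (k + 1) e) \<and> (\<forall>e. e \<notin> mesh_edges T \<longrightarrow> f e = 0)}"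
      unfolding Sh0_iff mem_Times_iff by blast
  qed
qed

lemma Mh_iff:
  "q \<in> Mh T k \<longleftrightarrow> (\<forall>K\<in>T. q K \<in> Pk k K) \<and> (\<forall>K. K \<notin> T \<longrightarrow> q K = 0) \<and> (\<Sum>K\<in>T. integral K (q K)) = 0"
  by (simp add: Mh_def zero_fun_def)

lemma integral_Pk_linear_comb:
  assumes "K \<in> T" "p \<in> Pk m K" "q \<in> Pk n K"
  shows "integral K (\<lambda>x. p x + c * q x) = integral K p + c * integral K q"
  using assms triangle_convex_compact(1)[OF triangle_T[OF assms(1)]]
  by (intro integral_linear_comb) (auto intro: Pk_continuous_on)

lemma subspace_Mh: "subspace (Mh T k)"
proof -
  have lin: "p + c *\<^sub>R q \<in> Mh T k" if "p \<in> Mh T k" "q \<in> Mh T k" for p q c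
  proof -
    have "integral K ((p + c *\<^sub>R q) K) = integral K (p K) + c * integral K (q K)" if "K \<in> T" for K
      using integral_Pk_linear_comb[OF that, of "p K" k "q K" k c] \<open>p \<in> Mh T k\<close> \<open>q \<in> Mh T k\<close> that
      by (simp add: Mh_iff plus_fun_def scaleR_fun_def)
    then have "(\<Sum>K\<in>T. integral K ((p + c *\<^sub>R q) K)) = (\<Sum>K\<in>T. integral K (p K)) + c * (\<Sum>K\<in>T. integral K (q K))"
      by (simp add: sum.distrib sum_distrib_left)
    then show ?thesis
      using that by (auto simp: Mh_iff intro: subspace_add[OF subspace_Pk] subspace_scale[OF subspace_Pk])
  qed
  have 0: "0 \<in> Mh T k" by (auto simp: Mh_iff subspace_0 zero_fun_def[symmetric]) (simp add: zero_fun_def)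
  show ?thesis
  proof (rule subspaceI[OF 0])
    show "p + q \<in> Mh T k" if "p \<in> Mh T k" "q \<in> Mh T k" for p q using lin[OF that, of 1] by simp
    show "c *\<^sub>R q \<in> Mh T k" if "q \<in> Mh T k" for q c using lin[OF 0 that] by simp
  qed
qed

lemma fin_dim_Mh: "fin_dim (Mh T k)"
proof (rule fin_dim_subset)
  show "fin_dim {f. (\<forall>K\<in>T. f K \<in> Pk k K) \<and> (\<forall>K. K \<notin> T \<longrightarrow> f K = 0)}"
    using finite_T by (intro fin_dim_families) auto
  show "Mh T k \<subseteq> {f. (\<forall>K\<in>T. f K \<in> Pk k K) \<and> (\<forall>K. K \<notin> T \<longrightarrow> f K = 0)}"
    by (auto simp: Mh_iff)
qed

lemma Vh_local:
  assumes "v \<in> Vh \<Omega> T k" "K \<in> T"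
  shows "fst v \<in> local_wfun k K" "snd v \<in> local_wfun k K"
  using assms Sh0_local by (auto simp: Vh_def)

section \<open>The bilinear forms on the finite element spaces\<close>

lemma wgrad_continuous_on:
  assumes "v \<in> Sh0 \<Omega> T k" "K \<in> T" shows "continuous_on K (wgrad k K v)"
  using wgrad_props(1)[OF triangle_T[OF assms(2)] Sh0_local[OF assms]] vPk_continuous_on by blast

lemma wgrad_Sh0:
  assumes "v \<in> Sh0 \<Omega> T k" "w \<in> Sh0 \<Omega> T k" "K \<in> T"
  shows "wgrad k K (v + c *\<^sub>R w) = wgrad k K v + c *\<^sub>R wgrad k K w"
  using wgrad_linear[OF triangle_T[OF assms(3)], of k] Sh0_local[OF _ assms(3)] assms(1,2)
  unfolding linear_on_set_def by blast

lemma ah_sym: "ah k T u v = ah k T v u"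
  by (simp add: ah_def inner_commute)

lemma ah_linear:
  assumes w: "w \<in> Vh \<Omega> T k"
  shows "linear_on_set (Vh \<Omega> T k) (\<lambda>u. ah k T u w)"
  unfolding linear_on_set_def
proof (intro ballI allI)
  fix u v c assume uv: "u \<in> Vh \<Omega> T k" "v \<in> Vh \<Omega> T k"
  have parts: "fst x \<in> Sh0 \<Omega> T k" "snd x \<in> Sh0 \<Omega> T k" if "x \<in> Vh \<Omega> T k" for x
    using that by (auto simp: Vh_def)
  let ?f = "\<lambda>u K x. wgrad k K (fst u) x \<bullet> wgrad k K (fst w) x + wgrad k K (snd u) x \<bullet> wgrad k K (snd w) x"
  have "integral K (?f (u + c *\<^sub>R v) K) = integral K (?f u K) + c * integral K (?f v K)" if K: "K \<in> T" for K
  proof -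
    have "?f (u + c *\<^sub>R v) K = (\<lambda>x. ?f u K x + c * ?f v K x)"
      using wgrad_Sh0[OF parts(1)[OF uv(1)] parts(1)[OF uv(2)] K] wgrad_Sh0[OF parts(2)[OF uv(1)] parts(2)[OF uv(2)] K]
      by (simp add: inner_add_left algebra_simps)
    then show ?thesis
      using triangle_convex_compact(1)[OF triangle_T[OF K]]
      by (simp only:) (intro integral_linear_comb continuous_intros wgrad_continuous_on K parts uv w)
  qed
  then show "ah k T (u + c *\<^sub>R v) w = ah k T u w + c *\<^sub>R ah k T v w"
    by (simp add: ah_def sum.distrib sum_distrib_left)
qed

text \<open>Removes the weak divergence from \<open>bh\<close> altogether; linearity in the velocity
  and injectivity in the pressure are derived from this form.\<close>

lemma bh_altdef:
  assumes v: "v \<in> Vh \<Omega> T k" and p: "\<And>K. K \<in> T \<Longrightarrow> P K \<in> poly2 k" "\<And>K. K \<in> T \<Longrightarrow> p K = restrict0 K (P K)"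
  shows "bh k T p v = (\<Sum>K\<in>T. wdiv_rhs K v (P K))"
  unfolding bh_def using p integral_Pk_wdiv triangle_T Vh_local[OF v] by (intro sum.cong) auto

lemma Mh_polynomials:
  assumes "p \<in> Mh T k"
  obtains P where "\<And>K. K \<in> T \<Longrightarrow> P K \<in> poly2 k" "\<And>K. K \<in> T \<Longrightarrow> p K = restrict0 K (P K)"
proof -
  have "\<forall>K\<in>T. \<exists>P\<in>poly2 k. p K = restrict0 K P" using assms by (auto simp: Mh_iff Pk_eq)
  then show ?thesis using that by metis
qed

lemma bh_linear:
  assumes p: "p \<in> Mh T k"
  shows "linear_on_set (Vh \<Omega> T k) (\<lambda>v. bh k T p v)"
  unfolding linear_on_set_def
proof (intro ballI allI)
  fix v w c assume vw: "v \<in> Vh \<Omega> T k" "w \<in> Vh \<Omega> T k"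
  obtain P where P: "\<And>K. K \<in> T \<Longrightarrow> P K \<in> poly2 k" "\<And>K. K \<in> T \<Longrightarrow> p K = restrict0 K (P K)"
    using Mh_polynomials[OF p] by blast
  have sum: "v + c *\<^sub>R w \<in> Vh \<Omega> T k"
    using vw subspace_Sh0 unfolding Vh_def by (intro subspace_add subspace_scale subspace_Times)
  have "wdiv_rhs K (v + c *\<^sub>R w) (P K) = wdiv_rhs K v (P K) + c * wdiv_rhs K w (P K)" if K: "K \<in> T" for K
  proof -
    have "v \<in> local_wfun k K \<times> local_wfun k K" "w \<in> local_wfun k K \<times> local_wfun k K"
      using Vh_local[OF vw(1) K] Vh_local[OF vw(2) K] by (simp_all add: mem_Times_iff)
    then show ?thesis
      using wdiv_rhs_linear[OF triangle_T[OF K] P(1)[OF K], of k]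
      unfolding linear_on_set_def real_scaleR_def by blast
  qed
  then show "bh k T p (v + c *\<^sub>R w) = bh k T p v + c *\<^sub>R bh k T p w"
    using bh_altdef[where P = P and p = p] P vw sum by (simp add: sum.distrib sum_distrib_left)
qed

lemma bh_linear_pressure:
  assumes v: "v \<in> Vh \<Omega> T k"
  shows "linear_on_set (Mh T k) (\<lambda>p. bh k T p v)"
  unfolding linear_on_set_def
proof (intro ballI allI)
  fix p q c assume pq: "p \<in> Mh T k" "q \<in> Mh T k"
  have "integral K (\<lambda>x. (p + c *\<^sub>R q) K x * wdiv k K v x) =
      integral K (\<lambda>x. p K x * wdiv k K v x) + c * integral K (\<lambda>x. q K x * wdiv k K v x)" if K: "K \<in> T" for K
  proof -
    have "p K \<in> Pk k K" "q K \<in> Pk k K" using pq K by (auto simp: Mh_iff)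
    then have "integral K (\<lambda>x. p K x * wdiv k K v x + c * (q K x * wdiv k K v x)) =
        integral K (\<lambda>x. p K x * wdiv k K v x) + c * integral K (\<lambda>x. q K x * wdiv k K v x)"
      using triangle_convex_compact(1)[OF triangle_T[OF K]] wdiv_props(1)[OF triangle_T[OF K] Vh_local[OF v K]]
      by (intro integral_linear_comb continuous_intros Pk_continuous_on)
    then show ?thesis by (simp add: distrib_right mult.assoc)
  qed
  then show "bh k T (p + c *\<^sub>R q) v = bh k T p v + c *\<^sub>R bh k T q v"
    by (simp add: bh_def sum.distrib sum_distrib_left)
qed

section \<open>Uniqueness of velocity and pressure\<close>

lemma ah_definite:
  assumes u: "u \<in> Vh \<Omega> T k" and 0: "ah k T u u = 0"
  shows "u = 0"
proof -
  have parts: "fst u \<in> Sh0 \<Omega> T k" "snd u \<in> Sh0 \<Omega> T k" using u by (auto simp: Vh_def)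
  let ?f = "\<lambda>K x. wgrad k K (fst u) x \<bullet> wgrad k K (fst u) x + wgrad k K (snd u) x \<bullet> wgrad k K (snd u) x"
  have cont: "continuous_on K (?f K)" if "K \<in> T" for K
    by (intro continuous_intros wgrad_continuous_on parts that)
  have "\<forall>K\<in>T. integral K (?f K) = 0"
  proof (subst sum_nonneg_eq_0_iff[symmetric, OF finite_T])
    fix K assume "K \<in> T"
    then show "0 \<le> integral K (?f K)"
      using integral_compact(3)[OF triangle_convex_compact(1)[OF triangle_T] cont] by (intro integral_nonneg) auto
  qed (use 0 in \<open>simp add: ah_def\<close>)
  then have grad0: "wgrad k K (fst u) x = 0 \<and> wgrad k K (snd u) x = 0" if "K \<in> T" "x \<in> interior K" for K x
  proof -
    have "?f K x = 0"
      using \<open>\<forall>K\<in>T. integral K (?f K) = 0\<close> that triangle_convex_compact(1)[OF triangle_T] cont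
      by (intro integral_nonneg_eq_0[of K "?f K"]) auto
    then show ?thesis by (simp add: add_nonneg_eq_0_iff)
  qed
  have zero: "w = 0" if w: "w \<in> Sh0 \<Omega> T k" and g: "\<And>K x. K \<in> T \<Longrightarrow> x \<in> interior K \<Longrightarrow> wgrad k K w x = 0" for w
  proof -
    have "\<exists>\<gamma>. (\<forall>x\<in>K. fst w K x = \<gamma>) \<and> (\<forall>e\<in>edges K. \<forall>x\<in>e. snd w e x = \<gamma>)" if K: "K \<in> T" for K
    proof (rule wgrad_kernel[OF triangle_T[OF K] Sh0_local[OF w K]])
      fix q assume q: "q \<in> vpoly2 (k + 1)"
      have "wgrad_rhs K w q = integral K (\<lambda>x. wgrad k K w x \<bullet> q x)"
        using wgrad_props(2)[OF triangle_T[OF K] Sh0_local[OF w K] q] by simp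
      \<comment> \<open>The weak gradient is known to vanish only in the interior; the frontier of a
        convex set is negligible.\<close>
      also have "\<dots> = integral (interior K) (\<lambda>x. wgrad k K w x \<bullet> q x)"
        using triangle_convex_compact(1,2)[OF triangle_T[OF K]]
        by (intro integral_subset_negligible[symmetric])
          (auto simp: interior_subset frontier_def compact_imp_closed closure_closed
            intro: negligible_subset[OF negligible_convex_frontier[of K]])
      also have "\<dots> = integral (interior K) (\<lambda>x. 0)" using g[OF K] by (intro integral_cong) simp
      finally show "wgrad_rhs K w q = 0" by simp
    qed
    then obtain \<gamma> where \<gamma>: "\<And>K x. K \<in> T \<Longrightarrow> x \<in> K \<Longrightarrow> fst w K x = \<gamma> K"
      "\<And>K e x. K \<in> T \<Longrightarrow> e \<in> edges K \<Longrightarrow> x \<in> e \<Longrightarrow> snd w e x = \<gamma> K" by metis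
    have nonempty: "\<exists>x. x \<in> e" if "K \<in> T" "e \<in> edges K" for K e
      using triangle_edge[OF triangle_T[OF that(1)] that(2)] ends_in_segment(1) by metis
    \<comment> \<open>Triangles with a common edge share the value on it, so the zero set of
      \<open>\<gamma>\<close> is closed under crossing edges; a boundary edge makes it
      nonempty.\<close>
    have "{K \<in> T. \<gamma> K = 0} = T"
    proof (rule edge_connected)
      obtain K e where Ke: "K \<in> T" "e \<in> edges K" "e \<subseteq> frontier \<Omega>" using boundary_edge_exists by blast
      then have "snd w e = 0" using w mesh_edgesI unfolding Sh0_iff by blast
      moreover obtain x where "x \<in> e" using nonempty Ke by blast
      ultimately have "\<gamma> K = 0" using \<gamma>(2)[OF Ke(1,2)] by force
      then show "{K \<in> T. \<gamma> K = 0} \<noteq> {}" using Ke by blast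
    next
      fix K K' e assume *: "K \<in> {K \<in> T. \<gamma> K = 0}" "K' \<in> T" "e \<in> edges K" "e \<in> edges K'"
      then obtain x where "x \<in> e" using nonempty by blast
      then have "\<gamma> K' = \<gamma> K" using \<gamma>(2)[of K e x] \<gamma>(2)[of K' e x] * by simp
      then show "K' \<in> {K \<in> T. \<gamma> K = 0}" using * by simp
    qed auto
    then have \<gamma>0: "\<gamma> K = 0" if "K \<in> T" for K using that by blast
    \<comment> \<open>Equality of functions also concerns points outside the triangle, where the
      extension by zero decides.\<close>
    have "fst w K x = 0" for K x
    proof (cases "K \<in> T \<and> x \<in> K")
      case False
      have "fst w K = 0 \<or> fst w K \<in> restrict0 K ` poly2 k \<and> K \<in> T"
        using w by (auto simp: Sh0_iff Pk_eq)
      then show ?thesis using False by (auto simp: restrict0_def)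
    qed (use \<gamma>(1) \<gamma>0 in simp)
    moreover have "snd w e x = 0" for e x
    proof (cases "e \<in> mesh_edges T \<and> x \<in> e")
      case True
      then obtain K where "K \<in> T" "e \<in> edges K" "x \<in> e" by (auto simp: mesh_edges_def)
      then show ?thesis using \<gamma>(2) \<gamma>0 by simp
    next
      case False
      have "snd w e = 0 \<or> snd w e \<in> restrict0 e ` poly2 (k + 1) \<and> e \<in> mesh_edges T"
      proof (cases "e \<in> mesh_edges T")
        case True
        then have "snd w e \<in> Pedge (k + 1) e" using w unfolding Sh0_iff by blast
        then show ?thesis using True Pedge_mesh_edge(1)[OF True, of "k + 1"] by blast
      qed (use w in \<open>simp add: Sh0_iff\<close>)
      then show ?thesis using False by (auto simp: restrict0_def)
    qed
    ultimately show "w = 0" by (simp add: prod_eq_iff fun_eq_iff)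
  qed
  show ?thesis using zero[OF parts(1)] zero[OF parts(2)] grad0 by (simp add: prod_eq_iff)
qed

end

context mesh
begin

lemma single_wfun_Vh:
  assumes f: "\<And>K. K \<in> T \<Longrightarrow> f K \<in> poly2 k" and g: "\<And>K. K \<in> T \<Longrightarrow> g K \<in> poly2 k"
  shows "(((\<lambda>K. if K \<in> T then restrict0 K (f K) else 0), 0), ((\<lambda>K. if K \<in> T then restrict0 K (g K) else 0), 0)) \<in> Vh \<Omega> T k"
proof -
  have "((\<lambda>K. if K \<in> T then restrict0 K (h K) else 0), 0) \<in> Sh0 \<Omega> T k"
    if "\<And>K. K \<in> T \<Longrightarrow> h K \<in> poly2 k" for h
    using that subspace_0[OF Pedge_mesh_edge(2)] by (auto simp: Sh0_iff Pk_eq)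
  then show ?thesis using f g by (simp add: Vh_def)
qed

text \<open>A value attached to one global edge is automatically single-valued from both sides, and
  an edge not contained in the frontier leaves the boundary condition intact.\<close>

lemma edge_wfun_Vh:
  assumes e: "e \<in> mesh_edges T" "\<not> e \<subseteq> frontier \<Omega>"
  shows "((0, (\<lambda>e'. if e' = e then restrict0 e (\<lambda>x. n$1) else 0)), (0, (\<lambda>e'. if e' = e then restrict0 e (\<lambda>x. n$2) else 0)))
    \<in> Vh \<Omega> T k"
proof -
  have "(0, (\<lambda>e'. if e' = e then restrict0 e (\<lambda>x. c) else 0)) \<in> Sh0 \<Omega> T k" for c
  proof -
    have "restrict0 e (\<lambda>x. c) \<in> Pedge (k + 1) e"
      unfolding Pedge_mesh_edge(1)[OF e(1)] by (intro imageI poly2_const)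
    then show ?thesis
      unfolding Sh0_iff using e subspace_0[OF Pedge_mesh_edge(2)] subspace_0[OF subspace_Pk] by auto
  qed
  then show ?thesis by (simp add: Vh_def)
qed

text \<open>Tested first with \<open>v0 = \<nabla>p\<close> and \<open>vb = 0\<close>, then, for \<open>p\<close> constant on each triangle, with
  the constant normal vector on a single interior edge, which isolates the jump of \<open>p\<close>.\<close>

lemma bh_injective:
  assumes p: "p \<in> Mh T k" and 0: "\<And>v. v \<in> Vh \<Omega> T k \<Longrightarrow> bh k T p v = 0"
  shows "p = 0"
proof -
  obtain P where P: "\<And>K. K \<in> T \<Longrightarrow> P K \<in> poly2 k" "\<And>K. K \<in> T \<Longrightarrow> p K = restrict0 K (P K)"
    using Mh_polynomials[OF p] by blast
  have "\<exists>\<gamma>. P K = (\<lambda>x. \<gamma>)" if K: "K \<in> T" for K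
  proof -
    let ?g = "\<lambda>i K x. grad2 (P K) x $ i"
    have g: "?g i K \<in> poly2 k" if "K \<in> T" for i K
    proof -
      have "?g i K \<in> poly2 (k - 1)" unfolding grad2_def using poly2_derivative[OF P(1)[OF that]] by simp
      then show ?thesis by (rule subsetD[OF poly2_mono, rotated]) simp
    qed
    let ?v = "(((\<lambda>K. if K \<in> T then restrict0 K (?g 1 K) else 0), 0), ((\<lambda>K. if K \<in> T then restrict0 K (?g 2 K) else 0), 0)) :: wfun \<times> wfun"
    have v: "?v \<in> Vh \<Omega> T k" using g by (intro single_wfun_Vh)
    have edge0: "edge_int e (\<lambda>x. (vec2 0 0 \<bullet> n) * q x) = 0" if L: "e \<in> edges L" "L \<in> T" for e n q L
    proof -
      obtain a b where "a \<noteq> b" "e = closed_segment a b" using triangle_edge[OF triangle_T[OF L(2)] L(1)] .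
      then show ?thesis by (simp add: inner_pt edge_int_segment)
    qed
    have wdiv: "wdiv_rhs L ?v (P L) = - integral L (\<lambda>x. grad2 (P L) x \<bullet> grad2 (P L) x)" if "L \<in> T" for L
    proof -
      have "integral L (\<lambda>x. vec2 (fst (fst ?v) L x) (fst (snd ?v) L x) \<bullet> grad2 (P L) x) =
          integral L (\<lambda>x. grad2 (P L) x \<bullet> grad2 (P L) x)"
        using that by (intro integral_cong) (simp add: restrict0_def vec2_eq)
      then show ?thesis unfolding wdiv_rhs_def using edge0 that by simp
    qed
    have cont: "continuous_on L (\<lambda>x. grad2 (P L) x \<bullet> grad2 (P L) x)" if "L \<in> T" for L
      by (intro continuous_intros grad2_continuous_on[OF P(1)[OF that]])
    \<comment> \<open>With no edge part the form is minus the sum of the squared gradient norms, so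
      each of these vanishes separately.\<close>
    have "(\<Sum>L\<in>T. integral L (\<lambda>x. grad2 (P L) x \<bullet> grad2 (P L) x)) = 0"
    proof -
      have "bh k T p ?v = (\<Sum>L\<in>T. wdiv_rhs L ?v (P L))" by (rule bh_altdef[OF v P])
      also have "\<dots> = (\<Sum>L\<in>T. - integral L (\<lambda>x. grad2 (P L) x \<bullet> grad2 (P L) x))"
        by (intro sum.cong refl) (rule wdiv)
      finally show ?thesis using 0[OF v] by (simp add: sum_negf)
    qed
    moreover have "0 \<le> integral L (\<lambda>x. grad2 (P L) x \<bullet> grad2 (P L) x)" if "L \<in> T" for L
      using integral_compact(3)[OF triangle_convex_compact(1)[OF triangle_T[OF that]] cont[OF that]]
      by (intro integral_nonneg) auto
    ultimately have "integral K (\<lambda>x. grad2 (P K) x \<bullet> grad2 (P K) x) = 0"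
      using K sum_nonneg_eq_0_iff[OF finite_T, of "\<lambda>L. integral L (\<lambda>x. grad2 (P L) x \<bullet> grad2 (P L) x)"] by simp
    then have "grad2 (P K) x \<bullet> grad2 (P K) x = 0" if "x \<in> interior K" for x
      using that by (intro integral_nonneg_eq_0[OF triangle_convex_compact(1)[OF triangle_T[OF K]] cont[OF K]]) auto
    then have int0: "?g i K x = 0" if "x \<in> interior K" for i x using that by simp
    have "?g i K = (\<lambda>x. 0)" for i
      using triangle_convex_compact(3)[OF triangle_T[OF K]] int0
      by (intro poly2_eq_0_if_open[OF g[OF K], of "interior K"]) auto
    then have "grad2 (P K) x = 0" for x by (simp add: vec_eq_iff) metis
    then have "frechet_derivative (P K) (at x) = (\<lambda>h. 0)" for x
      using frechet_derivative_poly2_components[OF P(1)[OF K]] by (simp add: fun_eq_iff)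
    then have "(P K has_derivative (\<lambda>h. 0)) (at x)" for x
      using poly2_has_derivative[OF P(1)[OF K], of x] by simp
    then have "\<exists>\<gamma>. \<forall>x\<in>UNIV. P K x = \<gamma>" by (intro has_derivative_zero_constant) auto
    then show ?thesis by (simp add: fun_eq_iff)
  qed
  then obtain \<gamma> where \<gamma>: "\<And>K. K \<in> T \<Longrightarrow> P K = (\<lambda>x. \<gamma> K)" by metis
  have jump: "\<gamma> K' = \<gamma> K" if K: "K \<in> T" "K' \<in> T" "K \<noteq> K'" and e: "e \<in> edges K" "e \<in> edges K'" for K K' e
  proof -
    let ?n = "normal K e"
    note shared = shared_edge[OF K e]
    let ?v = "((0, (\<lambda>e'. if e' = e then restrict0 e (\<lambda>x. ?n$1) else 0)), (0, (\<lambda>e'. if e' = e then restrict0 e (\<lambda>x. ?n$2) else 0))) :: wfun \<times> wfun"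
    have v: "?v \<in> Vh \<Omega> T k" by (rule edge_wfun_Vh[OF mesh_edgesI[OF K(1) e(1)] shared(2)])
    obtain a b where ab: "a \<noteq> b" "e = closed_segment a b" using triangle_edge[OF triangle_T[OF K(1)] e(1)] .
    have wdiv: "wdiv_rhs L ?v (P L) = (if e \<in> edges L then norm (b - a) * ((?n \<bullet> normal L e) * \<gamma> L) else 0)"
      if L: "L \<in> T" for L
    proof -
      let ?F = "\<lambda>e'. edge_int e' (\<lambda>x. (vec2 (snd (fst ?v) e' x) (snd (snd ?v) e' x) \<bullet> normal L e') * P L x)"
      have "?F e' = (if e' = e then norm (b - a) * ((?n \<bullet> normal L e) * \<gamma> L) else 0)" if e': "e' \<in> edges L" for e'
      proof (cases "e' = e")
        case True
        have "?F e = edge_int e (\<lambda>x. (?n \<bullet> normal L e) * \<gamma> L)"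
          unfolding ab(2) by (rule edge_int_cong[OF ab(1)]) (simp add: restrict0_def vec2_eq \<gamma>[OF L] ab(2))
        also have "\<dots> = norm (b - a) * ((?n \<bullet> normal L e) * \<gamma> L)"
          unfolding ab(2) edge_int_segment[OF ab(1)] by simp
        finally show ?thesis using True by simp
      next
        case False
        moreover obtain a' b' where "a' \<noteq> b'" "e' = closed_segment a' b'"
          using triangle_edge[OF triangle_T[OF L] e'] .
        ultimately show ?thesis by (simp add: inner_pt edge_int_segment)
      qed
      then have "(\<Sum>e'\<in>edges L. ?F e') = (\<Sum>e'\<in>edges L. if e' = e then norm (b - a) * ((?n \<bullet> normal L e) * \<gamma> L) else 0)"
        by (intro sum.cong) auto
      moreover have "integral L (\<lambda>x. vec2 (fst (fst ?v) L x) (fst (snd ?v) L x) \<bullet> grad2 (P L) x) = 0"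
        by (simp add: inner_pt)
      ultimately show ?thesis
        unfolding wdiv_rhs_def by (simp add: finite_edges[OF triangle_T[OF L]])
    qed
    have "0 = (\<Sum>L\<in>T. wdiv_rhs L ?v (P L))" 
    proof -
      have "bh k T p ?v = (\<Sum>L\<in>T. wdiv_rhs L ?v (P L))" by (rule bh_altdef[OF v P])
      then show ?thesis using 0[OF v] by (simp only:)
    qed
    also have "\<dots> = (\<Sum>L\<in>T. if e \<in> edges L then norm (b - a) * ((?n \<bullet> normal L e) * \<gamma> L) else 0)"
      by (intro sum.cong) (simp_all only: wdiv)
    also have "\<dots> = (\<Sum>L\<in>{L \<in> T. e \<in> edges L}. norm (b - a) * ((?n \<bullet> normal L e) * \<gamma> L))"
      by (simp add: sum.inter_filter finite_T)
    \<comment> \<open>The two triangles at the edge see opposite unit normals, so the sum is the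
      edge length times the jump.\<close>
    also have "\<dots> = norm (b - a) * (\<gamma> K - \<gamma> K')"
      unfolding shared(4) using K(3) shared(3)
      by (simp add: shared(1) dot_square_norm algebra_simps)
    finally show ?thesis using ab(1) by simp
  qed
  obtain K0 where K0: "K0 \<in> T" using nonempty_T by blast
  have "{K \<in> T. \<gamma> K = \<gamma> K0} = T"
  proof (rule edge_connected)
    show "{K \<in> T. \<gamma> K = \<gamma> K0} \<noteq> {}" using K0 by blast
    fix K K' e assume "K \<in> {K \<in> T. \<gamma> K = \<gamma> K0}" "K' \<in> T" "K \<noteq> K'" "e \<in> edges K" "e \<in> edges K'"
    then show "K' \<in> {K \<in> T. \<gamma> K = \<gamma> K0}" using jump[of K K' e] by simp
  qed blast
  then have const: "\<gamma> K = \<gamma> K0" if "K \<in> T" for K using that by blast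
  \<comment> \<open>The zero-mean condition is multiplied by the constant itself, which turns it
    into a vanishing sum of nonnegative integrals.\<close>
  have int_sq: "(\<Sum>K\<in>T. integral K (\<lambda>x. \<gamma> K0 * \<gamma> K0)) = 0"
  proof -
    have "integral K (\<lambda>x. \<gamma> K0 * \<gamma> K0) = \<gamma> K0 * integral K (p K)" if "K \<in> T" for K
    proof -
      have "integral K (p K) = integral K (\<lambda>x. \<gamma> K0)"
        using P(2)[OF that] \<gamma>[OF that] const[OF that] by (intro integral_cong) (simp add: restrict0_def)
      then show ?thesis by simp
    qed
    then have "(\<Sum>K\<in>T. integral K (\<lambda>x. \<gamma> K0 * \<gamma> K0)) = (\<Sum>K\<in>T. \<gamma> K0 * integral K (p K))"
      by (rule sum.cong[OF refl])
    also have "\<dots> = \<gamma> K0 * (\<Sum>K\<in>T. integral K (p K))" by (simp only: sum_distrib_left)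
    also have "\<dots> = 0" using p by (simp add: Mh_iff)
    finally show ?thesis .
  qed
  have "0 \<le> integral K (\<lambda>x. \<gamma> K0 * \<gamma> K0)" if "K \<in> T" for K
    using triangle_convex_compact(1)[OF triangle_T[OF that]] by (intro integral_nonneg integral_compact(3)) auto
  then have int0: "integral K0 (\<lambda>x. \<gamma> K0 * \<gamma> K0) = 0"
    using int_sq K0 sum_nonneg_eq_0_iff[OF finite_T, of "\<lambda>K. integral K (\<lambda>x. \<gamma> K0 * \<gamma> K0)"] by blast
  obtain x where "x \<in> interior K0" using triangle_convex_compact(3)[OF triangle_T[OF K0]] by blast
  then have "\<gamma> K0 * \<gamma> K0 = 0"
    using integral_nonneg_eq_0[OF triangle_convex_compact(1)[OF triangle_T[OF K0]] _ _ int0] by simp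
  then have "p K = 0" if "K \<in> T" for K
    using P(2)[OF that] \<gamma>[OF that] const[OF that] by (simp add: restrict0_def zero_fun_def)
  moreover have "p K = 0" if "K \<notin> T" for K using p that by (simp add: Mh_iff)
  ultimately show "p = 0" by (metis ext zero_fun_apply)
qed

text \<open>The functions in \<open>V\<^sub>h\<close> live on the closed triangles, whereas \<open>f\<close> is only controlled on the
  open domain; the difference is negligible.\<close>

lemma integrable_load:
  assumes f: "f measurable_on \<Omega>" "(\<lambda>x. norm (f x) ^ 2) integrable_on \<Omega>"
    and K: "K \<in> T" and w: "continuous_on K w"
  shows "(\<lambda>x. f x \<bullet> (w x :: pt)) integrable_on K"
proof -
  have \<Omega>: "\<Omega> \<in> sets lebesgue" using open_dom by auto
  have Kc: "compact K" using triangle_convex_compact(1)[OF triangle_T[OF K]] .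
  have Kl: "K \<in> sets lebesgue" using Kc by (simp add: compact_imp_closed borel_closed)
  \<comment> \<open>On a bounded domain square integrability implies integrability:
    \<open>1 + norm (f x) ^ 2\<close> is an integrable majorant, by expanding the square of
    \<open>norm (f x) - 1\<close>.\<close>
  have dom: "(\<lambda>x. 1 + norm (f x) ^ 2) integrable_on \<Omega>"
    using f(2) bounded_set_imp_lmeasurable[OF bounded_dom \<Omega>]
    by (intro integrable_add) (auto simp: integrable_on_const)
  have "f absolutely_integrable_on \<Omega>"
  proof (rule measurable_bounded_by_integrable_imp_absolutely_integrable[OF _ \<Omega> dom])
    show "f \<in> borel_measurable (lebesgue_on \<Omega>)"
      using f(1) measurable_on_iff_borel_measurable[OF \<Omega>] by blast
    fix x
    have "0 \<le> (norm (f x) - 1)\<^sup>2" by simp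
    then have "2 * norm (f x) \<le> 1 + (norm (f x))\<^sup>2" by (simp add: power2_diff)
    then show "norm (f x) \<le> 1 + (norm (f x))\<^sup>2" using norm_ge_zero[of "f x"] by linarith
  qed
  then have "f absolutely_integrable_on (K \<inter> \<Omega>)"
    by (rule set_integrable_subset) (use Kl \<Omega> in auto)
  moreover have "K - \<Omega> \<subseteq> frontier \<Omega>" using K Union_T open_dom by (auto simp: frontier_def interior_open)
  then have "negligible {x \<in> K - (K \<inter> \<Omega>). f x \<noteq> 0}"
    by (intro negligible_subset[OF negligible_convex_frontier[OF convex_dom]]) blast
  moreover have "negligible {x \<in> (K \<inter> \<Omega>) - K. f x \<noteq> 0}" 
  proof -
    have empty: "{x \<in> (K \<inter> \<Omega>) - K. f x \<noteq> 0} = {}" by blast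
    show ?thesis unfolding empty by simp
  qed
  ultimately have fK: "f absolutely_integrable_on K"
    using absolutely_integrable_spike_set_eq[where S = K and T = "K \<inter> \<Omega>" and f = f] by blast
  have "w \<in> borel_measurable (lebesgue_on K)" using continuous_imp_measurable_on_sets_lebesgue[OF w Kl] .
  moreover have "bounded (w ` K)" using compact_continuous_image[OF w Kc] compact_imp_bounded by blast
  moreover have "bilinear ((\<bullet>) :: pt \<Rightarrow> pt \<Rightarrow> real)"
    by (simp add: bilinear_conv_bounded_bilinear bounded_bilinear_inner)
  ultimately have "(\<lambda>x. w x \<bullet> f x) absolutely_integrable_on K"
    using absolutely_integrable_bounded_measurable_product[OF _ _ Kl _ fK, of "(\<bullet>)" w] by blast
  then show ?thesis by (simp add: inner_commute set_lebesgue_integral_eq_integral(1))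
qed

lemma rhs_linear:
  assumes f: "f measurable_on \<Omega>" "(\<lambda>x. norm (f x) ^ 2) integrable_on \<Omega>"
  shows "linear_on_set (Vh \<Omega> T k) (rhs T f)"
  unfolding linear_on_set_def
proof (intro ballI allI)
  fix v w c assume vw: "v \<in> Vh \<Omega> T k" "w \<in> Vh \<Omega> T k"
  let ?V = "\<lambda>v K x. vec2 (fst (fst v) K x) (fst (snd v) K x)"
  have "integral K (\<lambda>x. f x \<bullet> ?V (v + c *\<^sub>R w) K x) =
      integral K (\<lambda>x. f x \<bullet> ?V v K x) + c * integral K (\<lambda>x. f x \<bullet> ?V w K x)" if K: "K \<in> T" for K
  proof -
    have i: "(\<lambda>x. f x \<bullet> ?V u K x) integrable_on K" if "u \<in> Vh \<Omega> T k" for u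
      using local_wfun_continuous(1)[OF triangle_T[OF K]] Vh_local[OF that K]
      by (intro integrable_load[OF f K] continuous_on_vec2) auto
    have eq: "(\<lambda>x. f x \<bullet> ?V (v + c *\<^sub>R w) K x) = (\<lambda>x. f x \<bullet> ?V v K x + c * (f x \<bullet> ?V w K x))"
      by (simp add: inner_pt algebra_simps)
    show ?thesis
      unfolding eq using integral_add[OF i[OF vw(1)] integrable_cmul[OF i[OF vw(2)], of c]] by simp
  qed
  then show "rhs T f (v + c *\<^sub>R w) = rhs T f v + c *\<^sub>R rhs T f w"
    by (simp add: rhs_def sum.distrib sum_distrib_left)
qed

lemma well_posed:
  assumes f: "f measurable_on \<Omega>" "(\<lambda>x. norm (f x) ^ 2) integrable_on \<Omega>"
  shows "\<exists>!up. fst up \<in> Vh \<Omega> T k \<and> snd up \<in> Mh T k \<and>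
           (\<forall>v\<in>Vh \<Omega> T k. ah k T (fst up) v - bh k T (snd up) v = rhs T f v) \<and>
           (\<forall>q\<in>Mh T k. bh k T q (fst up) = 0)"
proof -
  let ?X = "Vh \<Omega> T k \<times> Mh T k"
  \<comment> \<open>The second equation enters with a plus sign, opposite to the pressure term of
    the first. On the diagonal the coupling terms cancel and only the energy of the velocity
    remains.\<close>
  define B where "B = (\<lambda>x y. ah k T (fst x) (fst y) - bh k T (snd x) (fst y) + bh k T (snd y) (fst x))"
  have V: "subspace (Vh \<Omega> T k)" "fin_dim (Vh \<Omega> T k)"
    unfolding Vh_def by (intro subspace_Times fin_dim_Times subspace_Sh0 fin_dim_Sh0)+
  note M = subspace_Mh[of k] fin_dim_Mh[of k]
  have V0: "0 \<in> Vh \<Omega> T k" and M0: "0 \<in> Mh T k" using V(1) M(1) by (simp_all add: subspace_0)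
  note a = linear_on_setD[OF ah_linear V(1)] and b = linear_on_setD[OF bh_linear V(1)]
    and b' = linear_on_setD[OF bh_linear_pressure M(1)] and r = linear_on_setD[OF rhs_linear[OF f] V(1)]
  have a': "u \<in> Vh \<Omega> T k \<Longrightarrow> v \<in> Vh \<Omega> T k \<Longrightarrow> ah k T w (u + v) = ah k T w u + ah k T w v"
    "u \<in> Vh \<Omega> T k \<Longrightarrow> ah k T w (c *\<^sub>R u) = c * ah k T w u" "ah k T w 0 = 0"
    if "w \<in> Vh \<Omega> T k" for u v w c
    using a[OF that] by (simp_all add: ah_sym[of k w])
  have ex1: "\<exists>!x. x \<in> ?X \<and> (\<forall>y\<in>?X. B x y = rhs T f (fst y))"
  proof (rule nondegenerate_form_ex1)
    show "subspace ?X" using V(1) M(1) by (rule subspace_Times)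
    show "fin_dim ?X" using V(2) M(2) by (rule fin_dim_Times)
    fix x assume x: "x \<in> ?X" and B0: "\<And>y. y \<in> ?X \<Longrightarrow> B x y = 0"
    have "ah k T (fst x) (fst x) = 0" using B0[OF x] by (simp add: B_def)
    then have u0: "fst x = 0" using ah_definite x by auto
    \<comment> \<open>With the velocity gone, the first equation says that the pressure annihilates
      every weak divergence.\<close>
    have "bh k T (snd x) v = 0" if v: "v \<in> Vh \<Omega> T k" for v
    proof -
      have "B x (v, 0) = 0" using v M0 by (intro B0) simp
      then show ?thesis using a(2)[OF v] b(2)[OF M0] by (simp add: B_def u0)
    qed
    then have "snd x = 0" using bh_injective x by auto
    then show "x = 0" using u0 by (simp add: prod_eq_iff)
  next
    fix x y z assume "x \<in> ?X" "y \<in> ?X" "z \<in> ?X"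
    then have m: "fst x \<in> Vh \<Omega> T k" "fst y \<in> Vh \<Omega> T k" "fst z \<in> Vh \<Omega> T k"
      "snd x \<in> Mh T k" "snd y \<in> Mh T k" "snd z \<in> Mh T k" by auto
    show "B (x + y) z = B x z + B y z" by (simp add: B_def a(1) b(1) b'(1) m)
    show "B z (x + y) = B z x + B z y" by (simp add: B_def a'(1) b(1) b'(1) m)
    show "rhs T f (fst (x + y)) = rhs T f (fst x) + rhs T f (fst y)" by (simp add: r(1) m)
  next
    fix c x z assume "x \<in> ?X" "z \<in> ?X"
    then have m: "fst x \<in> Vh \<Omega> T k" "fst z \<in> Vh \<Omega> T k" "snd x \<in> Mh T k" "snd z \<in> Mh T k" by auto
    show "B (c *\<^sub>R x) z = c * B x z" by (simp add: B_def a(3) b(3) b'(3) m algebra_simps)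
    show "B z (c *\<^sub>R x) = c * B z x" by (simp add: B_def a'(2) b(3) b'(3) m algebra_simps)
  next
    fix c x assume "x \<in> ?X"
    then have "fst x \<in> Vh \<Omega> T k" by auto
    then show "rhs T f (fst (c *\<^sub>R x)) = c * rhs T f (fst x)" by (simp add: r(3))
  qed
  \<comment> \<open>The tests \<open>(v, 0)\<close> and \<open>(0, q)\<close> separate the two
    equations; adding them gives the converse.\<close>
  have equiv: "(\<forall>y\<in>?X. B x y = rhs T f (fst y)) \<longleftrightarrow>
      (\<forall>v\<in>Vh \<Omega> T k. ah k T (fst x) v - bh k T (snd x) v = rhs T f v) \<and> (\<forall>q\<in>Mh T k. bh k T q (fst x) = 0)"
    if x: "x \<in> ?X" for x
  proof
    assume *: "\<forall>y\<in>?X. B x y = rhs T f (fst y)"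
    have xV: "fst x \<in> Vh \<Omega> T k" and xM: "snd x \<in> Mh T k" using x by auto
    show "(\<forall>v\<in>Vh \<Omega> T k. ah k T (fst x) v - bh k T (snd x) v = rhs T f v) \<and> (\<forall>q\<in>Mh T k. bh k T q (fst x) = 0)"
    proof (intro conjI ballI)
      fix v assume "v \<in> Vh \<Omega> T k"
      then show "ah k T (fst x) v - bh k T (snd x) v = rhs T f v"
        using bspec[OF *, of "(v, 0)"] M0 b'(2)[OF xV] by (simp add: B_def)
    next
      fix q assume "q \<in> Mh T k"
      then show "bh k T q (fst x) = 0"
        using bspec[OF *, of "(0, q)"] V0 b(2)[OF xM] a'(3)[OF xV] r(2) by (simp add: B_def)
    qed
  qed (auto simp: B_def)
  have "fst x \<in> Vh \<Omega> T k \<and> snd x \<in> Mh T k \<and>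
      (\<forall>v\<in>Vh \<Omega> T k. ah k T (fst x) v - bh k T (snd x) v = rhs T f v) \<and> (\<forall>q\<in>Mh T k. bh k T q (fst x) = 0) \<longleftrightarrow>
      x \<in> ?X \<and> (\<forall>y\<in>?X. B x y = rhs T f (fst y))" for x
    using equiv[of x] by (auto simp: mem_Times_iff)
  then show ?thesis using ex1 by simp
qed

end

theorem theorem2p1:
  fixes \<Omega> :: "pt set" and T :: "pt set set" and k :: nat and f :: "pt \<Rightarrow> pt"
  assumes "open \<Omega>" and "bounded \<Omega>" and "convex \<Omega>" and "\<Omega> \<noteq> {}"
    and "triangulation \<Omega> T"
    and "f measurable_on \<Omega>" and "(\<lambda>x. norm (f x) ^ 2) integrable_on \<Omega>"
  shows "\<exists>!up. fst up \<in> Vh \<Omega> T k \<and> snd up \<in> Mh T k \<and>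
           (\<forall>v\<in>Vh \<Omega> T k. ah k T (fst up) v - bh k T (snd up) v = rhs T f v) \<and>
           (\<forall>q\<in>Mh T k. bh k T q (fst up) = 0)"
  using mesh.well_posed[OF mesh.intro[OF assms(1-5)] assms(6,7)] .

end
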